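(* For $\lambda\in U\cap Z({\bf B})$ put $k_\lambda=\sup_{\pi(P)=\lambda}k_P$. For every $\lambda_0\in U$ such that $X_{\lambda_0}$ has a period annulus, the minimal order of every bifurcation function associated to $\lambda_0$ is bounded by $k_{\lambda_0}$. Moreover the number $\sup_{\lambda\in U\cap Z({\bf B})}k_\lambda$ is finite.
   Context: Blowup and orders. For the polynomial ideal ${\bf B}=(v_1,\dots,v_N)\subset\mathbb C[\lambda_1,\dots,\lambda_n]$ (the Bautin ideal, see below) with zero set $Z({\bf B})\subset\mathbb C^n$, the blowup $B_{\bf B}\mathbb C^n\subset\mathbb C^n\times\mathbb P^{N-1}$ is the Zariski closure of the graph of $\mathbb C^n\setminus Z({\bf B})\to\mathbb P^{N-1}$, $\lambda\mapsto[v_1(\lambda):\dots:v_N(\lambda)]$, with projection $\pi$ to $\mathbb C^n$ and exceptional locus $E=\pi^{-1}(Z({\bf B}))$. For an arc $\alpha$ on $B_{\bf B}\mathbb C^n$ with $\alpha(0)\in E$, not contained in $E$, with projection $\lambda(\varepsilon)=\pi(\alpha(\varepsilon))$, the order $k(\alpha)$ is the integer $k\geq 1$ with $(v_1(\lambda(\varepsilon)),\dots,v_N(\lambda(\varepsilon)))=\varepsilon^k(p+O(\varepsilon))$, $p\in\mathbb C^N\setminus\{0\}$. For $P\in E$, $k_P=\min_{\alpha(0)=P}k(\alpha)$. Bautin ideal. $X_\lambda$, $\lambda\in\mathbb C^n$, is the family of polynomial planar vector fields of degree at most $d$, parameterized by its coefficients. Let $X_{\lambda_0}$ have an open period annulus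 (a union of periodic orbits homeomorphic to $S^1\times(0,1)$), let $\Sigma$ be a cross-section with coordinate $h$ and let $h_0$ be the coordinate of a point of $\Sigma$. For $\lambda$ near $\lambda_0$ the displacement function is $F(h,\lambda)=\mathcal P_\lambda(h)-h$, with $\mathcal P_\lambda$ the first return map; it is analytic near $(h_0,\lambda_0)$, and $F_k(\lambda)$ denote the coefficients of its Taylor expansion in powers of $h-h_0$. The germ $\mathcal B_{\lambda_0}$ is the ideal of the ring of germs of analytic functions at $\lambda_0$ generated by all the $F_k$. Standing assumptions: there is an open set $U\subset\mathbb C^n$ on which the coefficients $F_k$ define an ideal sheaf with germs $\mathcal B_\lambda$, and polynomials $v_1,\dots,v_N$ generating $\mathcal B_\lambda$ for every $\lambda\in U$; the polynomial ideal ${\bf B}=(v_1,\dots,v_N)$ is the Bautin ideal. Bifurcation function. For an analytic arc $\varepsilon\mapsto\lambda(\varepsilon)$ with $\lambda(0)=\lambda_0$ and $F(h,\lambda(\varepsilon))\not\equiv0$, write $F(h,\lambda(\varepsilon))=\varepsilon^kM_k(h)+O(\varepsilon^{k+1})$, $M_k\not\equiv0$. $M_k$ is the bifurcation function associated to the deformation $X_{\lambda(\varepsilon)}$, and $k$ is its order for that deformation. The bifurcation functions associated to $\lambda_0$ are all functions so obtained from arcs with $\lambda(0)=\lambda_0$; the minimal order of such a function $M$ is the smallest $k$ for which $M$, up to a nonzero multiplicative constant, is the bifurcation function of order $k$ of some deformation $X_{\lambda(\varepsilon)}$ with $\lambda(0)=\lambda_0$. *)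

theory Defs
  imports "HOL-Analysis.Analysis" "HOL-Library.Poly_Mapping"
    "HOL-Library.Extended_Nat" "HOL-Library.Landau_Symbols"
begin

text \<open>The ring \<open>\<complex>[x\<^sub>i | i :: 'x]\<close>: finitely supported coefficient functions on multi-indices,
  with the convolution product of \<^theory>\<open>HOL-Library.Poly_Mapping\<close>.\<close>

type_synonym 'x cpoly = "('x \<Rightarrow>\<^sub>0 nat) \<Rightarrow>\<^sub>0 complex"

definition monom_val :: "('x::finite \<Rightarrow> complex) \<Rightarrow> ('x \<Rightarrow>\<^sub>0 nat) \<Rightarrow> complex" where
  "monom_val x m = (\<Prod>i\<in>UNIV. x i ^ Poly_Mapping.lookup m i)"

definition cpoly_eval :: "'x::finite cpoly \<Rightarrow> ('x \<Rightarrow> complex) \<Rightarrow> complex" where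
  "cpoly_eval f x = (\<Sum>m\<in>Poly_Mapping.keys f. Poly_Mapping.lookup f m * monom_val x m)"

definition ideal_of :: "('N::finite \<Rightarrow> 'n cpoly) \<Rightarrow> 'n cpoly set" where
  "ideal_of v = range (\<lambda>c. \<Sum>j\<in>UNIV. c j * v j)"

definition zero_set :: "'n::finite cpoly set \<Rightarrow> (complex^'n) set" where
  "zero_set I = {x. \<forall>f\<in>I. cpoly_eval f (vec_nth x) = 0}"

definition proj_rel :: "complex^'N \<Rightarrow> complex^'N \<Rightarrow> bool" where
  "proj_rel x y \<longleftrightarrow> x \<noteq> 0 \<and> y \<noteq> 0 \<and> (\<exists>c. c \<noteq> 0 \<and> y = c *s x)"

lemma part_equivp_proj_rel: "part_equivp (proj_rel :: complex^'N \<Rightarrow> complex^'N \<Rightarrow> bool)"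
proof (rule part_equivpI)
  show "\<exists>x :: complex^'N. proj_rel x x"
    by (rule exI[of _ "1"]) (auto simp: proj_rel_def intro!: exI[of _ 1])
  show "symp (proj_rel :: complex^'N \<Rightarrow> complex^'N \<Rightarrow> bool)"
  proof (rule sympI)
    fix x y :: "complex^'N"
    assume "proj_rel x y"
    then obtain c where "x \<noteq> 0" "y \<noteq> 0" "c \<noteq> 0" "y = c *s x"
      by (auto simp: proj_rel_def)
    then show "proj_rel y x"
      by (auto simp: proj_rel_def vector_smult_assoc intro!: exI[of _ "inverse c"])
  qed
  show "transp (proj_rel :: complex^'N \<Rightarrow> complex^'N \<Rightarrow> bool)"
  proof (rule transpI)
    fix x y z :: "complex^'N"
    assume "proj_rel x y" "proj_rel y z"
    then obtain c c' where "x \<noteq> 0" "z \<noteq> 0" "c \<noteq> 0" "c' \<noteq> 0" "z = (c' * c) *s x"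
      by (auto simp: proj_rel_def vector_smult_assoc)
    then show "proj_rel x z"
      unfolding proj_rel_def by (metis mult_eq_0_iff)
  qed
qed

text \<open>The projective space of dimension \<open>CARD('N) - 1\<close>; \<open>proj_class x\<close> is the point with
  homogeneous coordinates \<open>x\<close>, and is meaningful only for \<open>x \<noteq> 0\<close>.\<close>

quotient_type (overloaded) 'N cproj = "complex^'N" / partial: proj_rel
  by (rule part_equivp_proj_rel)

definition proj_class :: "complex^'N \<Rightarrow> 'N cproj" where
  "proj_class x = abs_cproj x"

definition homogeneous_snd :: "nat \<Rightarrow> ('n + 'N::finite) cpoly \<Rightarrow> bool" where
  "homogeneous_snd e f \<longleftrightarrow> (\<forall>m\<in>Poly_Mapping.keys f. (\<Sum>j\<in>UNIV. Poly_Mapping.lookup m (Inr j)) = e)"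

definition zariski_closed :: "((complex^'n) \<times> 'N::finite cproj) set \<Rightarrow> bool" where
  "zariski_closed C \<longleftrightarrow>
     (\<exists>S :: ('n + 'N) cpoly set. (\<forall>f\<in>S. \<exists>e. homogeneous_snd e f) \<and>
        C = {(lam, proj_class x) | lam x.
               x \<noteq> 0 \<and> (\<forall>f\<in>S. cpoly_eval f (case_sum (vec_nth lam) (vec_nth x)) = 0)})"

definition zariski_closure ::
    "((complex^'n) \<times> 'N::finite cproj) set \<Rightarrow> ((complex^'n) \<times> 'N cproj) set" where
  "zariski_closure A = \<Inter>{C. zariski_closed C \<and> A \<subseteq> C}"


definition poly_map :: "('N::finite \<Rightarrow> 'n::finite cpoly) \<Rightarrow> complex^'n \<Rightarrow> complex^'N" where
  "poly_map v lam = (\<chi> j. cpoly_eval (v j) (vec_nth lam))"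

definition blowup :: "('N::finite \<Rightarrow> 'n::finite cpoly) \<Rightarrow> ((complex^'n) \<times> 'N cproj) set" where
  "blowup v = zariski_closure
     ((\<lambda>lam. (lam, proj_class (poly_map v lam))) ` (- zero_set (ideal_of v)))"

definition exceptional :: "('N::finite \<Rightarrow> 'n::finite cpoly) \<Rightarrow> ((complex^'n) \<times> 'N cproj) set" where
  "exceptional v = {P \<in> blowup v. fst P \<in> zero_set (ideal_of v)}"

definition analytic_arc :: "(complex \<Rightarrow> complex^'n) \<Rightarrow> bool" where
  "analytic_arc g \<longleftrightarrow> (\<forall>i. (\<lambda>\<epsilon>. g \<epsilon> $ i) analytic_on {0})"

text \<open>Arcs are germs at \<open>0\<close>; analyticity of the projective component means that it has an
  analytic nowhere vanishing lift to homogeneous coordinates.\<close>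

definition blowup_arc ::
    "('N::finite \<Rightarrow> 'n::finite cpoly) \<Rightarrow> (complex \<Rightarrow> (complex^'n) \<times> 'N cproj) \<Rightarrow> bool" where
  "blowup_arc v \<alpha> \<longleftrightarrow>
     analytic_arc (\<lambda>\<epsilon>. fst (\<alpha> \<epsilon>)) \<and>
     (\<exists>q. analytic_arc q \<and>
        (\<forall>\<^sub>F \<epsilon> in nhds 0. q \<epsilon> \<noteq> 0 \<and> snd (\<alpha> \<epsilon>) = proj_class (q \<epsilon>))) \<and>
     (\<forall>\<^sub>F \<epsilon> in nhds 0. \<alpha> \<epsilon> \<in> blowup v) \<and>
     \<alpha> 0 \<in> exceptional v \<and>
     \<not> (\<forall>\<^sub>F \<epsilon> in nhds 0. \<alpha> \<epsilon> \<in> exceptional v)"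

definition has_arc_order ::
    "('N::finite \<Rightarrow> 'n::finite cpoly) \<Rightarrow> (complex \<Rightarrow> (complex^'n) \<times> 'N cproj) \<Rightarrow> nat \<Rightarrow> bool" where
  "has_arc_order v \<alpha> k \<longleftrightarrow> k \<ge> 1 \<and>
     (\<exists>p :: complex^'N. p \<noteq> 0 \<and>
        (\<forall>j. (\<lambda>\<epsilon>. poly_map v (fst (\<alpha> \<epsilon>)) $ j - \<epsilon> ^ k * p $ j) \<in> O[at 0](\<lambda>\<epsilon>. \<epsilon> ^ (k + 1))))"

text \<open>Orders take values in \<^typ>\<open>enat\<close>, so that a point through which there is no admissible
  arc, or an unbounded set of orders, yields \<open>\<infinity>\<close>.\<close>

definition point_order ::
    "('N::finite \<Rightarrow> 'n::finite cpoly) \<Rightarrow> (complex^'n) \<times> 'N cproj \<Rightarrow> enat" where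
  "point_order v P = Inf {enat k | k \<alpha>. blowup_arc v \<alpha> \<and> \<alpha> 0 = P \<and> has_arc_order v \<alpha> k}"

definition fibre_order :: "('N::finite \<Rightarrow> 'n::finite cpoly) \<Rightarrow> complex^'n \<Rightarrow> enat" where
  "fibre_order v lam = (SUP P\<in>{P \<in> exceptional v. fst P = lam}. point_order v P)"


definition analytic_germ :: "(complex^'n \<Rightarrow> complex) \<Rightarrow> complex^'n \<Rightarrow> bool" where
  "analytic_germ f a \<longleftrightarrow>
     (\<exists>c. \<exists>r>0. \<forall>x\<in>ball a r. ((\<lambda>m. c m * monom_val (vec_nth (x - a)) m) has_sum f x) UNIV)"

definition analytic_germ2 :: "(complex \<Rightarrow> complex^'n \<Rightarrow> complex) \<Rightarrow> complex \<Rightarrow> complex^'n \<Rightarrow> bool" where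
  "analytic_germ2 F h\<^sub>0 a \<longleftrightarrow>
     (\<exists>c. \<exists>r>0. \<forall>h\<in>ball h\<^sub>0 r. \<forall>x\<in>ball a r.
        ((\<lambda>(k, m). c k m * (h - h\<^sub>0) ^ k * monom_val (vec_nth (x - a)) m) has_sum F h x) UNIV)"

text \<open>The ideal generated by \<open>G\<close> in the ring of germs at \<open>a\<close>, as the set of all representatives
  of its elements; equality of two such sets is equality of the ideals.\<close>

definition germ_ideal :: "complex^'n \<Rightarrow> (complex^'n \<Rightarrow> complex) set \<Rightarrow> (complex^'n \<Rightarrow> complex) set" where
  "germ_ideal a G = {f. analytic_germ f a \<and>
     (\<exists>S c. finite S \<and> S \<subseteq> G \<and> (\<forall>g\<in>S. analytic_germ (c g) a) \<and>
        (\<forall>\<^sub>F x in nhds a. f x = (\<Sum>g\<in>S. c g x * g x)))}"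

definition taylor_coeff :: "(complex \<Rightarrow> complex^'n \<Rightarrow> complex) \<Rightarrow> complex \<Rightarrow> nat \<Rightarrow> complex^'n \<Rightarrow> complex" where
  "taylor_coeff F h\<^sub>0 k lam = (deriv ^^ k) (\<lambda>h. F h lam) h\<^sub>0 / fact k"


text \<open>\<open>idx\<close> enumerates the coefficients: if \<open>idx l = (s, i, j)\<close> then \<open>lam $ l\<close> is the coefficient
  of \<open>x^i * y^j\<close> in the first (\<open>s\<close> true) or second (\<open>s\<close> false) component.\<close>

definition coeff_indexing :: "nat \<Rightarrow> ('n::finite \<Rightarrow> bool \<times> nat \<times> nat) \<Rightarrow> bool" where
  "coeff_indexing d idx \<longleftrightarrow> bij_betw idx UNIV {(s, i, j). i + j \<le> d}"

definition vfield ::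
    "('n::finite \<Rightarrow> bool \<times> nat \<times> nat) \<Rightarrow> complex^'n \<Rightarrow> real \<times> real \<Rightarrow> complex \<times> complex" where
  "vfield idx lam z =
     (let comp = (\<lambda>s. \<Sum>l | fst (idx l) = s.
            lam $ l * of_real (fst z) ^ fst (snd (idx l)) * of_real (snd z) ^ snd (snd (idx l)))
      in (comp True, comp False))"

definition cplx :: "real \<times> real \<Rightarrow> complex \<times> complex" where
  "cplx z = (of_real (fst z), of_real (snd z))"

text \<open>Orbits live in the real plane. For arbitrary complex \<open>lam\<close> a period annulus, being open,
  can exist only if \<open>lam\<close> is real.\<close>

definition integral_curve ::
    "('n::finite \<Rightarrow> bool \<times> nat \<times> nat) \<Rightarrow> complex^'n \<Rightarrow> (real \<Rightarrow> real \<times> real) \<Rightarrow> real set \<Rightarrow> bool" where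
  "integral_curve idx lam \<gamma> I \<longleftrightarrow>
     (\<forall>t\<in>I. ((\<lambda>s. cplx (\<gamma> s)) has_vector_derivative vfield idx lam (\<gamma> t)) (at t within I))"

definition periodic_orbit ::
    "('n::finite \<Rightarrow> bool \<times> nat \<times> nat) \<Rightarrow> complex^'n \<Rightarrow> (real \<times> real) set \<Rightarrow> bool" where
  "periodic_orbit idx lam \<O> \<longleftrightarrow>
     (\<exists>\<gamma> T. T > 0 \<and> integral_curve idx lam \<gamma> UNIV \<and> (\<forall>t. \<gamma> (t + T) = \<gamma> t) \<and>
        (\<exists>t. \<gamma> t \<noteq> \<gamma> 0) \<and> \<O> = range \<gamma>)"

definition period_annulus ::
    "('n::finite \<Rightarrow> bool \<times> nat \<times> nat) \<Rightarrow> complex^'n \<Rightarrow> (real \<times> real) set \<Rightarrow> bool" where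
  "period_annulus idx lam A \<longleftrightarrow>
     open A \<and> (\<exists>Orb. (\<forall>\<O>\<in>Orb. periodic_orbit idx lam \<O>) \<and> A = \<Union>Orb) \<and>
     A homeomorphic (sphere (0::complex) 1 \<times> {0<..<1::real})"

text \<open>\<open>\<sigma>\<close> parameterizes the section by its coordinate \<open>h \<in> J\<close>: it is real analytic, injective and
  transversal to the vector field.\<close>

definition cross_section ::
    "('n::finite \<Rightarrow> bool \<times> nat \<times> nat) \<Rightarrow> complex^'n \<Rightarrow> (real \<Rightarrow> real \<times> real) \<Rightarrow> real set \<Rightarrow> bool" where
  "cross_section idx lam \<sigma> J \<longleftrightarrow>
     inj_on \<sigma> J \<and>
     (\<forall>h\<in>J. \<exists>a. \<exists>r>0. \<forall>s\<in>ball h r. (\<lambda>k. (s - h) ^ k *\<^sub>R a k) sums \<sigma> s) \<and>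
     (\<forall>h\<in>J. \<exists>w. (\<sigma> has_vector_derivative w) (at h) \<and>
        fst (cplx w) * snd (vfield idx lam (\<sigma> h)) - snd (cplx w) * fst (vfield idx lam (\<sigma> h)) \<noteq> 0)"

definition annulus_through ::
    "('n::finite \<Rightarrow> bool \<times> nat \<times> nat) \<Rightarrow> complex^'n \<Rightarrow> (real \<Rightarrow> real \<times> real) \<Rightarrow> real \<Rightarrow> bool" where
  "annulus_through idx lam \<sigma> h\<^sub>0 \<longleftrightarrow>
     (\<exists>A. period_annulus idx lam A \<and> \<sigma> h\<^sub>0 \<in> A) \<and>
     (\<exists>r>0. cross_section idx lam \<sigma> {h\<^sub>0 - r<..<h\<^sub>0 + r})"

definition first_return ::
    "('n::finite \<Rightarrow> bool \<times> nat \<times> nat) \<Rightarrow> complex^'n \<Rightarrow> (real \<times> real) set \<Rightarrow>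
      real \<times> real \<Rightarrow> real \<times> real \<Rightarrow> bool" where
  "first_return idx lam S p q \<longleftrightarrow>
     (\<exists>\<gamma> T. T > 0 \<and> integral_curve idx lam \<gamma> {0..T} \<and> \<gamma> 0 = p \<and> \<gamma> T = q \<and> q \<in> S \<and>
        (\<forall>t\<in>{0<..<T}. \<gamma> t \<notin> S))"

text \<open>The germ at \<open>(h\<^sub>0, lam\<^sub>0)\<close> of \<open>F(h, lam) = P\<^sub>l\<^sub>a\<^sub>m(h) - h\<close>. The return map itself is defined for real
  \<open>h\<close> and \<open>lam\<close>; the values of \<open>F\<close> at complex arguments are those of its (unique) analytic
  extension.\<close>

definition displacement ::
    "('n::finite \<Rightarrow> bool \<times> nat \<times> nat) \<Rightarrow> complex^'n \<Rightarrow> (real \<Rightarrow> real \<times> real) \<Rightarrow> real \<Rightarrow>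
      (complex \<Rightarrow> complex^'n \<Rightarrow> complex) \<Rightarrow> bool" where
  "displacement idx lam\<^sub>0 \<sigma> h\<^sub>0 F \<longleftrightarrow>
     analytic_germ2 F (of_real h\<^sub>0) lam\<^sub>0 \<and>
     (\<exists>r>0. cross_section idx lam\<^sub>0 \<sigma> {h\<^sub>0 - r<..<h\<^sub>0 + r} \<and>
       (\<exists>\<delta>>0. \<forall>h lam. \<bar>h - h\<^sub>0\<bar> < \<delta> \<and> dist lam lam\<^sub>0 < \<delta> \<and> (\<forall>i. lam $ i \<in> \<real>) \<longrightarrow>
          (\<exists>h'\<in>{h\<^sub>0 - r<..<h\<^sub>0 + r}.
             first_return idx lam (\<sigma> ` {h\<^sub>0 - r<..<h\<^sub>0 + r}) (\<sigma> h) (\<sigma> h') \<and>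
             F (of_real h) lam = of_real (h' - h))))"


text \<open>\<open>M\<close> is the bifurcation function of order \<open>k\<close> of some deformation of \<open>lam\<^sub>0\<close>; \<open>M\<close> matters only as
  a germ at \<open>h\<^sub>0\<close>.\<close>

definition bifurcation_function ::
    "(complex \<Rightarrow> complex^'n \<Rightarrow> complex) \<Rightarrow> complex \<Rightarrow> complex^'n \<Rightarrow> nat \<Rightarrow> (complex \<Rightarrow> complex) \<Rightarrow> bool" where
  "bifurcation_function F h\<^sub>0 lam\<^sub>0 k M \<longleftrightarrow>
     \<not> (\<forall>\<^sub>F h in nhds h\<^sub>0. M h = 0) \<and>
     (\<exists>g. analytic_arc g \<and> g 0 = lam\<^sub>0 \<and>
        (\<forall>\<^sub>F h in nhds h\<^sub>0. (\<lambda>\<epsilon>. F h (g \<epsilon>) - \<epsilon> ^ k * M h) \<in> O[at 0](\<lambda>\<epsilon>. \<epsilon> ^ (k + 1))))"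

definition minimal_order ::
    "(complex \<Rightarrow> complex^'n \<Rightarrow> complex) \<Rightarrow> complex \<Rightarrow> complex^'n \<Rightarrow> (complex \<Rightarrow> complex) \<Rightarrow> nat" where
  "minimal_order F h\<^sub>0 lam\<^sub>0 M =
     (LEAST k. \<exists>c. c \<noteq> 0 \<and> bifurcation_function F h\<^sub>0 lam\<^sub>0 k (\<lambda>h. c * M h))"

end

(*
A bifurcation function of positive order is determined, up to a constant, by the point of the
exceptional locus at which the lifted arc starts. If v(lambda(e)) = e^k (p + O(e)), write each
Taylor coefficient of F as sum_j c_j v_j with analytic c_j; then F(h, lambda(e)) =
e^k M(h) + O(e^(k+1)), where the Taylor coefficients of M are sum_j c_j(lambda_0) p_j. Since the v_j are
conversely combinations of the Taylor coefficients, M is nonzero and k is the order. So the order of any other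
arc through the same point bounds the minimal order.

For the uniform bound, take a chart X of the blowup, an irreducible affine variety, with the function f that
generates the exceptional ideal. Noether normalization makes X finite over an affine space with coordinates y.
Adjoin the coefficients w of a general linear form a = sum_l w_l x_l, and let G be its minimal polynomial over
C[y, w]. Then G is monic with polynomial coefficients, and differentiating G(y, w, a) = 0 in w_l gives
x_l = - G_(w_l) / G_T. Over a general line through the image of P, a Puiseux root of G therefore gives an arc
in X. It starts at P if w separates P from the other points over y(P). As f divides a polynomial rho(y, w),
the order of f on the arc is at most D! deg(rho), with D the degree of G, for every P.
*)

theory Submission
  imports Defs "HOL-Complex_Analysis.Complex_Analysis" "HOL-Computational_Algebra.Fundamental_Theorem_Algebra"
begin

text \<open>The separating form depends on \<open>P\<close>, but the bound must not. With w among
  the base variables, one \<open>G\<close> and one \<open>\<rho>\<close> serve all points: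
  \<open>P\<close> only decides where the line in (y, w)-space starts, and the line aims at a place
  where \<open>\<rho>\<close> is nonzero. The formula x_l = - G_(w_l) / G_T gives only Laurent
  series, and needs G_T nonzero along the root. A second base polynomial arranges the latter; poles
  are excluded because each x_l is integral over the base, which is why \<open>G\<close> has to be
  monic. Monicity comes from growth, not from unique factorization: the roots of \<open>G\<close>
  are values of the linear form at points of X, X is proper over the base, and a locally bounded
  quotient of polynomials is a polynomial. Identities on X are carried to numbers, power series and
  Laurent series, so evaluation takes a ring homomorphism on the coefficients as a parameter. The
  formal arc found in X is finally truncated to a polynomial arc; keeping its terms up to the order
  in question preserves order and starting point, and no convergence is involved.\<close>

section \<open>Evaluation of polynomials in several variables\<close>

hide_const (open) Poly_Mapping.degree

abbreviation (input) "lookup \<equiv> Poly_Mapping.lookup"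
abbreviation (input) "keys \<equiv> Poly_Mapping.keys"
abbreviation (input) "single \<equiv> Poly_Mapping.single"
abbreviation (input) "ev \<equiv> cpoly_eval"

text \<open>A predicate on functions, because the homomorphisms are built on the fly: evaluations,
  embeddings of constants, substitutions t = s^m and their compositions.\<close>

definition rhom :: "('a::comm_ring_1 \<Rightarrow> 'b::comm_ring_1) \<Rightarrow> bool" where
  "rhom h \<longleftrightarrow> h 0 = 0 \<and> h 1 = 1 \<and> (\<forall>a b. h (a + b) = h a + h b) \<and> (\<forall>a b. h (a * b) = h a * h b)"

lemma rhomD:
  assumes "rhom h"
  shows "h 0 = 0" "h 1 = 1" "h (a + b) = h a + h b" "h (a * b) = h a * h b"
    "h (a ^ n) = h a ^ n" "h (\<Sum>i\<in>A. f i) = (\<Sum>i\<in>A. h (f i))" "h (\<Prod>i\<in>A. f i) = (\<Prod>i\<in>A. h (f i))"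
    "h (- a) = - h a" "h (a - b) = h a - h b" "h (of_nat n) = of_nat n"
proof -
  show *: "h 0 = 0" "h 1 = 1" "h (a + b) = h a + h b" "h (a * b) = h a * h b" for a b
    using assms by (auto simp: rhom_def)
  show "h (a ^ n) = h a ^ n" by (induction n) (auto simp: *)
  show "h (\<Sum>i\<in>A. f i) = (\<Sum>i\<in>A. h (f i))" by (induction A rule: infinite_finite_induct) (auto simp: *)
  show "h (\<Prod>i\<in>A. f i) = (\<Prod>i\<in>A. h (f i))" by (induction A rule: infinite_finite_induct) (auto simp: *)
  show m: "h (- a) = - h a" for a using *(3)[of a "- a"] *(1) by (simp add: eq_neg_iff_add_eq_0 add.commute)
  show "h (a - b) = h a - h b" using *(3)[of a "- b"] m by simp
  show "h (of_nat n) = of_nat n" by (induction n) (auto simp: *)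
qed

lemma rhom_id [simp]: "rhom (\<lambda>c. c)"
  by (simp add: rhom_def)

lemma rhom_pconst [simp]: "rhom (\<lambda>c. [:c:])"
  by (simp add: rhom_def one_pCons)

lemma rhom_fps_const [simp]: "rhom fps_const"
  by (simp add: rhom_def)

lemma rhom_fls_const [simp]: "rhom fls_const"
  by (simp add: rhom_def fls_plus_const fls_const_mult_const)

lemma rhom_compose: "rhom g \<Longrightarrow> rhom h \<Longrightarrow> rhom (\<lambda>x. g (h x))"
  by (simp add: rhom_def)

lemma rhom_poly [simp]: "rhom (\<lambda>p. poly p x)"
  by (simp add: rhom_def)

lemma rhom_fps_of_poly [simp]: "rhom fps_of_poly"
  by (simp add: rhom_def fps_of_poly_add fps_of_poly_mult)

lemma rhom_fps_to_fls [simp]: "rhom fps_to_fls"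
  by (simp add: rhom_def fls_times_fps_to_fls)

text \<open>The map \<open>h\<close> places the coefficients in the target ring: the identity for
  values, \<open>fps_const\<close> and \<open>fls_const\<close> for arcs, \<open>PC\<close> for
  substituting polynomials into a polynomial.\<close>

definition peval :: "(complex \<Rightarrow> 'r) \<Rightarrow> 'x::finite cpoly \<Rightarrow> ('x \<Rightarrow> 'r) \<Rightarrow> 'r::comm_ring_1" where
  "peval h f x = (\<Sum>m\<in>keys f. h (lookup f m) * (\<Prod>i\<in>UNIV. x i ^ lookup m i))"

lemma cpoly_eval_peval: "ev f x = peval (\<lambda>c. c) f x"
  by (simp add: cpoly_eval_def peval_def monom_val_def)

lemma peval_superset:
  assumes "rhom h" "finite A" "keys f \<subseteq> A"
  shows "peval h f x = (\<Sum>m\<in>A. h (lookup f m) * (\<Prod>i\<in>UNIV. x i ^ lookup m i))"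
  unfolding peval_def
  by (rule sum.mono_neutral_left) (use assms in \<open>auto simp: in_keys_iff rhomD(1)[OF assms(1)]\<close>)

definition PC :: "complex \<Rightarrow> 'x cpoly" where
  "PC c = single 0 c"

definition PV :: "'x \<Rightarrow> 'x cpoly" where
  "PV i = single (single i 1) 1"

lemma rhom_PC [simp]: "rhom PC"
  by (simp add: rhom_def PC_def single_add mult_single)

lemma peval_single:
  assumes "rhom h"
  shows "peval h (single m c) x = h c * (\<Prod>i\<in>UNIV. x i ^ lookup m i)"
  using peval_superset[OF assms, of "{m}" "single m c" x] by (simp add: lookup_single)

lemma peval_0 [simp]: "peval h 0 x = 0"
  by (simp add: peval_def)

lemma peval_add [simp]:
  assumes "rhom h"
  shows "peval h (f + g) x = peval h f x + peval h g x"
proof -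
  let ?A = "keys f \<union> keys g"
  have "keys (f + g) \<subseteq> ?A" by (rule keys_add)
  then show ?thesis
    by (simp add: peval_superset[OF assms, of ?A] lookup_add rhomD[OF assms] algebra_simps sum.distrib)
qed

lemma peval_sum [simp]:
  assumes "rhom h"
  shows "peval h (\<Sum>a\<in>A. f a) x = (\<Sum>a\<in>A. peval h (f a) x)"
  by (induction A rule: infinite_finite_induct) (auto simp: assms)

lemma cpoly_sum_single:
  "f = (\<Sum>m\<in>keys f. single m (lookup f m))" (is "_ = ?g")
proof (rule poly_mapping_eqI)
  fix k
  have "lookup ?g k = (\<Sum>m\<in>keys f. if m = k then lookup f m else 0)"
    by (auto simp: lookup_sum lookup_single when_def intro!: sum.cong)
  then show "lookup f k = lookup ?g k"
    by (auto simp: in_keys_iff)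
qed

lemma peval_mult [simp]:
  fixes f g :: "'x::finite cpoly"
  assumes "rhom h"
  shows "peval h (f * g) x = peval h f x * peval h g x"
proof -
  have "f * g = (\<Sum>m\<in>keys f. \<Sum>k\<in>keys g.
      single (m + k) (lookup f m * lookup g k))"
    by (subst (1) cpoly_sum_single[of f], subst (1) cpoly_sum_single[of g]) (simp add: sum_product mult_single)
  then have "peval h (f * g) x = (\<Sum>m\<in>keys f. \<Sum>k\<in>keys g.
      h (lookup f m) * (\<Prod>i\<in>UNIV. x i ^ lookup m i) *
      (h (lookup g k) * (\<Prod>i\<in>UNIV. x i ^ lookup k i)))"
    by (simp add: assms peval_single rhomD[OF assms] lookup_add power_add prod.distrib mult_ac)
  then show ?thesis by (simp add: peval_def sum_product)
qed

lemma peval_PC [simp]: "rhom h \<Longrightarrow> peval h (PC c) x = h c"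
  by (simp add: PC_def peval_single)

lemma peval_PV [simp]: "rhom h \<Longrightarrow> peval h (PV i) x = x i"
proof -
  assume h: "rhom h"
  have "(\<Prod>j\<in>UNIV. x j ^ lookup (single i 1) j) = (\<Prod>j\<in>UNIV. if j = i then x j else 1)"
    by (intro prod.cong) (auto simp: lookup_single when_def)
  then show ?thesis by (simp add: PV_def peval_single h rhomD[OF h])
qed

lemma peval_1 [simp]: "rhom h \<Longrightarrow> peval h 1 x = 1"
  using peval_PC[of h 1 x] by (simp add: PC_def rhom_def)

lemma rhom_peval [simp]: "rhom h \<Longrightarrow> rhom (\<lambda>f. peval h f x)"
  by (simp add: rhom_def[of "\<lambda>f. peval h f x"])

lemmas peval_hom = rhomD[OF rhom_peval]

text \<open>Constants and variables generate the ring, so properties compatible with sums and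
  products can be proved without looking at monomials.\<close>

lemma cpoly_induct [case_names const var add mult]:
  fixes f :: "'x::finite cpoly"
  assumes "\<And>c. P (PC c)" "\<And>i. P (PV i)" "\<And>f g. P f \<Longrightarrow> P g \<Longrightarrow> P (f + g)" "\<And>f g. P f \<Longrightarrow> P g \<Longrightarrow> P (f * g)"
  shows "P f"
proof -
  have one: "P 1" using assms(1)[of 1] by (simp add: PC_def)
  have pow: "P (PV i ^ k)" for i k by (induction k) (auto simp: one assms)
  have prd: "P (\<Prod>i\<in>A. PV i ^ k i)" for A and k :: "'x \<Rightarrow> nat"
    by (induction A rule: infinite_finite_induct) (auto simp: one assms pow)
  have pv: "PV i ^ k = single (single i k) 1" for i :: 'x and k
    by (induction k) (auto simp: PV_def mult_single simp flip: single_add)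
  have single_prod: "(\<Prod>i\<in>A. single (single i (k i)) (1::complex)) =
      single (\<Sum>i\<in>A. single i (k i)) 1" for A and k :: "'x \<Rightarrow> nat"
    by (induction A rule: infinite_finite_induct) (auto simp: mult_single)
  have "(\<Sum>i\<in>UNIV. single i (lookup m i)) = m" for m :: "'x \<Rightarrow>\<^sub>0 nat"
    by (rule poly_mapping_eqI) (auto simp: lookup_sum lookup_single when_def)
  then have "single m c = PC c * (\<Prod>i\<in>UNIV. PV i ^ lookup m i)" for m :: "'x \<Rightarrow>\<^sub>0 nat" and c
    by (simp add: pv single_prod PC_def mult_single)
  then have sg: "P (single m c)" for m c
    using assms(1,4) prd by metis
  have z: "P 0" using assms(1)[of 0] by (simp add: PC_def)
  have "P (\<Sum>m\<in>A. single m (lookup f m))" for A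
    by (induction A rule: infinite_finite_induct) (auto simp: z assms sg)
  then show ?thesis by (subst cpoly_sum_single)
qed

lemma peval_commute:
  assumes "rhom h" "rhom \<phi>"
  shows "\<phi> (peval h f x) = peval (\<lambda>c. \<phi> (h c)) f (\<lambda>i. \<phi> (x i))"
  by (simp add: peval_def rhomD[OF assms(2)])

lemma peval_subst:
  assumes "rhom h"
  shows "peval h (peval PC f q) x = peval h f (\<lambda>i. peval h (q i) x)"
  using peval_commute[OF rhom_PC rhom_peval[OF assms, of x], of f q] by (simp add: assms)

section \<open>Kronecker substitution and points where polynomials do not vanish\<close>

lemma ex_separating_weight:
  fixes A :: "('x::finite \<Rightarrow>\<^sub>0 nat) set"
  assumes "finite A"
  shows "\<exists>\<kappa>::'x \<Rightarrow> nat. inj_on (\<lambda>m. \<Sum>i\<in>UNIV. \<kappa> i * lookup m i) A"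
proof -
  obtain e :: "'x \<Rightarrow> nat" where e: "inj e"
    using finite_imp_inj_to_nat_seg[of "UNIV :: 'x set"] by auto
  \<comment> \<open>Difference of the weights of the two multi-indices, as a polynomial in t, for
    the weights t ^ \<open>e i\<close>. It is nonzero for distinct multi-indices, so all but
    finitely many t separate the finitely many pairs.\<close>
  define q :: "('x \<Rightarrow>\<^sub>0 nat) \<times> ('x \<Rightarrow>\<^sub>0 nat) \<Rightarrow> int poly" where
    "q = (\<lambda>(m, k). \<Sum>i\<in>UNIV. monom (int (lookup m i) - int (lookup k i)) (e i))"
  have q0: "q (m, k) \<noteq> 0" if mk: "m \<noteq> k" for m k
  proof -
    obtain i where i: "lookup m i \<noteq> lookup k i"
      using mk poly_mapping_eqI[of m k] by blast
    have "coeff (q (m, k)) (e i) = (\<Sum>j\<in>UNIV. if j = i then int (lookup m j) - int (lookup k j) else 0)"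
      unfolding q_def using e by (auto simp: coeff_sum inj_eq intro!: sum.cong)
    then show ?thesis using i by auto
  qed
  define B where "B = {p \<in> A \<times> A. fst p \<noteq> snd p}"
  have "finite (\<Union>p\<in>B. {t. poly (q p) t = 0})"
    using assms q0 by (auto simp: B_def intro!: poly_roots_finite finite_subset[of _ "A \<times> A"])
  then obtain t :: nat where t: "int t \<notin> (\<Union>p\<in>B. {t. poly (q p) t = 0})"
    by (metis (no_types, lifting) ex_new_if_finite finite_vimageI infinite_UNIV_nat inj_of_nat vimageI)
  show ?thesis
  proof (intro exI inj_onI)
    fix m k assume mk: "m \<in> A" "k \<in> A" "(\<Sum>i\<in>UNIV. t ^ e i * lookup m i) = (\<Sum>i\<in>UNIV. t ^ e i * lookup k i)"
    show "m = k"
    proof (rule ccontr)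
      assume "m \<noteq> k"
      then have "poly (q (m, k)) (int t) \<noteq> 0" using t mk by (force simp: B_def)
      moreover have "poly (q (m, k)) (int t) = int (\<Sum>i\<in>UNIV. t ^ e i * lookup m i) - int (\<Sum>i\<in>UNIV. t ^ e i * lookup k i)"
        by (simp add: q_def poly_sum poly_monom sum_subtractf algebra_simps)
      ultimately show False using mk(3) by simp
    qed
  qed
qed

lemma poly_nonroot_exists: "(p::complex poly) \<noteq> 0 \<Longrightarrow> \<exists>t. poly p t \<noteq> 0"
  using poly_all_0_iff_0 by blast

text \<open>Substituting powers of t with separating weights sends distinct monomials to distinct
  powers, so nothing cancels and a nonzero polynomial in one variable remains.\<close>

lemma cpoly_nonzero_point:
  fixes f :: "'x::finite cpoly"
  assumes "f \<noteq> 0"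
  shows "\<exists>x. ev f x \<noteq> 0"
proof -
  obtain \<kappa> :: "'x \<Rightarrow> nat" where \<kappa>: "inj_on (\<lambda>m. \<Sum>i\<in>UNIV. \<kappa> i * lookup m i) (keys f)"
    using ex_separating_weight finite_keys by blast
  define w where "w m = (\<Sum>i\<in>UNIV. \<kappa> i * lookup m i)" for m
  have monom_prod: "(\<Prod>i\<in>B. monom 1 (k i)) = monom (1::complex) (\<Sum>i\<in>B. k i)" for B and k :: "'x \<Rightarrow> nat"
    by (induction B rule: infinite_finite_induct) (auto simp: mult_monom)
  define p where "p = peval (\<lambda>c. [:c:]) f (\<lambda>i. monom 1 (\<kappa> i))"
  have p: "p = (\<Sum>m\<in>keys f. monom (lookup f m) (w m))"
    by (simp add: p_def peval_def monom_power monom_prod w_def smult_monom)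
  obtain m0 where m0: "m0 \<in> keys f" using assms by (metis keys_eq_empty equals0I)
  have "coeff p (w m0) = (\<Sum>m\<in>keys f. if m = m0 then lookup f m else 0)"
    unfolding p coeff_sum using \<kappa> m0 by (intro sum.cong) (auto simp: inj_on_def w_def)
  also have "\<dots> \<noteq> 0" using m0 by (auto simp: in_keys_iff)
  finally have "p \<noteq> 0" by auto
  then obtain t where "poly p t \<noteq> 0" using poly_nonroot_exists by blast
  moreover have "poly p t = ev f (\<lambda>i. poly (monom 1 (\<kappa> i)) t)"
    unfolding p_def cpoly_eval_peval by (subst peval_commute[OF _ rhom_poly]) auto
  ultimately show ?thesis by auto
qed

lemma cpoly_eqI: "(\<And>x. ev f x = ev g x) \<Longrightarrow> f = g"
  using cpoly_nonzero_point[of "f - g"] by (auto simp: cpoly_eval_peval peval_hom)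

definition cline :: "'x::finite cpoly \<Rightarrow> ('x \<Rightarrow> complex) \<Rightarrow> ('x \<Rightarrow> complex) \<Rightarrow> complex poly" where
  "cline f x v = peval (\<lambda>c. [:c:]) f (\<lambda>i. [:x i, v i:])"

lemma poly_cline: "poly (cline f x v) t = ev f (\<lambda>i. x i + t * v i)"
  unfolding cline_def cpoly_eval_peval by (subst peval_commute[OF _ rhom_poly]) auto

text \<open>On the line joining the two points the restrictions are nonzero at t = 0 and at t = 1
  respectively, so their product is a nonzero polynomial in t.\<close>

lemma cpoly_common_nonzero:
  assumes "ev f x \<noteq> 0" "ev g y \<noteq> 0"
  shows "\<exists>t. ev f (\<lambda>i. x i + t * (y i - x i)) \<noteq> 0 \<and> ev g (\<lambda>i. x i + t * (y i - x i)) \<noteq> 0"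
proof -
  let ?v = "\<lambda>i. y i - x i"
  have "poly (cline f x ?v) 0 \<noteq> 0" "poly (cline g x ?v) 1 \<noteq> 0" using assms by (auto simp: poly_cline)
  then have "cline f x ?v * cline g x ?v \<noteq> 0" by auto
  then obtain t where "poly (cline f x ?v * cline g x ?v) t \<noteq> 0" using poly_nonroot_exists by blast
  then show ?thesis by (auto simp: poly_cline)
qed

lemma cpoly_mult_eq_0: "(f::'x::finite cpoly) * g = 0 \<longleftrightarrow> f = 0 \<or> g = 0"
proof
  assume fg: "f * g = 0"
  show "f = 0 \<or> g = 0"
  proof (rule ccontr)
    assume "\<not> (f = 0 \<or> g = 0)"
    then obtain x y where "ev f x \<noteq> 0" "ev g y \<noteq> 0" using cpoly_nonzero_point by blast
    then obtain z where "ev f z \<noteq> 0" "ev g z \<noteq> 0" using cpoly_common_nonzero by blast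
    then have "ev (f * g) z \<noteq> 0" by (simp add: cpoly_eval_peval)
    then show False using fg by (simp add: cpoly_eval_peval)
  qed
qed auto

lemma ex_partial_derivative:
  "\<exists>f'. \<forall>x. ((\<lambda>t. ev f (x(i := t))) has_field_derivative ev f' x) (at (x i))"
proof (induction f rule: cpoly_induct)
  case (const c)
  show ?case by (rule exI[of _ 0]) (auto simp: cpoly_eval_peval)
next
  case (var j)
  show ?case by (rule exI[of _ "if i = j then 1 else 0"]) (auto simp: cpoly_eval_peval)
next
  case (add f g)
  then obtain f' g' where "\<And>x. ((\<lambda>t. ev f (x(i := t))) has_field_derivative ev f' x) (at (x i))"
    "\<And>x. ((\<lambda>t. ev g (x(i := t))) has_field_derivative ev g' x) (at (x i))" by blast
  then show ?case
    by (intro exI[of _ "f' + g'"]) (auto simp: cpoly_eval_peval simp del: fun_upd_apply intro!: derivative_eq_intros)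
next
  case (mult f g)
  then obtain f' g' where "\<And>x. ((\<lambda>t. ev f (x(i := t))) has_field_derivative ev f' x) (at (x i))"
    "\<And>x. ((\<lambda>t. ev g (x(i := t))) has_field_derivative ev g' x) (at (x i))" by blast
  then show ?case
    by (intro exI[of _ "f' * g + f * g'"]) (auto simp: cpoly_eval_peval simp del: fun_upd_apply intro!: derivative_eq_intros)
qed

lemma cpoly_bounded: "\<exists>M\<ge>0. \<forall>x. (\<forall>i. cmod (x i) \<le> R) \<longrightarrow> cmod (ev f x) \<le> M"
proof (induction f rule: cpoly_induct)
  case (const c)
  show ?case by (rule exI[of _ "cmod c"]) (auto simp: cpoly_eval_peval)
next
  case (var j)
  show ?case by (rule exI[of _ "max R 0"]) (auto simp: cpoly_eval_peval intro: order_trans[OF _ max.cobounded1])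
next
  case (add f g)
  then obtain M N where MN: "M \<ge> 0" "N \<ge> 0" "\<And>x. (\<forall>i. cmod (x i) \<le> R) \<Longrightarrow> cmod (ev f x) \<le> M"
    "\<And>x. (\<forall>i. cmod (x i) \<le> R) \<Longrightarrow> cmod (ev g x) \<le> N" by blast
  show ?case
    by (rule exI[of _ "M + N"]) (use MN in \<open>auto simp: cpoly_eval_peval intro!: norm_triangle_le add_mono\<close>)
next
  case (mult f g)
  then obtain M N where MN: "M \<ge> 0" "N \<ge> 0" "\<And>x. (\<forall>i. cmod (x i) \<le> R) \<Longrightarrow> cmod (ev f x) \<le> M"
    "\<And>x. (\<forall>i. cmod (x i) \<le> R) \<Longrightarrow> cmod (ev g x) \<le> N" by blast
  show ?case
    by (rule exI[of _ "M * N"]) (use MN in \<open>auto simp: cpoly_eval_peval norm_mult intro!: mult_mono\<close>)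
qed

section \<open>Noether normalization\<close>

lemma PC_eq_0_iff [simp]: "PC c = 0 \<longleftrightarrow> c = 0"
  unfolding PC_def by (metis lookup_single_eq lookup_zero single_zero)

text \<open>Two-stage evaluation for polynomials in T over a polynomial ring: \<open>\<phi>\<close>
  is usually itself an evaluation, at a point or along an arc.\<close>

definition rpoly :: "('a::comm_ring_1 \<Rightarrow> 'b::comm_ring_1) \<Rightarrow> 'a poly \<Rightarrow> 'b \<Rightarrow> 'b" where
  "rpoly \<phi> G t = poly (map_poly \<phi> G) t"

abbreviation (input) "rpoly_ev Y \<equiv> rpoly (\<lambda>p. ev p Y)"
abbreviation (input) "rpoly_peval h Y \<equiv> rpoly (\<lambda>p. peval h p Y)"

lemma rpoly_0 [simp]: "rpoly \<phi> 0 t = 0"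
  by (simp add: rpoly_def)

lemma rpoly_pCons: "rhom \<phi> \<Longrightarrow> rpoly \<phi> (pCons a p) t = \<phi> a + t * rpoly \<phi> p t"
  by (simp add: rpoly_def map_poly_pCons rhomD(1))

lemma rpoly_altdef:
  assumes "rhom \<phi>" "degree G \<le> n"
  shows "rpoly \<phi> G t = (\<Sum>k\<le>n. \<phi> (coeff G k) * t ^ k)"
proof -
  have "degree (map_poly \<phi> G) \<le> n"
    using map_poly_degree_leq[of \<phi> G] assms rhomD(1)[OF assms(1)] by linarith
  moreover have "poly (map_poly \<phi> G) t = (\<Sum>k\<le>degree (map_poly \<phi> G). coeff (map_poly \<phi> G) k * t ^ k)"
    by (rule poly_altdef)
  moreover have "\<dots> = (\<Sum>k\<le>n. coeff (map_poly \<phi> G) k * t ^ k)"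
    by (rule sum.mono_neutral_left) (use calculation(1) in \<open>auto simp: coeff_eq_0\<close>)
  ultimately show ?thesis
    by (simp add: rpoly_def coeff_map_poly rhomD[OF assms(1)])
qed

lemma rpoly_add [simp]: "rhom \<phi> \<Longrightarrow> rpoly \<phi> (p + q) t = rpoly \<phi> p t + rpoly \<phi> q t"
  by (induction p q rule: poly_induct2) (auto simp: rpoly_pCons rhomD algebra_simps)

lemma rpoly_smult [simp]: "rhom \<phi> \<Longrightarrow> rpoly \<phi> (smult a q) t = \<phi> a * rpoly \<phi> q t"
  by (induction q) (auto simp: rpoly_pCons rhomD algebra_simps)

lemma rpoly_mult [simp]: "rhom \<phi> \<Longrightarrow> rpoly \<phi> (p * q) t = rpoly \<phi> p t * rpoly \<phi> q t"
  by (induction p) (auto simp: rpoly_pCons rhomD algebra_simps)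

lemma rhom_rpoly [simp]: "rhom \<phi> \<Longrightarrow> rhom (\<lambda>G. rpoly \<phi> G t)"
  by (simp add: rhom_def[of "\<lambda>G. rpoly \<phi> G t"] rpoly_pCons one_pCons rhomD)

lemmas rpoly_hom = rhomD[OF rhom_rpoly]

lemma rpoly_const [simp]: "rhom \<phi> \<Longrightarrow> rpoly \<phi> [:a:] t = \<phi> a"
  by (simp add: rpoly_pCons)

lemma rpoly_commute: "rhom \<phi> \<Longrightarrow> rhom \<psi> \<Longrightarrow> \<psi> (rpoly \<phi> G t) = rpoly (\<lambda>a. \<psi> (\<phi> a)) G (\<psi> t)"
  by (induction G) (auto simp: rpoly_pCons rhom_compose rhomD)

lemma rpoly_pcompose: "rhom \<phi> \<Longrightarrow> rpoly \<phi> (pcompose p q) t = rpoly \<phi> p (rpoly \<phi> q t)"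
  by (induction p) (auto simp: pcompose_pCons rpoly_pCons)

text \<open>Working with upper bounds on the degrees keeps the top coefficient multiplicative even
  when it vanishes.\<close>

lemma degree_coeff_mult_le:
  assumes "degree p \<le> a" "degree q \<le> b"
  shows "degree (p * q) \<le> a + b \<and> coeff (p * q) (a + b) = coeff p a * coeff q b"
proof
  show "degree (p * q) \<le> a + b" using degree_mult_le[of p q] assms by linarith
  have "coeff (p * q) (a + b) = (\<Sum>i\<le>a + b. coeff p i * coeff q (a + b - i))" by (simp add: coeff_mult)
  also have "\<dots> = (\<Sum>i\<in>{a}. coeff p i * coeff q (a + b - i))"
  proof (rule sum.mono_neutral_right)
    show "\<forall>i\<in>{..a + b} - {a}. coeff p i * coeff q (a + b - i) = 0"
    proof
      fix i assume "i \<in> {..a + b} - {a}"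
      then have "i > a \<or> a + b - i > b" by auto
      then show "coeff p i * coeff q (a + b - i) = 0"
        using assms by (auto simp: coeff_eq_0)
    qed
  qed auto
  finally show "coeff (p * q) (a + b) = coeff p a * coeff q b" by simp
qed

lemma degree_coeff_power_le:
  fixes p :: "'a::comm_ring_1 poly"
  assumes "degree p \<le> a"
  shows "degree (p ^ n) \<le> n * a \<and> coeff (p ^ n) (n * a) = coeff p a ^ n"
proof (induction n)
  case (Suc n)
  then show ?case using degree_coeff_mult_le[of p a "p ^ n" "n * a"] assms by auto
qed auto

lemma degree_coeff_prod_le:
  fixes p :: "'i \<Rightarrow> 'a::comm_ring_1 poly"
  assumes "\<And>i. i \<in> A \<Longrightarrow> degree (p i) \<le> d i"
  shows "degree (\<Prod>i\<in>A. p i) \<le> (\<Sum>i\<in>A. d i) \<and> coeff (\<Prod>i\<in>A. p i) (\<Sum>i\<in>A. d i) = (\<Prod>i\<in>A. coeff (p i) (d i))"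
  using assms
proof (induction A rule: infinite_finite_induct)
  case (insert x A)
  then show ?case using degree_coeff_mult_le[of "p x" "d x" "\<Prod>i\<in>A. p i" "\<Sum>i\<in>A. d i"] by auto
qed auto

section \<open>Homogeneous components and their restriction to parallel lines\<close>

definition mdeg :: "('x::finite \<Rightarrow>\<^sub>0 nat) \<Rightarrow> nat" where
  "mdeg m = (\<Sum>i\<in>UNIV. lookup m i)"

definition hpart :: "nat \<Rightarrow> 'x::finite cpoly \<Rightarrow> 'x cpoly" where
  "hpart k H = (\<Sum>m\<in>{m \<in> keys H. mdeg m = k}. single m (lookup H m))"

lemma peval_hpart:
  "rhom h \<Longrightarrow> peval h (hpart k H) x = (\<Sum>m\<in>{m \<in> keys H. mdeg m = k}. h (lookup H m) * (\<Prod>i\<in>UNIV. x i ^ lookup m i))"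
  by (simp add: hpart_def peval_single)

lemma hpart_sum: "\<exists>n. \<forall>x. ev H x = (\<Sum>k\<le>n. ev (hpart k H) x)"
proof (intro exI allI)
  fix x
  have "(\<Sum>k\<le>Max (mdeg ` keys H). ev (hpart k H) x) =
     (\<Sum>k\<le>Max (mdeg ` keys H). \<Sum>m\<in>{m \<in> keys H. mdeg m = k}. lookup H m * (\<Prod>i\<in>UNIV. x i ^ lookup m i))"
    by (simp add: cpoly_eval_peval peval_hpart)
  also have "\<dots> = (\<Sum>m\<in>keys H. lookup H m * (\<Prod>i\<in>UNIV. x i ^ lookup m i))"
    by (rule sum.group) auto
  finally show "ev H x = (\<Sum>k\<le>Max (mdeg ` keys H). ev (hpart k H) x)"
    by (simp add: cpoly_eval_peval peval_def)
qed

lemma hpart_at_0: "ev (hpart k H) (\<lambda>_. 0) = 0" if "k \<noteq> 0"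
proof -
  have "(\<Prod>i\<in>UNIV. (0::complex) ^ lookup m i) = 0" if m: "mdeg m = k" for m :: "'a \<Rightarrow>\<^sub>0 nat"
  proof -
    have "\<exists>i. lookup m i \<noteq> 0"
      by (rule ccontr) (use \<open>k \<noteq> 0\<close> m in \<open>simp add: mdeg_def\<close>)
    then show ?thesis by auto
  qed
  then show ?thesis by (auto simp: cpoly_eval_peval peval_hpart intro!: sum.neutral simp del: prod_zero_iff)
qed

lemma hpart_0: "ev (hpart 0 H) x = ev (hpart 0 H) y"
  by (simp add: cpoly_eval_peval peval_hpart mdeg_def)

text \<open>Restriction to the lines of direction \<open>c\<close> through a variable point: the
  point supplies the coefficients, the parameter of the line is the polynomial variable.\<close>

definition sline :: "'x::finite cpoly \<Rightarrow> ('x \<Rightarrow> complex) \<Rightarrow> 'x cpoly poly" where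
  "sline f c = peval (\<lambda>a. [:PC a:]) f (\<lambda>i. [:PV i, PC (c i):])"

lemma rhom_pcPC [simp]: "rhom (\<lambda>a. [:PC a:])"
  by (simp add: rhom_def one_pCons rhomD[OF rhom_PC] mult.commute)

lemma rpoly_sline: "rpoly_ev Y (sline f c) s = ev f (\<lambda>i. Y i + s * c i)"
  unfolding sline_def cpoly_eval_peval
  by (subst peval_commute[OF _ rhom_rpoly]) (auto simp: rpoly_pCons)

text \<open>The top power of the parameter arises only by taking the direction in every factor. A
  direction at which the form does not vanish therefore makes the restriction monic up to a
  constant.\<close>

lemma sline_hpart:
  "degree (sline (hpart k H) c) \<le> k \<and> coeff (sline (hpart k H) c) k = PC (ev (hpart k H) c)"
proof -
  let ?M = "{m \<in> keys H. mdeg m = k}"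
  let ?t = "\<lambda>m. [:PC (lookup H m):] * (\<Prod>i\<in>UNIV. [:PV i, PC (c i):] ^ lookup m i)"
  have eq: "sline (hpart k H) c = (\<Sum>m\<in>?M. ?t m)" by (simp add: sline_def peval_hpart)
  have t: "degree (?t m) \<le> k \<and> coeff (?t m) k = PC (lookup H m * (\<Prod>i\<in>UNIV. c i ^ lookup m i))"
    if "m \<in> ?M" for m
  proof -
    have 1: "degree ([:PV i, PC (c i):] ^ n) \<le> n \<and> coeff ([:PV i, PC (c i):] ^ n) n = PC (c i) ^ n" for i n
      using degree_coeff_power_le[of "[:PV i, PC (c i):]" 1 n] by auto
    have k: "(\<Sum>i\<in>UNIV. lookup m i) = k" using that by (simp add: mdeg_def)
    have "degree (\<Prod>i\<in>UNIV. [:PV i, PC (c i):] ^ lookup m i) \<le> k \<and>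
       coeff (\<Prod>i\<in>UNIV. [:PV i, PC (c i):] ^ lookup m i) k = (\<Prod>i\<in>UNIV. PC (c i) ^ lookup m i)"
      using degree_coeff_prod_le[of UNIV "\<lambda>i. [:PV i, PC (c i):] ^ lookup m i" "\<lambda>i. lookup m i"] 1
      unfolding k by auto
    then show ?thesis
      by (auto simp: rhomD[OF rhom_PC] intro: order_trans[OF degree_smult_le])
  qed
  show ?thesis
  proof
    show "degree (sline (hpart k H) c) \<le> k" unfolding eq by (rule degree_sum_le) (use t in auto)
    show "coeff (sline (hpart k H) c) k = PC (ev (hpart k H) c)"
      unfolding eq coeff_sum using t by (simp add: cpoly_eval_peval peval_hpart rhomD[OF rhom_PC])
  qed
qed

text \<open>The functions \<open>y i\<close> take the polynomial functions on \<open>X\<close> to a module over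
  \<open>\<complex>[y]\<close> generated by the finite set \<open>E\<close>; this replaces integrality over \<open>\<complex>[y]\<close>.\<close>

definition module_gen :: "('v::finite \<Rightarrow> complex) set \<Rightarrow> ('v \<Rightarrow> 'v cpoly) \<Rightarrow> 'v cpoly set \<Rightarrow> bool" where
  "module_gen X y E \<longleftrightarrow> finite E \<and>
     (\<forall>f. \<exists>c. \<forall>x\<in>X. ev f x = (\<Sum>e\<in>E. ev (c e) (\<lambda>i. ev (y i) x) * ev e x))"

text \<open>A relation H among the y_i lets one of them be removed. In a direction c where the top
  form of H is nonzero write y = y' + s c; then H(y' + s c) = 0 is an equation for s with constant
  leading coefficient, so over the polynomials in y' the powers of s below its degree
  suffice.\<close>

lemma module_gen_step:
  fixes X :: "('v::finite \<Rightarrow> complex) set"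
  assumes gen: "module_gen X y E" and I: "\<And>i. i \<notin> I \<Longrightarrow> y i = 0" and ne: "X \<noteq> {}"
    and H: "\<And>x. x \<in> X \<Longrightarrow> ev H (\<lambda>i. ev (y i) x) = 0"
    and Y0: "\<And>i. i \<notin> I \<Longrightarrow> Y0 i = 0" "ev H Y0 \<noteq> 0"
  shows "\<exists>r\<in>I. \<exists>y' E'. module_gen X y' E' \<and> (\<forall>i. i \<notin> I - {r} \<longrightarrow> y' i = 0)"
proof -
  let ?CI = "{Y :: 'v \<Rightarrow> complex. \<forall>i. i \<notin> I \<longrightarrow> Y i = 0}"
  have eta: "(\<lambda>i. ev (y i) x) \<in> ?CI" for x using I by (auto simp: cpoly_eval_peval)
  obtain n where n: "\<And>Y. ev H Y = (\<Sum>k\<le>n. ev (hpart k H) Y)" using hpart_sum by blast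
  \<comment> \<open>Degrees are measured on the coordinate subspace of \<open>I\<close>, since forms
    of \<open>H\<close> of higher degree may vanish identically there.\<close>
  define D where "D = {k. k \<le> n \<and> (\<exists>c\<in>?CI. ev (hpart k H) c \<noteq> 0)}"
  have "D \<noteq> {}"
  proof
    assume "D = {}"
    then have "\<And>k. k \<le> n \<Longrightarrow> ev (hpart k H) Y0 = 0" using Y0(1) by (auto simp: D_def)
    then show False using Y0(2) n[of Y0] by simp
  qed
  have finD: "finite D" by (auto simp: D_def)
  define d where "d = Max D"
  have "d \<in> D" using finD \<open>D \<noteq> {}\<close> d_def Max_in by blast
  then obtain c where c: "c \<in> ?CI" "ev (hpart d H) c \<noteq> 0" and dn: "d \<le> n" by (auto simp: D_def)
  have above: "ev (hpart k H) Y = 0" if "k > d" "k \<le> n" "Y \<in> ?CI" for k Y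
  proof (rule ccontr)
    assume "ev (hpart k H) Y \<noteq> 0"
    then have "k \<in> D" using that by (auto simp: D_def)
    then show False using Max_ge[OF finD, of k] that(1) by (auto simp: d_def)
  qed
  have HCI: "ev H Y = (\<Sum>k\<le>d. ev (hpart k H) Y)" if "Y \<in> ?CI" for Y
    unfolding n by (rule sum.mono_neutral_right) (use above that dn in \<open>auto simp: not_le\<close>)
  \<comment> \<open>Otherwise \<open>H\<close> would be constant on the subspace, with value 0 at
    the image of a point of \<open>X\<close> and a nonzero value at \<open>Y0\<close>.\<close>
  have "d \<noteq> 0"
  proof
    assume d0: "d = 0"
    obtain x where x: "x \<in> X" using ne by blast
    have "ev H Y0 = ev H (\<lambda>i. ev (y i) x)"
      using HCI[of Y0] HCI[OF eta[of x]] Y0(1) d0 hpart_0[of H] by auto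
    then show False using H[OF x] Y0(2) by simp
  qed
  then have "c \<noteq> (\<lambda>_. 0)" using hpart_at_0 c(2) by metis
  then obtain r where r: "c r \<noteq> 0" by auto
  then have rI: "r \<in> I" using c(1) by auto
  define \<kappa> where "\<kappa> = ev (hpart d H) c"
  \<comment> \<open>Normalized so that the new coordinate of index r, namely y_r - c_r s, is
    zero.\<close>
  define s where "s = PC (1 / c r) * y r"
  define y' where "y' i = y i - PC (c i) * s" for i
  have y'0: "y' i = 0" if "i \<notin> I - {r}" for i
  proof (cases "i = r")
    case True
    have "PC (c r) * PC (1 / c r) = (1 :: 'v cpoly)"
      using r rhomD(2)[OF rhom_PC] by (simp flip: rhomD(4)[OF rhom_PC])
    then show ?thesis using True by (simp add: y'_def s_def flip: mult.assoc)
  next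
    case False
    then show ?thesis using that I c(1) by (auto simp: y'_def rhomD[OF rhom_PC])
  qed
  have y_eq: "(\<lambda>i. ev (y' i) x + ev s x * c i) = (\<lambda>i. ev (y i) x)" for x
    by (auto simp: y'_def cpoly_eval_peval peval_hom)
  define B where "B = (\<Sum>k\<le>d. sline (hpart k H) c)"
  have degB: "degree B \<le> d"
    unfolding B_def by (rule degree_sum_le) (use sline_hpart[of _ H c] in \<open>auto intro: order_trans\<close>)
  have cB: "coeff B d = PC \<kappa>"
  proof -
    have "coeff (sline (hpart k H) c) d = 0" if "k < d" for k
      using sline_hpart[of k H c] that by (intro coeff_eq_0) auto
    then have "coeff B d = (\<Sum>k\<le>d. if k = d then coeff (sline (hpart k H) c) d else 0)"
      unfolding B_def coeff_sum by (intro sum.cong) auto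
    then show ?thesis using sline_hpart[of d H c] by (simp add: \<kappa>_def)
  qed
  have \<kappa>0: "\<kappa> \<noteq> 0" using c by (simp add: \<kappa>_def)
  then have "PC \<kappa> \<noteq> (0 :: 'v cpoly)" by simp
  then have dB: "degree B = d" and B0: "B \<noteq> 0" using degB cB le_degree[of B d] by auto
  have rel: "rpoly (\<lambda>p. ev p (\<lambda>i. ev (y' i) x)) B (ev s x) = 0" if "x \<in> X" for x
  proof -
    have rh: "rhom (\<lambda>p. ev p (\<lambda>i. ev (y' i) x))" by (simp add: cpoly_eval_peval)
    show ?thesis
      unfolding B_def rhomD(6)[OF rhom_rpoly[OF rh]] rpoly_sline y_eq
      using HCI[OF eta[of x]] H[OF that] by simp
  qed
  define \<phi> where "\<phi> = (\<lambda>(e, k::nat). e * s ^ k)"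
  let ?E' = "\<phi> ` (E \<times> {..<d})"
  have finE: "finite E" using gen by (simp add: module_gen_def)
  \<comment> \<open>Pseudo-division by \<open>B\<close> leaves a remainder of degree below
    \<open>d\<close>; the factor it introduces is a power of the constant \<open>\<kappa>\<close>
    and can be divided out.\<close>
  have reduce: "\<exists>b. \<forall>x\<in>X. ev g (\<lambda>i. ev (y i) x) =
      (\<Sum>k<d. ev (b k) (\<lambda>i. ev (y' i) x) * ev s x ^ k)" for g
  proof -
    obtain q R where qR: "pseudo_divmod (sline g c) B = (q, R)" by fastforce
    define N where "N = Suc (degree (sline g c)) - degree B"
    have 1: "smult (PC \<kappa> ^ N) (sline g c) = B * q + R" and 2: "R = 0 \<or> degree R < d"
      using pseudo_divmod[OF B0 qR] cB dB by (auto simp: N_def)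
    have degR: "degree R \<le> d - 1" using 2 \<open>d \<noteq> 0\<close> by auto
    show ?thesis
    proof (intro exI ballI)
      fix x assume x: "x \<in> X"
      let ?h = "\<lambda>p. ev p (\<lambda>i. ev (y' i) x)"
      have rh: "rhom ?h" by (simp add: cpoly_eval_peval)
      have "?h (PC \<kappa> ^ N) * rpoly ?h (sline g c) (ev s x) = rpoly ?h R (ev s x)"
        using arg_cong[OF 1, of "\<lambda>p. rpoly ?h p (ev s x)"] rel[OF x] by (simp add: rh)
      moreover have "?h (PC \<kappa> ^ N) = \<kappa> ^ N" by (simp add: cpoly_eval_peval peval_hom)
      ultimately have "ev g (\<lambda>i. ev (y i) x) = (1 / \<kappa> ^ N) * rpoly ?h R (ev s x)"
        unfolding rpoly_sline y_eq using \<kappa>0 by (simp add: field_simps)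
      also have "rpoly ?h R (ev s x) = (\<Sum>k<d. ?h (coeff R k) * ev s x ^ k)"
        using rpoly_altdef[OF rh degR] \<open>d \<noteq> 0\<close> by (simp flip: lessThan_Suc_atMost)
      finally show "ev g (\<lambda>i. ev (y i) x) =
         (\<Sum>k<d. ev (PC (1 / \<kappa> ^ N) * coeff R k) (\<lambda>i. ev (y' i) x) * ev s x ^ k)"
        by (simp add: cpoly_eval_peval sum_distrib_left mult_ac)
    qed
  qed
  have "\<exists>c'. \<forall>x\<in>X. ev f x = (\<Sum>e\<in>?E'. ev (c' e) (\<lambda>i. ev (y' i) x) * ev e x)" for f
  proof -
    have "\<exists>c. \<forall>x\<in>X. ev f x = (\<Sum>e\<in>E. ev (c e) (\<lambda>i. ev (y i) x) * ev e x)"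
      using gen by (simp add: module_gen_def)
    then obtain g where g: "\<And>x. x \<in> X \<Longrightarrow> ev f x = (\<Sum>e\<in>E. ev (g e) (\<lambda>i. ev (y i) x) * ev e x)"
      by blast
    have "\<forall>e. \<exists>b. \<forall>x\<in>X. ev (g e) (\<lambda>i. ev (y i) x) =
      (\<Sum>k<d. ev (b k) (\<lambda>i. ev (y' i) x) * ev s x ^ k)"
      by (intro allI reduce)
    then have "\<exists>b. \<forall>e. \<forall>x\<in>X. ev (g e) (\<lambda>i. ev (y i) x) =
      (\<Sum>k<d. ev (b e k) (\<lambda>i. ev (y' i) x) * ev s x ^ k)"
      by (rule choice)
    then obtain b where b: "\<And>e x. x \<in> X \<Longrightarrow> ev (g e) (\<lambda>i. ev (y i) x) =
      (\<Sum>k<d. ev (b e k) (\<lambda>i. ev (y' i) x) * ev s x ^ k)"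
      by blast
    define c' where "c' e' = (\<Sum>p\<in>{p \<in> E \<times> {..<d}. \<phi> p = e'}. b (fst p) (snd p))" for e'
    show ?thesis
    proof (intro exI ballI)
      fix x assume x: "x \<in> X"
      let ?h = "\<lambda>p. ev p (\<lambda>i. ev (y' i) x)"
      have "ev f x = (\<Sum>e\<in>E. \<Sum>k<d. ?h (b e k) * ev (\<phi> (e, k)) x)"
        unfolding g[OF x] b[OF x] sum_distrib_right
        by (intro sum.cong) (auto simp: \<phi>_def cpoly_eval_peval peval_hom mult_ac)
      also have "\<dots> = (\<Sum>p\<in>E \<times> {..<d}. ?h (b (fst p) (snd p)) * ev (\<phi> p) x)"
        by (subst sum.cartesian_product) (auto intro!: sum.cong)
      also have "\<dots> = (\<Sum>e'\<in>?E'. \<Sum>p\<in>{p \<in> E \<times> {..<d}. \<phi> p = e'}. ?h (b (fst p) (snd p)) * ev (\<phi> p) x)"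
        by (rule sum.image_gen) (use finE in auto)
      also have "\<dots> = (\<Sum>e'\<in>?E'. ?h (c' e') * ev e' x)"
        by (intro sum.cong refl) (simp add: c'_def cpoly_eval_peval sum_distrib_right)
      finally show "ev f x = (\<Sum>e'\<in>?E'. ?h (c' e') * ev e' x)" .
    qed
  qed
  then have "module_gen X y' ?E'" using finE by (auto simp: module_gen_def)
  then show ?thesis using rI y'0 by blast
qed

text \<open>Take an index set of least size, starting from the coordinates themselves with the
  single generator 1; any further relation would let \<open>module_gen_step\<close> remove an index.
  Independence is tested on the coordinate subspace of \<open>I\<close> because the remaining y_i
  are zero.\<close>

lemma noether_normalization:
  fixes X :: "('v::finite \<Rightarrow> complex) set"
  assumes "X \<noteq> {}"
  obtains I y E where "module_gen X y E" "\<And>i. i \<notin> I \<Longrightarrow> y i = 0"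
    "\<And>H Y. (\<And>x. x \<in> X \<Longrightarrow> ev H (\<lambda>i. ev (y i) x) = 0) \<Longrightarrow> (\<And>i. i \<notin> I \<Longrightarrow> Y i = 0) \<Longrightarrow> ev H Y = 0"
proof -
  define Q where "Q I \<longleftrightarrow> (\<exists>y E. module_gen X y E \<and> (\<forall>i. i \<notin> I \<longrightarrow> y i = 0))" for I
  have "module_gen X PV {1}"
    unfolding module_gen_def
  proof (intro conjI allI)
    fix f :: "'v cpoly"
    show "\<exists>c. \<forall>x\<in>X. ev f x = (\<Sum>e\<in>{1}. ev (c e) (\<lambda>i. ev (PV i) x) * ev e x)"
      by (rule exI[of _ "\<lambda>_. f"]) (simp add: cpoly_eval_peval)
  qed auto
  then have "Q UNIV" unfolding Q_def by blast
  then obtain I where I: "Q I" and min: "\<And>J. Q J \<Longrightarrow> card I \<le> card J"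
    using ex_has_least_nat[of Q UNIV card] by auto
  from I obtain y E where yE: "module_gen X y E" "\<And>i. i \<notin> I \<Longrightarrow> y i = 0" unfolding Q_def by blast
  show ?thesis
  proof (rule that[OF yE])
    fix H fix Y :: "'v \<Rightarrow> complex"
    assume *: "\<And>x. x \<in> X \<Longrightarrow> ev H (\<lambda>i. ev (y i) x) = 0" "\<And>i. i \<notin> I \<Longrightarrow> Y i = 0"
    show "ev H Y = 0"
    proof (rule ccontr)
      assume "ev H Y \<noteq> 0"
      then have "\<exists>r\<in>I. \<exists>y' E'. module_gen X y' E' \<and> (\<forall>i. i \<notin> I - {r} \<longrightarrow> y' i = 0)"
        by (intro module_gen_step[where y = y and E = E and H = H and ?Y0.0 = Y] yE assms *)
      then obtain r y' E' where "r \<in> I" "module_gen X y' E'" "\<forall>i. i \<notin> I - {r} \<longrightarrow> y' i = 0"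
        by blast
      then have "r \<in> I" "Q (I - {r})" unfolding Q_def by blast+
      then show False using min[of "I - {r}"] card_Diff1_less[of I r] by simp
    qed
  qed
qed

section \<open>The minimal polynomial of a general linear form\<close>

lemma rhom_cpoly_eval [simp]: "rhom (\<lambda>p. ev p x)"
  by (simp add: cpoly_eval_peval)

lemmas cpoly_eval_hom [simp] = rhomD[OF rhom_cpoly_eval]

lemma cpoly_eval_PC [simp]: "ev (PC c) x = c"
  and cpoly_eval_PV [simp]: "ev (PV i) x = x i"
  by (simp_all add: cpoly_eval_peval)

lemma cpoly_eval_subst [simp]: "ev (peval PC f q) x = ev f (\<lambda>i. ev (q i) x)"
  by (simp add: cpoly_eval_peval peval_subst)

text \<open>More unknowns than equations. The pivot is eliminated by cross multiplication, which
  keeps all coefficients polynomial.\<close>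

lemma cpoly_linear_dependence:
  fixes r :: "'k \<Rightarrow> 'j \<Rightarrow> 'x::finite cpoly"
  assumes "finite J" "finite K" "card J < card K"
  shows "\<exists>c. (\<exists>k\<in>K. c k \<noteq> 0) \<and> (\<forall>j\<in>J. (\<Sum>k\<in>K. c k * r k j) = 0)"
  using assms
proof (induction J arbitrary: K r rule: finite_induct)
  case empty
  then obtain k where "k \<in> K" by fastforce
  then show ?case by (intro exI[of _ "\<lambda>_. 1"]) auto
next
  case (insert j J)
  show ?case
  proof (cases "\<forall>k\<in>K. r k j = 0")
    case True
    have "card J < card K" using insert by simp
    then obtain c where "\<exists>k\<in>K. c k \<noteq> 0" "\<forall>j\<in>J. (\<Sum>k\<in>K. c k * r k j) = 0"
      using insert.IH[OF insert.prems(1)] by blast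
    then show ?thesis using True by (intro exI[of _ c]) auto
  next
    case False
    then obtain p where p: "p \<in> K" "r p j \<noteq> 0" by blast
    let ?K = "K - {p}"
    define r' where "r' k i = r p j * r k i - r k j * r p i" for k i
    have "card J < card ?K" using insert p by simp
    then obtain c where c: "\<exists>k\<in>?K. c k \<noteq> 0" "\<forall>i\<in>J. (\<Sum>k\<in>?K. c k * r' k i) = 0"
      using insert.IH[of ?K r'] insert.prems(1) by blast
    define c' where "c' k = (if k = p then - (\<Sum>k\<in>?K. c k * r k j) else c k * r p j)" for k
    have split: "(\<Sum>k\<in>K. c' k * r k i) = (\<Sum>k\<in>?K. c k * r' k i)" for i
    proof -
      have "(\<Sum>k\<in>K. c' k * r k i) = c' p * r p i + (\<Sum>k\<in>?K. c' k * r k i)"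
        using p insert.prems(1) by (simp add: sum.remove)
      also have "(\<Sum>k\<in>?K. c' k * r k i) = (\<Sum>k\<in>?K. c k * r p j * r k i)"
        by (intro sum.cong) (auto simp: c'_def)
      also have "c' p * r p i + \<dots> = (\<Sum>k\<in>?K. c k * r' k i)"
        by (simp add: c'_def r'_def algebra_simps sum_subtractf sum_distrib_left)
      finally show ?thesis .
    qed
    have "(\<Sum>k\<in>?K. c k * r' k j) = 0" by (simp add: r'_def algebra_simps)
    then have "\<forall>i\<in>insert j J. (\<Sum>k\<in>K. c' k * r k i) = 0" using c(2) by (auto simp: split)
    moreover have "\<exists>k\<in>K. c' k \<noteq> 0"
      using c(1) p by (auto simp: c'_def cpoly_mult_eq_0)
    ultimately show ?thesis by blast
  qed
qed

lemma rpoly_monom [simp]: "rhom \<phi> \<Longrightarrow> rpoly \<phi> (monom c n) t = \<phi> c * t ^ n"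
  by (induction n) (auto simp: monom_0 monom_Suc rpoly_pCons rhomD)

text \<open>\<^const>\<open>pderiv\<close> requires an integral domain, which the ring of coefficients is not known to be
  on the level of type classes.\<close>

definition fderiv :: "'a::comm_ring_1 poly \<Rightarrow> 'a poly" where
  "fderiv G = (\<Sum>k\<le>degree G. monom (of_nat k * coeff G k) (k - 1))"

lemma rpoly_fderiv:
  "rhom \<phi> \<Longrightarrow> rpoly \<phi> (fderiv G) t = (\<Sum>k\<le>degree G. \<phi> (coeff G k) * (of_nat k * t ^ (k - 1)))"
  by (simp add: fderiv_def rpoly_hom rhomD mult_ac)

lemma degree_fderiv_le: "degree (fderiv G) \<le> degree G - 1"
  unfolding fderiv_def by (rule degree_sum_le) (auto intro: order_trans[OF degree_monom_le])

lemma lead_coeff_fderiv: "degree G > 0 \<Longrightarrow> coeff (fderiv G) (degree G - 1) = of_nat (degree G) * lead_coeff G"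
proof -
  assume d: "degree G > 0"
  have "coeff (fderiv G) (degree G - 1) = (\<Sum>k\<le>degree G. if k = degree G then of_nat (degree G) * lead_coeff G else 0)"
    unfolding fderiv_def coeff_sum
  proof (rule sum.cong)
    fix k assume "k \<in> {..degree G}"
    then show "coeff (monom (of_nat k * coeff G k) (k - 1)) (degree G - 1) = (if k = degree G then of_nat (degree G) * lead_coeff G else 0)"
      using d by (cases "k = 0") auto
  qed auto
  then show ?thesis by simp
qed

definition partial_deriv :: "'x::finite \<Rightarrow> 'x cpoly \<Rightarrow> 'x cpoly" where
  "partial_deriv i f = (SOME f'. \<forall>x. ((\<lambda>t. ev f (x(i := t))) has_field_derivative ev f' x) (at (x i)))"

lemma partial_deriv: "((\<lambda>t. ev f (x(i := t))) has_field_derivative ev (partial_deriv i f) x) (at (x i))"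
  using someI_ex[OF ex_partial_derivative, of f i] unfolding partial_deriv_def by blast

text \<open>By \<open>prime\<close> and \<open>closed\<close> the ideal of \<open>X\<close> is prime
  and \<open>X\<close> is its zero set, so \<open>X\<close> is an irreducible affine variety; the
  other assumptions are the outcome of \<open>noether_normalization\<close>.\<close>

locale noether_normalized =
  fixes X :: "('v::finite \<Rightarrow> complex) set" and I :: "'v set" and y :: "'v \<Rightarrow> 'v cpoly" and E :: "'v cpoly set"
  assumes prime: "\<And>p q. (\<forall>x\<in>X. ev (p * q) x = 0) \<Longrightarrow> (\<forall>x\<in>X. ev p x = 0) \<or> (\<forall>x\<in>X. ev q x = 0)"
    and closed: "\<And>x. (\<And>p. (\<forall>z\<in>X. ev p z = 0) \<Longrightarrow> ev p x = 0) \<Longrightarrow> x \<in> X"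
    and gen: "module_gen X y E"
    and y_outside: "\<And>i. i \<notin> I \<Longrightarrow> y i = 0"
    and indep: "\<And>H Y. (\<And>x. x \<in> X \<Longrightarrow> ev H (\<lambda>i. ev (y i) x) = 0) \<Longrightarrow> (\<And>i. i \<notin> I \<Longrightarrow> Y i = 0) \<Longrightarrow> ev H Y = 0"
begin

text \<open>The base has coordinates \<open>Inl i\<close> for \<open>y i\<close> (free dummies for \<open>i \<notin> I\<close>) and \<open>Inr l\<close> for
  the coefficient of \<open>x l\<close> in a general linear form.\<close>

definition Z :: "(('v \<Rightarrow> complex) \<times> ('v + 'v \<Rightarrow> complex)) set" where
  "Z = {(x, Y). x \<in> X \<and> (\<forall>i\<in>I. Y (Inl i) = ev (y i) x)}"

definition vanZ :: "('v + ('v + 'v)) cpoly \<Rightarrow> bool" where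
  "vanZ \<Phi> \<longleftrightarrow> (\<forall>x Y. (x, Y) \<in> Z \<longrightarrow> ev \<Phi> (case_sum x Y) = 0)"

text \<open>\<open>Z\<close> is \<open>X\<close> times an affine space. If neither factor vanished
  on \<open>Z\<close>, one choice of the free coordinates would make both nonzero somewhere over
  \<open>X\<close>, against primeness on \<open>X\<close>.\<close>

lemma vanZ_prime:
  assumes "vanZ (\<Phi> * \<Psi>)"
  shows "vanZ \<Phi> \<or> vanZ \<Psi>"
proof (rule ccontr)
  assume "\<not> (vanZ \<Phi> \<or> vanZ \<Psi>)"
  then obtain x1 Y1 x2 Y2 where
    1: "(x1, Y1) \<in> Z" "ev \<Phi> (case_sum x1 Y1) \<noteq> 0" and 2: "(x2, Y2) \<in> Z" "ev \<Psi> (case_sum x2 Y2) \<noteq> 0"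
    unfolding vanZ_def by blast
  define Yx where "Yx x W = (case_sum (\<lambda>i. if i \<in> I then ev (y i) x else W (Inl i)) (\<lambda>l. W (Inr l)))"
    for x and W :: "'v + 'v \<Rightarrow> complex"
  have YxZ: "(x, Yx x W) \<in> Z" if "x \<in> X" for x W using that by (auto simp: Z_def Yx_def)
  have Yx_self: "Yx x Y = Y" if "(x, Y) \<in> Z" for x Y
    using that by (auto simp: Z_def Yx_def fun_eq_iff split: sum.split)
  \<comment> \<open>Two specializations: \<open>A\<close> fixes the point of \<open>X\<close> and
    keeps the free coordinates variable, the later \<open>B\<close> does the reverse.\<close>
  define A where "A x (p :: ('v + ('v + 'v)) cpoly) = peval PC p (case_sum (\<lambda>i. PC (x i))
     (case_sum (\<lambda>i. if i \<in> I then PC (ev (y i) x) else PV (Inl i)) (\<lambda>l. PV (Inr l))))" for x p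
  have A: "ev (A x p) W = ev p (case_sum x (Yx x W))" for x p W
    unfolding A_def cpoly_eval_subst Yx_def
    by (rule arg_cong[of _ _ "ev p"]) (auto split: sum.split)
  have "ev (A x1 \<Phi>) Y1 \<noteq> 0" "ev (A x2 \<Psi>) Y2 \<noteq> 0"
    using 1 2 by (auto simp: A Yx_self)
  then obtain W where W: "ev (A x1 \<Phi>) W \<noteq> 0" "ev (A x2 \<Psi>) W \<noteq> 0"
    using cpoly_common_nonzero by blast
  define B where "B (p :: ('v + ('v + 'v)) cpoly) = peval PC p (case_sum PV
     (case_sum (\<lambda>i. if i \<in> I then y i else PC (W (Inl i))) (\<lambda>l. PC (W (Inr l)))))" for p
  have B: "ev (B p) x = ev p (case_sum x (Yx x W))" for x p
    unfolding B_def cpoly_eval_subst Yx_def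
    by (rule arg_cong[of _ _ "ev p"]) (auto split: sum.split)
  have "\<forall>x\<in>X. ev (B \<Phi> * B \<Psi>) x = 0"
    using assms YxZ[of _ W] by (auto simp: B vanZ_def)
  then have "(\<forall>x\<in>X. ev (B \<Phi>) x = 0) \<or> (\<forall>x\<in>X. ev (B \<Psi>) x = 0)" by (rule prime)
  then show False using W 1(1) 2(1) unfolding A B by (auto simp: Z_def)
qed

text \<open>Freezing the dummies and the w_l at a point where \<open>H\<close> is nonzero leaves a
  polynomial in the y_i with i in \<open>I\<close>, to which \<open>indep\<close> applies.\<close>

lemma base_independent:
  assumes "\<And>x Y. (x, Y) \<in> Z \<Longrightarrow> ev H Y = 0"
  shows "H = 0"
proof (rule ccontr)
  assume "H \<noteq> 0"
  then obtain W where W: "ev H W \<noteq> 0" using cpoly_nonzero_point by blast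
  define H' where "H' = peval PC H (case_sum (\<lambda>i. if i \<in> I then PV i else PC (W (Inl i))) (\<lambda>l. PC (W (Inr l))))"
  have H': "ev H' Y = ev H (case_sum (\<lambda>i. if i \<in> I then Y i else W (Inl i)) (\<lambda>l. W (Inr l)))" for Y
    unfolding H'_def cpoly_eval_subst
    by (rule arg_cong[of _ _ "ev H"]) (auto split: sum.split)
  have "ev H' (\<lambda>i. if i \<in> I then W (Inl i) else 0) = 0"
  proof (rule indep)
    fix x assume "x \<in> X"
    then show "ev H' (\<lambda>i. ev (y i) x) = 0"
      unfolding H' by (intro assms[of x]) (auto simp: Z_def)
  qed auto
  moreover have "(case_sum (\<lambda>i. if i \<in> I then if i \<in> I then W (Inl i) else 0 else W (Inl i)) (\<lambda>l. W (Inr l))) = W"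
    by (auto split: sum.split)
  ultimately show False using W by (simp add: H')
qed

lemma finite_E: "finite E"
  using gen by (simp add: module_gen_def)

lemma genX: "\<exists>c. \<forall>x Y. (x, Y) \<in> Z \<longrightarrow> ev f x = (\<Sum>e\<in>E. ev (c e) Y * ev e x)"
proof -
  have "\<exists>c. \<forall>x\<in>X. ev f x = (\<Sum>e\<in>E. ev (c e) (\<lambda>i. ev (y i) x) * ev e x)"
    using gen by (simp add: module_gen_def)
  then obtain c where c: "\<And>x. x \<in> X \<Longrightarrow> ev f x = (\<Sum>e\<in>E. ev (c e) (\<lambda>i. ev (y i) x) * ev e x)"
    by blast
  have eq: "(\<lambda>i. ev (if i \<in> I then PV (Inl i) else 0) Y) = (\<lambda>i. ev (y i) x)" if "(x, Y) \<in> Z" for x Y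
    using that y_outside by (auto simp: Z_def)
  show ?thesis
  proof (intro exI[of _ "\<lambda>e. peval PC (c e) (\<lambda>i. if i \<in> I then PV (Inl i) else 0)"] allI impI)
    fix x Y assume z: "(x, Y) \<in> Z"
    then have "x \<in> X" by (simp add: Z_def)
    then show "ev f x = (\<Sum>e\<in>E. ev (peval PC (c e) (\<lambda>i. if i \<in> I then PV (Inl i) else 0)) Y * ev e x)"
      by (simp only: cpoly_eval_subst eq[OF z] c)
  qed
qed

text \<open>The base coordinates only enter the coefficients, and a product of two combinations
  returns to \<open>E\<close> by expanding each product of two generators with
  \<open>genX\<close>.\<close>

lemma genZ: "\<exists>c. \<forall>x Y. (x, Y) \<in> Z \<longrightarrow> ev \<Phi> (case_sum x Y) = (\<Sum>e\<in>E. ev (c e) Y * ev e x)"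
proof (induction \<Phi> rule: cpoly_induct)
  case (const c)
  show ?case using genX[of "PC c"] by simp
next
  case (var j)
  show ?case
  proof (cases j)
    case (Inl i)
    then show ?thesis using genX[of "PV i"] by simp
  next
    case (Inr i)
    obtain c where c: "\<And>x Y. (x, Y) \<in> Z \<Longrightarrow> ev 1 x = (\<Sum>e\<in>E. ev (c e) Y * ev e x)"
      using genX[of 1] by blast
    have "Y i = (\<Sum>e\<in>E. ev (PV i * c e) Y * ev e x)" if "(x, Y) \<in> Z" for x Y
      using c[OF that] by (simp add: mult.assoc flip: sum_distrib_left)
    then show ?thesis using Inr by (intro exI[of _ "\<lambda>e. PV i * c e"]) simp
  qed
next
  case (add f g)
  then obtain c d where
    c: "\<And>x Y. (x, Y) \<in> Z \<Longrightarrow> ev f (case_sum x Y) = (\<Sum>e\<in>E. ev (c e) Y * ev e x)" and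
    d: "\<And>x Y. (x, Y) \<in> Z \<Longrightarrow> ev g (case_sum x Y) = (\<Sum>e\<in>E. ev (d e) Y * ev e x)"
    by blast
  show ?case by (intro exI[of _ "\<lambda>e. c e + d e"]) (auto simp: c d algebra_simps sum.distrib)
next
  case (mult f g)
  then obtain c d where
    c: "\<And>x Y. (x, Y) \<in> Z \<Longrightarrow> ev f (case_sum x Y) = (\<Sum>e\<in>E. ev (c e) Y * ev e x)" and
    d: "\<And>x Y. (x, Y) \<in> Z \<Longrightarrow> ev g (case_sum x Y) = (\<Sum>e\<in>E. ev (d e) Y * ev e x)"
    by blast
  have "\<forall>p. \<exists>b. \<forall>x Y. (x, Y) \<in> Z \<longrightarrow> ev p x = (\<Sum>e\<in>E. ev (b e) Y * ev e x)"
    by (intro allI genX)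
  then have "\<exists>b. \<forall>p. \<forall>x Y. (x, Y) \<in> Z \<longrightarrow> ev p x = (\<Sum>e\<in>E. ev (b p e) Y * ev e x)"
    by (rule choice)
  then obtain b where b: "\<And>p x Y. (x, Y) \<in> Z \<Longrightarrow> ev p x = (\<Sum>e\<in>E. ev (b p e) Y * ev e x)"
    by blast
  show ?case
  proof (intro exI allI impI)
    fix x Y assume z: "(x, Y) \<in> Z"
    have "ev (f * g) (case_sum x Y) = (\<Sum>e\<in>E. \<Sum>e'\<in>E. ev (c e) Y * ev (d e') Y * ev (e * e') x)"
      by (simp add: c[OF z] d[OF z] sum_product mult_ac)
    also have "\<dots> = (\<Sum>e\<in>E. \<Sum>e'\<in>E. \<Sum>e''\<in>E. ev (c e) Y * ev (d e') Y * (ev (b (e * e') e'') Y * ev e'' x))"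
      unfolding b[OF z, of "_ * _"] sum_distrib_left ..
    also have "\<dots> = (\<Sum>e''\<in>E. \<Sum>e\<in>E. \<Sum>e'\<in>E. ev (c e) Y * ev (d e') Y * (ev (b (e * e') e'') Y * ev e'' x))"
      by (subst sum.swap[of _ E], subst sum.swap) (auto intro!: sum.cong sum.swap)
    also have "\<dots> = (\<Sum>e''\<in>E. ev (\<Sum>e\<in>E. \<Sum>e'\<in>E. c e * d e' * b (e * e') e'') Y * ev e'' x)"
      by (intro sum.cong refl) (simp add: sum_distrib_right sum_distrib_left mult_ac)
    finally show "ev (f * g) (case_sum x Y) = (\<Sum>e''\<in>E. ev (\<Sum>e\<in>E. \<Sum>e'\<in>E. c e * d e' * b (e * e') e'') Y * ev e'' x)" .
  qed
qed

section \<open>Relations of least degree over the base\<close>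

definition rel :: "('v + ('v + 'v)) cpoly \<Rightarrow> ('v + 'v) cpoly poly \<Rightarrow> bool" where
  "rel \<Phi> G \<longleftrightarrow> (\<forall>x Y. (x, Y) \<in> Z \<longrightarrow> rpoly_ev Y G (ev \<Phi> (case_sum x Y)) = 0)"

definition minrel :: "('v + ('v + 'v)) cpoly \<Rightarrow> ('v + 'v) cpoly poly \<Rightarrow> bool" where
  "minrel \<Phi> G \<longleftrightarrow> G \<noteq> 0 \<and> rel \<Phi> G \<and> (\<forall>G'. G' \<noteq> 0 \<longrightarrow> rel \<Phi> G' \<longrightarrow> degree G \<le> degree G')"

text \<open>The powers of \<open>\<Phi>\<close> with exponents from 0 to \<open>card E\<close> are
  combinations of only \<open>card E\<close> generators, hence linearly dependent over the base
  ring. The leading coefficient is still arbitrary.\<close>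

lemma ex_minrel: "\<exists>G. minrel \<Phi> G"
proof -
  let ?K = "{..card E}"
  have "\<forall>k. \<exists>c. \<forall>x Y. (x, Y) \<in> Z \<longrightarrow> ev (\<Phi> ^ k) (case_sum x Y) = (\<Sum>e\<in>E. ev (c e) Y * ev e x)"
    by (intro allI genZ)
  then have "\<exists>c. \<forall>k. \<forall>x Y. (x, Y) \<in> Z \<longrightarrow> ev (\<Phi> ^ k) (case_sum x Y) = (\<Sum>e\<in>E. ev (c k e) Y * ev e x)"
    by (rule choice)
  then obtain c where c: "\<And>k x Y. (x, Y) \<in> Z \<Longrightarrow> ev \<Phi> (case_sum x Y) ^ k = (\<Sum>e\<in>E. ev (c k e) Y * ev e x)"
    by auto
  obtain g where g: "\<exists>k\<in>?K. g k \<noteq> 0" "\<And>e. e \<in> E \<Longrightarrow> (\<Sum>k\<in>?K. g k * c k e) = 0"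
    using cpoly_linear_dependence[of E ?K c] finite_E by auto
  define G where "G = (\<Sum>k\<in>?K. monom (g k) k)"
  have cG: "coeff G k = g k" if "k \<in> ?K" for k
    unfolding G_def coeff_sum using that by simp
  have "degree G \<le> card E"
    unfolding G_def by (rule degree_sum_le) (auto intro: order_trans[OF degree_monom_le])
  then have "rel \<Phi> G"
    unfolding rel_def
  proof (intro allI impI)
    fix x Y assume z: "(x, Y) \<in> Z"
    have "rpoly_ev Y G (ev \<Phi> (case_sum x Y)) = (\<Sum>k\<in>?K. ev (g k) Y * (\<Sum>e\<in>E. ev (c k e) Y * ev e x))"
      using rpoly_altdef[OF rhom_cpoly_eval \<open>degree G \<le> card E\<close>] by (simp add: cG c[OF z])
    also have "\<dots> = (\<Sum>e\<in>E. ev (\<Sum>k\<in>?K. g k * c k e) Y * ev e x)"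
      proof -
      have "(\<Sum>k\<in>?K. ev (g k) Y * (\<Sum>e\<in>E. ev (c k e) Y * ev e x)) =
          (\<Sum>k\<in>?K. \<Sum>e\<in>E. ev (g k) Y * ev (c k e) Y * ev e x)"
        by (simp add: sum_distrib_left mult.assoc)
      also have "\<dots> = (\<Sum>e\<in>E. \<Sum>k\<in>?K. ev (g k) Y * ev (c k e) Y * ev e x)"
        by (rule sum.swap)
      finally show ?thesis by (simp add: sum_distrib_right)
    qed
    also have "\<dots> = 0" by (intro sum.neutral ballI) (simp only: g(2) cpoly_eval_hom(1) mult_zero_left)
    finally show "rpoly_ev Y G (ev \<Phi> (case_sum x Y)) = 0" .
  qed
  moreover have "G \<noteq> 0" using g(1) cG by auto
  ultimately have "\<exists>G. G \<noteq> 0 \<and> rel \<Phi> G" by blast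
  then show ?thesis
    using ex_has_least_nat[of "\<lambda>G. G \<noteq> 0 \<and> rel \<Phi> G" _ degree] unfolding minrel_def by blast
qed

lemma rel_degree_pos:
  assumes "rel \<Phi> G" "G \<noteq> 0"
  shows "degree G > 0"
proof (rule ccontr)
  assume "\<not> degree G > 0"
  then obtain g where G: "G = [:g:]" by (auto elim: degree_eq_zeroE)
  then have "g = 0" using assms(1) by (intro base_independent) (auto simp: rel_def)
  then show False using assms G by simp
qed

text \<open>The pseudo-remainder of \<open>H\<close> modulo \<open>G\<close> is a relation of
  smaller degree, hence zero. So a root of \<open>G\<close> in any integral domain behaves like
  \<open>\<Phi>\<close> itself; this is how identities on \<open>Z\<close> reach numbers and
  series.\<close>

lemma minrel_divides:
  fixes h :: "complex \<Rightarrow> 'r::idom"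
  assumes "minrel \<Phi> G" "rel \<Phi> H" "rhom h"
    and "peval h (lead_coeff G) Y \<noteq> 0" "rpoly_peval h Y G T = 0"
  shows "rpoly_peval h Y H T = 0"
proof -
  have G: "G \<noteq> 0" "rel \<Phi> G" using assms(1) by (auto simp: minrel_def)
  obtain q R where qR: "pseudo_divmod H G = (q, R)" by fastforce
  define N where "N = Suc (degree H) - degree G"
  have 1: "smult (lead_coeff G ^ N) H = G * q + R" and 2: "R = 0 \<or> degree R < degree G"
    using pseudo_divmod[OF G(1) qR] by (auto simp: N_def)
  have "rel \<Phi> R"
    unfolding rel_def
  proof (intro allI impI)
    fix x Y assume z: "(x, Y) \<in> Z"
    show "rpoly_ev Y R (ev \<Phi> (case_sum x Y)) = 0"
      using arg_cong[OF 1, of "\<lambda>p. rpoly_ev Y p (ev \<Phi> (case_sum x Y))"] z assms(2) G(2)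
      by (simp add: rel_def)
  qed
  then have "R = 0" using 2 assms(1) unfolding minrel_def by force
  then show ?thesis
    using arg_cong[OF 1, of "\<lambda>p. rpoly_peval h Y p T"] assms by (simp add: peval_hom)
qed

text \<open>Otherwise G = T * G', and irreducibility of \<open>Z\<close> would make G' a relation of
  smaller degree.\<close>

lemma minrel_coeff_0:
  assumes "minrel \<Phi> G" "\<not> vanZ \<Phi>"
  shows "coeff G 0 \<noteq> 0"
proof
  assume c0: "coeff G 0 = 0"
  obtain g G' where G: "G = pCons g G'" by (cases G)
  then have g: "g = 0" using c0 by simp
  have G0: "G \<noteq> 0" "rel \<Phi> G" using assms(1) by (auto simp: minrel_def)
  then have G'0: "G' \<noteq> 0" using G g by auto
  have ev: "ev (rpoly (\<lambda>p. peval PC p (\<lambda>i. PV (Inr i))) G' \<Phi>) (case_sum x Y) = rpoly_ev Y G' (ev \<Phi> (case_sum x Y))" for x Y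
    by (subst rpoly_commute[OF _ rhom_cpoly_eval]) auto
  have "vanZ (\<Phi> * rpoly (\<lambda>p. peval PC p (\<lambda>i. PV (Inr i))) G' \<Phi>)"
    using G0(2) by (auto simp: vanZ_def rel_def ev G g rpoly_pCons)
  then have "vanZ (rpoly (\<lambda>p. peval PC p (\<lambda>i. PV (Inr i))) G' \<Phi>)" using vanZ_prime assms(2) by blast
  then have "rel \<Phi> G'" by (auto simp: vanZ_def rel_def ev)
  then show False using assms(1) G'0 G g unfolding minrel_def by force
qed

section \<open>The general linear form and its derivatives in the coefficients w\<close>

definition lform :: "('v + ('v + 'v)) cpoly" where
  "lform = (\<Sum>l\<in>UNIV. PV (Inr (Inr l)) * PV (Inl l))"

lemma eval_lform: "ev lform (case_sum x Y) = (\<Sum>l\<in>UNIV. Y (Inr l) * x l)"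
  by (simp add: lform_def)

definition coord_deriv :: "('v + 'v) cpoly poly \<Rightarrow> 'v \<Rightarrow> ('v + 'v) cpoly poly" where
  "coord_deriv G l = (\<Sum>k\<le>degree G. monom (partial_deriv (Inr l) (coeff G k)) k)"

lemma rpoly_coord_deriv:
  assumes "rhom \<phi>"
  shows "rpoly \<phi> (coord_deriv G l) T = (\<Sum>k\<le>degree G. \<phi> (partial_deriv (Inr l) (coeff G k)) * T ^ k)"
proof -
  have d: "degree (coord_deriv G l) \<le> degree G"
    unfolding coord_deriv_def by (rule degree_sum_le) (auto intro: order_trans[OF degree_monom_le])
  have "coeff (coord_deriv G l) k = partial_deriv (Inr l) (coeff G k)" if "k \<le> degree G" for k
    unfolding coord_deriv_def coeff_sum using that by simp
  then show ?thesis using rpoly_altdef[OF assms d] by simp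
qed

text \<open>Differentiating \<open>G(y, w, \<Sum> w\<^sub>l x\<^sub>l) = 0\<close> with respect to \<open>w\<^sub>l\<close>.\<close>

lemma coord_deriv_identity:
  assumes "rel lform G" "(x, Y) \<in> Z"
  shows "rpoly_ev Y (coord_deriv G l) (ev lform (case_sum x Y)) +
    x l * rpoly_ev Y (fderiv G) (ev lform (case_sum x Y)) = 0"
proof -
  define a where "a = ev lform (case_sum x Y)"
  let ?Y = "\<lambda>t. Y(Inr l := t)"
  define u where "u t = a + (t - Y (Inr l)) * x l" for t
  have u: "ev lform (case_sum x (?Y t)) = u t" for t
  proof -
    have "(\<Sum>k\<in>UNIV. ?Y t (Inr k) * x k) = (\<Sum>k\<in>UNIV. Y (Inr k) * x k + (if k = l then (t - Y (Inr l)) * x l else 0))"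
      by (intro sum.cong) (auto simp: algebra_simps)
    then show ?thesis by (simp add: eval_lform u_def a_def sum.distrib)
  qed
  define g where "g t = (\<Sum>k\<le>degree G. ev (coeff G k) (?Y t) * u t ^ k)" for t
  have "g t = 0" for t
  proof -
    \<comment> \<open>The coordinate w_l is free on \<open>Z\<close>, so it can vary while
      \<open>x\<close> stays fixed.\<close>
    have "(x, ?Y t) \<in> Z" using assms(2) by (auto simp: Z_def)
    then have "rpoly (\<lambda>p. ev p (?Y t)) G (u t) = 0" using assms(1) u[of t] by (metis rel_def)
    then show ?thesis using rpoly_altdef[OF rhom_cpoly_eval order_refl, of "?Y t" G "u t"] by (simp add: g_def)
  qed
  then have "g = (\<lambda>_. 0)" by auto
  then have d0: "(g has_field_derivative 0) (at (Y (Inr l)))" by simp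
  have du: "(u has_field_derivative x l) (at t)" for t
    unfolding u_def by (auto intro!: derivative_eq_intros)
  have uY: "u (Y (Inr l)) = a" by (simp add: u_def)
  have "(g has_field_derivative (\<Sum>k\<le>degree G. ev (partial_deriv (Inr l) (coeff G k)) Y * a ^ k +
      ev (coeff G k) Y * (of_nat k * a ^ (k - 1) * x l))) (at (Y (Inr l)))"
    unfolding g_def
  proof (rule DERIV_sum, goal_cases)
    case (1 k)
    have "((\<lambda>t. u t ^ k) has_field_derivative of_nat k * (u (Y (Inr l)) ^ (k - Suc 0) * x l)) (at (Y (Inr l)))"
      using DERIV_power[OF du, of k] by (simp add: mult_ac)
    from DERIV_mult[OF partial_deriv[of "coeff G k" Y "Inr l"] this]
    show ?case by (simp add: uY mult_ac add_ac)
  qed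
  from DERIV_unique[OF d0 this]
  have eq: "(\<Sum>k\<le>degree G. ev (partial_deriv (Inr l) (coeff G k)) Y * a ^ k) +
     x l * (\<Sum>k\<le>degree G. ev (coeff G k) Y * (of_nat k * a ^ (k - 1))) = 0"
    by (simp add: sum.distrib sum_distrib_left mult_ac)
  then show ?thesis using eq by (simp add: a_def rpoly_coord_deriv rpoly_fderiv)
qed

lemma rel_iff_vanZ: "rel \<Phi> H \<longleftrightarrow> vanZ (rpoly (\<lambda>p. peval PC p (\<lambda>i. PV (Inr i))) H \<Phi>)"
proof -
  have "ev (rpoly (\<lambda>p. peval PC p (\<lambda>i. PV (Inr i))) H \<Phi>) (case_sum x Y) = rpoly_ev Y H (ev \<Phi> (case_sum x Y))" for x Y
    by (subst rpoly_commute[OF _ rhom_cpoly_eval]) auto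
  then show ?thesis by (auto simp: vanZ_def rel_def)
qed

text \<open>Since G_T x_l = - G_(w_l), a power of G_T turns any polynomial in x and Y into a
  polynomial \<open>H\<close> in T over the base. If it vanishes on \<open>Z\<close>, then
  \<open>H\<close> is a relation of the linear form and vanishes at \<open>T\<close>; as G_T is
  nonzero there, \<open>\<Phi>\<close> vanishes at \<open>\<xi>\<close>.\<close>

lemma transfer_identity:
  fixes h :: "complex \<Rightarrow> 'r::field"
  assumes G: "minrel lform G" and h: "rhom h"
    and lead: "peval h (lead_coeff G) Y \<noteq> 0" and root: "rpoly_peval h Y G T = 0"
    and r: "rpoly_peval h Y (fderiv G) T \<noteq> 0"
    and \<xi>: "\<And>l. \<xi> l = - rpoly_peval h Y (coord_deriv G l) T / rpoly_peval h Y (fderiv G) T"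
    and van: "vanZ \<Phi>"
  shows "peval h \<Phi> (case_sum \<xi> Y) = 0"
proof -
  have relG: "rel lform G" using G by (simp add: minrel_def)
  let ?a = "\<lambda>x Y. ev lform (case_sum x Y)"
  let ?r = "rpoly_peval h Y (fderiv G) T"
  \<comment> \<open>The same \<open>e\<close> and \<open>H\<close> have to serve both on
    \<open>Z\<close> and at \<open>\<xi>\<close>; the induction carries the two claims
    together.\<close>
  have "\<exists>e H. (\<forall>x Y. (x, Y) \<in> Z \<longrightarrow> rpoly_ev Y (fderiv G) (?a x Y) ^ e * ev \<Phi> (case_sum x Y) =
      rpoly_ev Y H (?a x Y)) \<and> ?r ^ e * peval h \<Phi> (case_sum \<xi> Y) = rpoly_peval h Y H T"
  proof (induction \<Phi> rule: cpoly_induct)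
    case (const c)
    show ?case by (rule exI[of _ 0], rule exI[of _ "[:PC c:]"]) (auto simp: h)
  next
    case (var j)
    show ?case
    proof (cases j)
      case (Inl l)
      have 1: "rpoly_ev Y (fderiv G) (?a x Y) * x l = rpoly_ev Y (- coord_deriv G l) (?a x Y)" if "(x, Y) \<in> Z" for x Y
        using coord_deriv_identity[OF relG that, of l] by (simp add: rpoly_hom eq_neg_iff_add_eq_0 add_ac mult_ac)
      show ?thesis
        by (rule exI[of _ 1], rule exI[of _ "- coord_deriv G l"]) (use r in \<open>auto simp: Inl 1 h \<xi> rpoly_hom\<close>)
    next
      case (Inr i)
      then show ?thesis by (intro exI[of _ 0] exI[of _ "[:PV i:]"]) (auto simp: h)
    qed
  next
    case (add f g)
    then obtain e1 H1 e2 H2 where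
      1: "\<And>x Y. (x, Y) \<in> Z \<Longrightarrow> rpoly_ev Y (fderiv G) (?a x Y) ^ e1 * ev f (case_sum x Y) = rpoly_ev Y H1 (?a x Y)"
         "?r ^ e1 * peval h f (case_sum \<xi> Y) = rpoly_peval h Y H1 T" and
      2: "\<And>x Y. (x, Y) \<in> Z \<Longrightarrow> rpoly_ev Y (fderiv G) (?a x Y) ^ e2 * ev g (case_sum x Y) = rpoly_ev Y H2 (?a x Y)"
         "?r ^ e2 * peval h g (case_sum \<xi> Y) = rpoly_peval h Y H2 T" by blast
    show ?case
      by (rule exI[of _ "e1 + e2"], rule exI[of _ "fderiv G ^ e2 * H1 + fderiv G ^ e1 * H2"])
         (auto simp: h rpoly_hom power_add algebra_simps simp flip: 1 2)
  next
    case (mult f g)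
    then obtain e1 H1 e2 H2 where
      1: "\<And>x Y. (x, Y) \<in> Z \<Longrightarrow> rpoly_ev Y (fderiv G) (?a x Y) ^ e1 * ev f (case_sum x Y) = rpoly_ev Y H1 (?a x Y)"
         "?r ^ e1 * peval h f (case_sum \<xi> Y) = rpoly_peval h Y H1 T" and
      2: "\<And>x Y. (x, Y) \<in> Z \<Longrightarrow> rpoly_ev Y (fderiv G) (?a x Y) ^ e2 * ev g (case_sum x Y) = rpoly_ev Y H2 (?a x Y)"
         "?r ^ e2 * peval h g (case_sum \<xi> Y) = rpoly_peval h Y H2 T" by blast
    show ?case
      by (rule exI[of _ "e1 + e2"], rule exI[of _ "H1 * H2"])
         (auto simp: h power_add mult_ac simp flip: 1 2)
  qed
  then obtain e H where H: "\<And>x Y. (x, Y) \<in> Z \<Longrightarrow> rpoly_ev Y (fderiv G) (?a x Y) ^ e * ev \<Phi> (case_sum x Y) =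
      rpoly_ev Y H (?a x Y)" "?r ^ e * peval h \<Phi> (case_sum \<xi> Y) = rpoly_peval h Y H T"
    by blast
  have "rel lform H" using van by (auto simp: rel_def vanZ_def simp flip: H(1))
  from minrel_divides[OF G this h lead root] show ?thesis using H(2) r by simp
qed

end

section \<open>Integrality of the minimal polynomial\<close>

text \<open>The polynomial \<open>r\<close> marks points where no bound is known. Near a root t0 of
  \<open>q\<close> the bound holds except possibly at t0, so by continuity \<open>p\<close> vanishes
  at t0 and the linear factor cancels from both.\<close>

lemma poly_dvd_of_local_bound:
  fixes p q r :: "complex poly"
  assumes "q \<noteq> 0" "r \<noteq> 0" "\<And>R. \<exists>C. \<forall>t. cmod t \<le> R \<longrightarrow> poly r t \<noteq> 0 \<longrightarrow> cmod (poly p t) \<le> C * cmod (poly q t)"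
  shows "q dvd p"
  using assms
proof (induction "degree q" arbitrary: p q r)
  case 0
  then obtain c where "q = [:c:]" "c \<noteq> 0" by (metis degree_eq_zeroE pCons_0_0)
  then show ?case by (simp add: const_poly_dvd_iff dvd_field_iff)
next
  case (Suc n)
  then obtain t0 where t0: "poly q t0 = 0"
    using alg_closed_imp_poly_has_root[of q] by auto
  obtain C where C: "\<And>t. cmod t \<le> cmod t0 + 1 \<Longrightarrow> poly r t \<noteq> 0 \<Longrightarrow> cmod (poly p t) \<le> C * cmod (poly q t)"
    using Suc.prems(3) by blast
  have "finite {t. poly r t = 0}" using Suc.prems(2) by (rule poly_roots_finite)
  then have "eventually (\<lambda>t. poly r t \<noteq> 0) (at t0)"
    using islimpt_finite[of "{t. poly r t = 0}" t0] unfolding islimpt_iff_eventually by simp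
  moreover have "eventually (\<lambda>t. dist t t0 < 1) (at t0)" by (rule eventually_at_ball'[THEN eventually_mono]) (auto simp: dist_commute)
  then have "eventually (\<lambda>t. cmod t \<le> cmod t0 + 1) (at t0)"
    by eventually_elim (metis add.commute add_le_cancel_left dist_norm less_le norm_triangle_sub order_trans)
  ultimately have "eventually (\<lambda>t. cmod (poly p t) \<le> C * cmod (poly q t)) (at t0)"
    by eventually_elim (use C in auto)
  moreover have "((\<lambda>t. cmod (poly p t)) \<longlongrightarrow> cmod (poly p t0)) (at t0)" "((\<lambda>t. C * cmod (poly q t)) \<longlongrightarrow> C * cmod (poly q t0)) (at t0)"
    by (intro tendsto_intros isContD poly_isCont)+
  ultimately have "cmod (poly p t0) \<le> C * cmod (poly q t0)"
    by (intro tendsto_le[of "at t0"]) auto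
  then have "poly p t0 = 0" using t0 by simp
  then obtain p' q' where p': "p = [:- t0, 1:] * p'" and q': "q = [:- t0, 1:] * q'"
    using t0 by (metis dvd_def poly_eq_0_iff_dvd)
  have q'0: "q' \<noteq> 0" using q' Suc.prems(1) by auto
  then have "degree q = Suc (degree q')" unfolding q' by (subst degree_mult_eq) auto
  then have n: "n = degree q'" using Suc.hyps(2) by simp
  have "q' dvd p'"
  proof (rule Suc.hyps(1)[OF n q'0])
    \<comment> \<open>The enlarged \<open>r\<close> also excludes t0, where the common factor is
      zero and cannot be cancelled from the inequality.\<close>
    show "r * [:- t0, 1:] \<noteq> 0" using Suc.prems(2) by (simp del: mult_pCons_right)
    fix R
    obtain C where C: "\<forall>t. cmod t \<le> R \<longrightarrow> poly r t \<noteq> 0 \<longrightarrow> cmod (poly p t) \<le> C * cmod (poly q t)"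
      using Suc.prems(3) by blast
    show "\<exists>C. \<forall>t. cmod t \<le> R \<longrightarrow> poly (r * [:- t0, 1:]) t \<noteq> 0 \<longrightarrow> cmod (poly p' t) \<le> C * cmod (poly q' t)"
    proof (intro exI allI impI)
      fix t assume t: "cmod t \<le> R" "poly (r * [:- t0, 1:]) t \<noteq> 0"
      have eq: "poly p t = (t - t0) * poly p' t" "poly q t = (t - t0) * poly q' t"
        by (simp_all add: p' q' algebra_simps)
      have "poly r t \<noteq> 0" "t \<noteq> t0" using t(2) by auto
      then have "cmod (t - t0) * cmod (poly p' t) \<le> cmod (t - t0) * (C * cmod (poly q' t))" "cmod (t - t0) > 0"
        using C[rule_format, of t] t(1) by (auto simp: eq norm_mult mult_ac)
      then show "cmod (poly p' t) \<le> C * cmod (poly q' t)" by (metis mult_le_cancel_left_pos)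
    qed
  qed
  then show ?case unfolding p' q' by (rule mult_dvd_mono[OF dvd_refl])
qed

text \<open>Restricted to the lines through a point where \<open>q\<close> is nonzero, \<open>p / q\<close> is a polynomial of bounded
  degree, and its coefficients depend polynomially on the direction of the line.\<close>

lemma cpoly_dvd_of_local_bound:
  fixes p q r :: "'x::finite cpoly"
  assumes "q \<noteq> 0" "r \<noteq> 0"
    and bound: "\<And>R. \<exists>C. \<forall>Y. (\<forall>i. cmod (Y i) \<le> R) \<longrightarrow> ev r Y \<noteq> 0 \<longrightarrow> cmod (ev p Y) \<le> C * cmod (ev q Y)"
  shows "q dvd p"
proof -
  have "q * r \<noteq> 0" using assms(1,2) by (simp add: cpoly_mult_eq_0)
  then obtain A where "ev (q * r) A \<noteq> 0" using cpoly_nonzero_point by blast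
  then have A: "ev q A \<noteq> 0" "ev r A \<noteq> 0" by auto
  \<comment> \<open>The direction of the line through \<open>A\<close> stays variable, so the
    coefficients are polynomials in the direction.\<close>
  define L where "L f = peval (\<lambda>a. [:PC a:]) f (\<lambda>i. [:PC (A i), PV i:])" for f :: "'x cpoly"
  have L: "poly (cline f A V) t = rpoly (\<lambda>p. ev p V) (L f) t" for f V t
  proof -
    have "rpoly (\<lambda>p. ev p V) (L f) t = peval (\<lambda>a. rpoly (\<lambda>p. ev p V) [:PC a:] t) f
        (\<lambda>i. rpoly (\<lambda>p. ev p V) [:PC (A i), PV i:] t)"
      unfolding L_def by (rule peval_commute[OF rhom_pcPC rhom_rpoly[OF rhom_cpoly_eval]])
    then show ?thesis by (simp add: poly_cline cpoly_eval_peval[of f] rpoly_pCons)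
  qed
  have coeff_L: "coeff (cline f A V) k = ev (coeff (L f) k) V" and deg_L: "degree (cline f A V) \<le> degree (L f)" for f V k
  proof -
    have *: "cline f A V = map_poly (\<lambda>p. ev p V) (L f)"
      by (subst poly_eq_poly_eq_iff[symmetric]) (simp add: L rpoly_def fun_eq_iff)
    show "coeff (cline f A V) k = ev (coeff (L f) k) V" by (simp add: * coeff_map_poly)
    show "degree (cline f A V) \<le> degree (L f)" by (simp add: * map_poly_degree_leq)
  qed
  have dvd: "cline q A V dvd cline p A V" for V
  proof (rule poly_dvd_of_local_bound)
    show "cline q A V \<noteq> 0" "cline r A V \<noteq> 0"
      using A poly_cline[of q A V 0] poly_cline[of r A V 0] by auto
    fix R
    define R' where "R' = (\<Sum>i\<in>UNIV. cmod (A i) + \<bar>R\<bar> * cmod (V i))"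
    have R': "cmod (A i + t * V i) \<le> R'" if "cmod t \<le> R" for i t
    proof -
      have "cmod (A i + t * V i) \<le> cmod (A i) + \<bar>R\<bar> * cmod (V i)"
        using that by (intro norm_triangle_le add_mono) (auto simp: norm_mult intro!: mult_right_mono)
      also have "\<dots> \<le> R'" unfolding R'_def by (rule member_le_sum) auto
      finally show ?thesis .
    qed
    obtain C where "\<forall>Y. (\<forall>i. cmod (Y i) \<le> R') \<longrightarrow> ev r Y \<noteq> 0 \<longrightarrow> cmod (ev p Y) \<le> C * cmod (ev q Y)"
      using bound by blast
    then show "\<exists>C. \<forall>t. cmod t \<le> R \<longrightarrow> poly (cline r A V) t \<noteq> 0 \<longrightarrow> cmod (poly (cline p A V) t) \<le> C * cmod (poly (cline q A V) t)"
      unfolding poly_cline using R' by (intro exI[of _ C]) simp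
  qed
  define c where "c V = cline p A V div cline q A V" for V
  have c: "cline p A V = cline q A V * c V" for V using dvd[of V] by (simp add: c_def)
  have q0: "coeff (cline q A V) 0 = ev q A" for V
    using poly_cline[of q A V 0] by (simp add: poly_0_coeff_0)
  \<comment> \<open>Division of power series: on every line the constant term of \<open>q\<close> is
    the nonzero number q(A), so each coefficient of the quotient follows from the earlier
    ones.\<close>
  have coeffs: "\<exists>d. \<forall>V. coeff (c V) k = ev d V" for k
  proof (induction k rule: less_induct)
    case (less k)
    have "\<forall>i. \<exists>d. i < k \<longrightarrow> (\<forall>V. coeff (c V) i = ev d V)" using less by blast
    then have "\<exists>d. \<forall>i. i < k \<longrightarrow> (\<forall>V. coeff (c V) i = ev (d i) V)" by (rule choice)
    then obtain d where d: "\<And>i V. i < k \<Longrightarrow> coeff (c V) i = ev (d i) V" by blast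
    have "coeff (c V) k = ev (PC (1 / ev q A) * (coeff (L p) k - (\<Sum>i\<in>{1..k}. coeff (L q) i * d (k - i)))) V" for V
    proof -
      have "coeff (cline p A V) k = (\<Sum>i\<le>k. coeff (cline q A V) i * coeff (c V) (k - i))"
        by (subst c) (simp add: coeff_mult)
      also have "{..k} = insert 0 {1..k}" by auto
      also have "(\<Sum>i\<in>insert 0 {1..k}. coeff (cline q A V) i * coeff (c V) (k - i)) =
          ev q A * coeff (c V) k + (\<Sum>i\<in>{1..k}. ev (coeff (L q) i) V * ev (d (k - i)) V)"
        by (subst sum.insert) (auto simp: q0[unfolded coeff_L] coeff_L d)
      finally show ?thesis using A(1) by (simp add: coeff_L field_simps)
    qed
    then show ?case by blast
  qed
  then have "\<forall>k. \<exists>d. \<forall>V. coeff (c V) k = ev d V" by blast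
  then have "\<exists>d. \<forall>k. \<forall>V. coeff (c V) k = ev (d k) V" by (rule choice)
  then obtain d where d: "\<And>k V. coeff (c V) k = ev (d k) V" by blast
  define n where "n = degree (L p)"
  have degc: "degree (c V) \<le> n" for V
  proof (cases "c V = 0")
    case False
    have "cline q A V \<noteq> 0" using A poly_cline[of q A V 0] by auto
    then have "degree (cline p A V) = degree (cline q A V) + degree (c V)"
      using False by (subst c) (simp add: degree_mult_eq)
    then show ?thesis using deg_L[of p V] by (simp add: n_def)
  qed auto
  \<comment> \<open>The point Y is reached at t = 1 on the line through \<open>A\<close> with
    direction Y - A.\<close>
  have "p = q * peval PC (\<Sum>k\<le>n. d k) (\<lambda>i. PV i - PC (A i))"
  proof (rule cpoly_eqI)
    fix Y
    let ?V = "\<lambda>i. Y i - A i"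
    have "poly (c ?V) 1 = (\<Sum>k\<le>n. coeff (c ?V) k)"
      using rpoly_altdef[OF rhom_id degc, of ?V 1] by (simp add: rpoly_def)
    moreover have "ev p Y = poly (cline q A ?V * c ?V) 1" by (simp add: poly_cline flip: c)
    ultimately show "ev p Y = ev (q * peval PC (\<Sum>k\<le>n. d k) (\<lambda>i. PV i - PC (A i))) Y"
      by (simp add: d poly_cline)
  qed
  then show ?thesis by (metis dvd_triv_left)
qed

text \<open>Splitting off one root at a time, each linear factor enlarges the coefficients at most
  by the factor 1 + C.\<close>

lemma monic_coeff_bound:
  fixes p :: "complex poly"
  assumes "lead_coeff p = 1" "\<And>z. poly p z = 0 \<Longrightarrow> cmod z \<le> C" "C \<ge> 0"
  shows "cmod (coeff p k) \<le> (1 + C) ^ degree p"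
  using assms
proof (induction "degree p" arbitrary: p k)
  case 0
  then have "p = 1" by (metis degree_eq_zeroE lead_coeff_pCons(2) one_pCons)
  then show ?case by simp
next
  case (Suc n)
  then obtain z where z: "poly p z = 0"
    using alg_closed_imp_poly_has_root[of p] by auto
  then obtain q where q: "p = [:- z, 1:] * q" by (metis dvd_def poly_eq_0_iff_dvd)
  have q0: "q \<noteq> 0" using q Suc.prems(1) by auto
  have dq: "degree p = Suc (degree q)" unfolding q by (subst degree_mult_eq) (use q0 in auto)
  have lq: "lead_coeff q = 1" using Suc.prems(1) unfolding q lead_coeff_mult by simp
  have IH: "cmod (coeff q k) \<le> (1 + C) ^ degree q" for k
    using Suc.hyps(1)[of q k] Suc.hyps(2) Suc.prems lq dq by (auto simp: q)
  have "coeff p k = (if k = 0 then 0 else coeff q (k - 1)) - z * coeff q k"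
    unfolding q by (cases k) auto
  also have "cmod \<dots> \<le> (1 + C) ^ degree q + C * (1 + C) ^ degree q"
  proof (rule norm_triangle_le_diff, rule add_mono)
    show "cmod (if k = 0 then 0 else coeff q (k - 1)) \<le> (1 + C) ^ degree q" using IH Suc.prems(3) by auto
    show "cmod (z * coeff q k) \<le> C * (1 + C) ^ degree q"
      unfolding norm_mult using IH Suc.prems z by (intro mult_mono) auto
  qed
  also have "\<dots> = (1 + C) ^ degree p" by (simp add: dq algebra_simps)
  finally show ?case .
qed

context noether_normalized
begin

abbreviation liftX :: "'v cpoly \<Rightarrow> ('v + ('v + 'v)) cpoly" where
  "liftX f \<equiv> peval PC f (\<lambda>i. PV (Inl i))"

abbreviation liftY :: "('v + 'v) cpoly \<Rightarrow> ('v + ('v + 'v)) cpoly" where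
  "liftY f \<equiv> peval PC f (\<lambda>i. PV (Inr i))"

text \<open>A substitute for the discriminant. G_T has smaller degree than \<open>G\<close> and so
  is not a relation; hence its own minimal relation N over the base has a nonzero constant term. As
  N(G_T) vanishes at every root of \<open>G\<close>, a zero of G_T at such a root makes that
  constant term vanish at \<open>Y\<close>.\<close>

lemma minrel_separable:
  assumes G: "minrel lform G"
  shows "\<exists>\<rho>. \<rho> \<noteq> 0 \<and> (\<forall>(h :: complex \<Rightarrow> 'r::field) Y T. rhom h \<longrightarrow> peval h (lead_coeff G) Y \<noteq> 0 \<longrightarrow>
     rpoly_peval h Y G T = 0 \<longrightarrow> peval h \<rho> Y \<noteq> 0 \<longrightarrow> rpoly_peval h Y (fderiv G) T \<noteq> 0)"
proof -
  have G0: "rel lform G" "G \<noteq> 0" using G by (auto simp: minrel_def)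
  have dG: "degree G > 0" by (rule rel_degree_pos[OF G0])
  have "(of_nat (degree G) :: ('v + 'v) cpoly) \<noteq> 0"
  proof
    assume "(of_nat (degree G) :: ('v + 'v) cpoly) = 0"
    then have "ev (of_nat (degree G) :: ('v + 'v) cpoly) (\<lambda>_. 0) = ev 0 (\<lambda>_. 0)" by simp
    then show False using dG by simp
  qed
  then have "fderiv G \<noteq> 0"
    using lead_coeff_fderiv[OF dG] G0(2) by (metis coeff_0 cpoly_mult_eq_0 leading_coeff_0_iff)
  have nrel: "\<not> rel lform (fderiv G)"
    using G \<open>fderiv G \<noteq> 0\<close> degree_fderiv_le[of G] dG unfolding minrel_def by fastforce
  define \<Phi> where "\<Phi> = rpoly liftY (fderiv G) lform"
  have "\<not> vanZ \<Phi>" using nrel by (simp add: rel_iff_vanZ \<Phi>_def)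
  obtain N where N: "minrel \<Phi> N" using ex_minrel by blast
  have \<Phi>: "ev \<Phi> (case_sum x Y) = rpoly_ev Y (fderiv G) (ev lform (case_sum x Y))" for x Y
    unfolding \<Phi>_def by (subst rpoly_commute[OF _ rhom_cpoly_eval]) auto
  have relN: "rel lform (pcompose N (fderiv G))"
    using N by (auto simp: minrel_def rel_def rpoly_pcompose simp flip: \<Phi>)
  show ?thesis
  proof (intro exI[of _ "coeff N 0"] conjI allI impI)
    show "coeff N 0 \<noteq> 0" by (rule minrel_coeff_0) fact+
    fix h :: "complex \<Rightarrow> 'r" and Y T
    assume *: "rhom h" "peval h (lead_coeff G) Y \<noteq> 0" "rpoly_peval h Y G T = 0" "peval h (coeff N 0) Y \<noteq> 0"
    have "rpoly_peval h Y N (rpoly_peval h Y (fderiv G) T) = 0"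
      using minrel_divides[OF G relN *(1-3)] *(1) by (simp add: rpoly_pcompose)
    moreover have "rpoly_peval h Y N 0 = peval h (coeff N 0) Y"
      using *(1) by (cases N) (simp add: rpoly_pCons)
    ultimately show "rpoly_peval h Y (fderiv G) T \<noteq> 0" using *(4) by metis
  qed
qed

lemma lift_point: "x \<in> X \<Longrightarrow> (x, case_sum (\<lambda>i. ev (y i) x) w) \<in> Z"
  by (auto simp: Z_def)

lemma vanZ_liftX: "vanZ (liftX f) \<longleftrightarrow> (\<forall>x\<in>X. ev f x = 0)"
  using lift_point by (auto simp: vanZ_def) (auto simp: Z_def)

lemma vanZ_liftY: "vanZ (liftY f) \<longleftrightarrow> f = 0"
  using base_independent[of f] by (auto simp: vanZ_def)

text \<open>A minimal relation of f reads g + T * G' with g nonzero, so on \<open>Z\<close> the base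
  function - g equals f * G'(f).\<close>

lemma base_multiple:
  assumes "\<exists>x\<in>X. ev f x \<noteq> 0"
  shows "\<exists>\<rho> \<Psi>. \<rho> \<noteq> 0 \<and> vanZ (liftY \<rho> - liftX f * \<Psi>)"
proof -
  obtain G where G: "minrel (liftX f) G" using ex_minrel by blast
  have c0: "coeff G 0 \<noteq> 0" by (rule minrel_coeff_0[OF G]) (use assms in \<open>simp add: vanZ_liftX\<close>)
  obtain g G' where Gg: "G = pCons g G'" by (cases G)
  have "vanZ (rpoly liftY G (liftX f))" using G by (simp add: minrel_def rel_iff_vanZ)
  then have "vanZ (liftY (- g) - liftX f * rpoly liftY G' (liftX f))"
    by (auto simp: Gg rpoly_pCons vanZ_def peval_hom) (metis add.inverse_inverse add_eq_0_iff)
  then show ?thesis using c0 Gg by (intro exI[of _ "- g"]) auto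
qed

text \<open>Multiplication by x_l acts on the generators by a matrix with entries polynomial in y.
  At a point of \<open>X\<close> the values of the generators form an eigenvector with eigenvalue
  x_l, so the entries bound x_l.\<close>

lemma X_bounded: "\<exists>C\<ge>0. \<forall>x\<in>X. (\<forall>i\<in>I. cmod (ev (y i) x) \<le> R) \<longrightarrow> (\<forall>l. cmod (x l) \<le> C)"
proof -
  have "\<forall>p. \<exists>c. \<forall>x\<in>X. ev p x = (\<Sum>e\<in>E. ev (c e) (\<lambda>i. ev (y i) x) * ev e x)"
    using gen by (simp add: module_gen_def)
  then have "\<exists>c. \<forall>p. \<forall>x\<in>X. ev p x = (\<Sum>e\<in>E. ev (c p e) (\<lambda>i. ev (y i) x) * ev e x)"
    by (rule choice)
  then obtain c where c: "\<And>p x. x \<in> X \<Longrightarrow> ev p x = (\<Sum>e\<in>E. ev (c p e) (\<lambda>i. ev (y i) x) * ev e x)"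
    by blast
  have "\<forall>p :: 'v cpoly. \<exists>M\<ge>0. \<forall>x. (\<forall>i. cmod (x i) \<le> max R 0) \<longrightarrow> cmod (ev p x) \<le> M"
    by (intro allI cpoly_bounded)
  then have "\<exists>M. \<forall>p :: 'v cpoly. M p \<ge> 0 \<and> (\<forall>x. (\<forall>i. cmod (x i) \<le> max R 0) \<longrightarrow> cmod (ev p x) \<le> M p)"
    by (rule choice)
  then obtain M where M: "\<And>p :: 'v cpoly. M p \<ge> 0" "\<And>p x. (\<And>i. cmod (x i) \<le> max R 0) \<Longrightarrow> cmod (ev p x) \<le> M p" by blast
  \<comment> \<open>Summing over all l and e dominates every row sum of every one of these
    matrices.\<close>
  define C where "C = (\<Sum>l\<in>(UNIV :: 'v set). \<Sum>e\<in>E. \<Sum>e'\<in>E. M (c (PV l * e) e'))"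
  have C0: "C \<ge> 0" unfolding C_def by (intro sum_nonneg M(1))
  show ?thesis
  proof (intro exI[of _ C] conjI C0 ballI impI allI)
    fix x l assume x: "x \<in> X" and R: "\<forall>i\<in>I. cmod (ev (y i) x) \<le> R"
    have eta: "cmod (ev (y i) x) \<le> max R 0" for i
      using R y_outside[of i] by (cases "i \<in> I") (auto intro: max.coboundedI1)
    have "E \<noteq> {}" using c[OF x, of 1] by auto
    define m where "m = Max ((\<lambda>e. cmod (ev e x)) ` E)"
    have m: "cmod (ev e x) \<le> m" if "e \<in> E" for e
      unfolding m_def using that finite_E by (intro Max_ge) auto
    have "m \<in> (\<lambda>e. cmod (ev e x)) ` E" unfolding m_def using finite_E \<open>E \<noteq> {}\<close> by (intro Max_in) auto
    then obtain e0 where e0: "e0 \<in> E" "m = cmod (ev e0 x)" by blast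
    \<comment> \<open>The constant 1 is a combination of the generators, so they cannot all vanish
      at \<open>x\<close>.\<close>
    have "m \<noteq> 0"
    proof
      assume "m = 0"
      then have "ev e x = 0" if "e \<in> E" for e using m[OF that] by simp
      then have "ev 1 x = 0" by (simp only: c[OF x, of 1]) simp
      then show False by simp
    qed
    then have mp: "m > 0" using e0 by simp
    have "cmod (x l) * m = cmod (ev (PV l * e0) x)" by (simp add: norm_mult e0(2))
    also have "\<dots> \<le> (\<Sum>e'\<in>E. M (c (PV l * e0) e') * m)"
      unfolding c[OF x, of "PV l * e0"]
      by (rule sum_norm_le) (auto simp: norm_mult intro!: mult_mono M eta m)
    also have "\<dots> \<le> C * m"
    proof -
      have "(\<Sum>e'\<in>E. M (c (PV l * e0) e')) \<le> (\<Sum>e\<in>E. \<Sum>e'\<in>E. M (c (PV l * e) e'))"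
        by (rule member_le_sum[where f = "\<lambda>e. \<Sum>e'\<in>E. M (c (PV l * e) e')"]) (use e0 finite_E M in \<open>auto intro: sum_nonneg\<close>)
      also have "\<dots> \<le> C" unfolding C_def
        by (rule member_le_sum[where f = "\<lambda>l. \<Sum>e\<in>E. \<Sum>e'\<in>E. M (c (PV l * e) e')"]) (use M in \<open>auto intro!: sum_nonneg\<close>)
      finally show ?thesis using mp by (simp add: sum_distrib_right[symmetric] mult_right_mono)
    qed
    finally show "cmod (x l) \<le> C" using mp by simp
  qed
qed

text \<open>The sum of T * G_T and all w_l * G_(w_l) is itself a relation: it is the combination of
  the differentiated identities with weights w_l. At the given root it yields the claim after
  division by G_T.\<close>

lemma transfer_lform:
  fixes h :: "complex \<Rightarrow> 'r::field"
  assumes G: "minrel lform G" and h: "rhom h"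
    and lead: "peval h (lead_coeff G) Y \<noteq> 0" and root: "rpoly_peval h Y G T = 0"
    and r: "rpoly_peval h Y (fderiv G) T \<noteq> 0"
    and \<xi>: "\<And>l. \<xi> l = - rpoly_peval h Y (coord_deriv G l) T / rpoly_peval h Y (fderiv G) T"
  shows "(\<Sum>l\<in>UNIV. Y (Inr l) * \<xi> l) = T"
proof -
  have relG: "rel lform G" using G by (simp add: minrel_def)
  define H where "H = [:0, 1:] * fderiv G + (\<Sum>l\<in>UNIV. [:PV (Inr l):] * coord_deriv G l)"
  have "rel lform H"
    unfolding rel_def
  proof (intro allI impI)
    fix x Y assume z: "(x, Y) \<in> Z"
    let ?a = "ev lform (case_sum x Y)" and ?ev = "\<lambda>p. ev p Y"
    have "rpoly ?ev H ?a = ?a * rpoly ?ev (fderiv G) ?a + (\<Sum>l\<in>UNIV. Y (Inr l) * rpoly ?ev (coord_deriv G l) ?a)"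
      by (simp add: H_def rpoly_hom rpoly_pCons)
    also have "\<dots> = (\<Sum>l\<in>UNIV. Y (Inr l) * (rpoly ?ev (coord_deriv G l) ?a + x l * rpoly ?ev (fderiv G) ?a))"
      by (simp add: eval_lform[of x Y] sum_distrib_left sum_distrib_right sum.distrib algebra_simps)
    also have "\<dots> = 0" using coord_deriv_identity[OF relG z] by simp
    finally show "rpoly ?ev H ?a = 0" .
  qed
  from minrel_divides[OF G this h lead root]
  have "T * rpoly_peval h Y (fderiv G) T + (\<Sum>l\<in>UNIV. Y (Inr l) * rpoly_peval h Y (coord_deriv G l) T) = 0"
    using h by (simp add: H_def rpoly_hom rpoly_pCons rhomD[OF rhom_peval])
  then have "(\<Sum>l\<in>UNIV. Y (Inr l) * rpoly_peval h Y (coord_deriv G l) T) = - (T * rpoly_peval h Y (fderiv G) T)"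
    by (simp add: eq_neg_iff_add_eq_0 add.commute)
  moreover have "(\<Sum>l\<in>UNIV. Y (Inr l) * \<xi> l) = - (\<Sum>l\<in>UNIV. Y (Inr l) * rpoly_peval h Y (coord_deriv G l) T) / rpoly_peval h Y (fderiv G) T"
    unfolding \<xi> by (simp add: sum_divide_distrib sum_negf)
  ultimately show ?thesis using r by simp
qed

text \<open>Where the leading coefficient \<open>q\<close> and \<open>\<rho>\<close> do not vanish,
  every root of \<open>G\<close> is the value of the linear form at a point of \<open>X\<close> over
  \<open>Y\<close>, hence bounded for bounded \<open>Y\<close>. So the coefficients of G / q are
  locally bounded, and \<open>q\<close> divides them.\<close>

lemma ex_monic_minrel: "\<exists>G. minrel lform G \<and> lead_coeff G = 1"
proof -
  obtain G where G: "minrel lform G" using ex_minrel by blast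
  have G0: "rel lform G" "G \<noteq> 0" using G by (auto simp: minrel_def)
  define q where "q = lead_coeff G"
  have q0: "q \<noteq> 0" using G0(2) by (simp add: q_def)
  obtain \<rho> where \<rho>: "\<rho> \<noteq> 0" "\<And>Y T. ev q Y \<noteq> 0 \<Longrightarrow> rpoly_ev Y G T = 0 \<Longrightarrow>
      ev \<rho> Y \<noteq> 0 \<Longrightarrow> rpoly_ev Y (fderiv G) T \<noteq> 0"
    using minrel_separable[OF G, where 'r = complex] by (auto simp: q_def cpoly_eval_peval)
  have root_bound: "\<exists>C\<ge>0. \<forall>Y T. (\<forall>i. cmod (Y i) \<le> R) \<longrightarrow> ev (q * \<rho>) Y \<noteq> 0 \<longrightarrow> rpoly_ev Y G T = 0 \<longrightarrow> cmod T \<le> C" for R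
  proof -
    obtain C where C: "C \<ge> 0" "\<And>x l. x \<in> X \<Longrightarrow> (\<And>i. i \<in> I \<Longrightarrow> cmod (ev (y i) x) \<le> R) \<Longrightarrow> cmod (x l) \<le> C"
      using X_bounded[of R] by blast
    show ?thesis
    proof (intro exI[of _ "of_nat CARD('v) * (\<bar>R\<bar> * C)"] conjI allI impI)
      show "0 \<le> of_nat CARD('v) * (\<bar>R\<bar> * C)" using C by simp
      fix Y T assume *: "\<forall>i. cmod (Y i) \<le> R" "ev (q * \<rho>) Y \<noteq> 0" "rpoly_ev Y G T = 0"
      have r: "rpoly_ev Y (fderiv G) T \<noteq> 0" using \<rho>(2)[of Y T] * by auto
      define \<xi> where "\<xi> l = - rpoly_ev Y (coord_deriv G l) T / rpoly_ev Y (fderiv G) T" for l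
      note tr = G rhom_id _ _ _ \<xi>_def[unfolded cpoly_eval_peval]
      have ident: "ev \<Phi> (case_sum \<xi> Y) = 0" if "vanZ \<Phi>" for \<Phi>
        unfolding cpoly_eval_peval
        by (rule transfer_identity[OF tr that]) (use * r in \<open>auto simp: q_def cpoly_eval_peval\<close>)
      have T: "(\<Sum>l\<in>UNIV. Y (Inr l) * \<xi> l) = T"
        by (rule transfer_lform[OF tr]) (use * r in \<open>auto simp: q_def cpoly_eval_peval\<close>)
      have \<xi>X: "\<xi> \<in> X"
      proof (rule closed)
        fix p assume "\<forall>z\<in>X. ev p z = 0"
        then have "vanZ (liftX p)" by (simp add: vanZ_liftX)
        from ident[OF this] show "ev p \<xi> = 0" by simp
      qed
      have y\<xi>: "ev (y i) \<xi> = Y (Inl i)" if "i \<in> I" for i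
      proof -
        have "vanZ (liftX (y i) - PV (Inr (Inl i)))" using that by (auto simp: vanZ_def Z_def)
        from ident[OF this] show ?thesis by simp
      qed
      have "cmod (\<xi> l) \<le> C" for l using C(2)[OF \<xi>X] y\<xi> * by simp
      then have "cmod (Y (Inr l) * \<xi> l) \<le> \<bar>R\<bar> * C" for l
        unfolding norm_mult using * by (intro mult_mono) (auto intro: order_trans[OF _ abs_ge_self])
      then have "cmod (\<Sum>l\<in>UNIV. Y (Inr l) * \<xi> l) \<le> (\<Sum>l\<in>(UNIV :: 'v set). \<bar>R\<bar> * C)"
        by (intro sum_norm_le) auto
      then show "cmod T \<le> of_nat CARD('v) * (\<bar>R\<bar> * C)" by (simp add: T)
    qed
  qed
  have "q dvd coeff G k" for k
  proof (rule cpoly_dvd_of_local_bound[OF q0])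
    show "q * \<rho> \<noteq> 0" using q0 \<rho>(1) by (simp add: cpoly_mult_eq_0)
    fix R
    obtain C where C: "C \<ge> 0" "\<And>Y T. (\<And>i. cmod (Y i) \<le> R) \<Longrightarrow> ev (q * \<rho>) Y \<noteq> 0 \<Longrightarrow> rpoly_ev Y G T = 0 \<Longrightarrow> cmod T \<le> C"
      using root_bound[of R] by blast
    show "\<exists>C. \<forall>Y. (\<forall>i. cmod (Y i) \<le> R) \<longrightarrow> ev (q * \<rho>) Y \<noteq> 0 \<longrightarrow> cmod (ev (coeff G k) Y) \<le> C * cmod (ev q Y)"
    proof (intro exI[of _ "(1 + C) ^ degree G"] allI impI)
      fix Y assume *: "\<forall>i. cmod (Y i) \<le> R" "ev (q * \<rho>) Y \<noteq> 0"
      define g where "g = smult (1 / ev q Y) (map_poly (\<lambda>p. ev p Y) G)"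
      have qY: "ev q Y \<noteq> 0" using * by auto
      have cg: "coeff g k = ev (coeff G k) Y / ev q Y" for k
        by (simp add: g_def coeff_map_poly)
      have "degree g \<le> degree G" by (simp add: g_def map_poly_degree_leq)
      moreover have "coeff g (degree G) = 1" using qY by (simp add: cg q_def)
      ultimately have dg: "degree g = degree G" "lead_coeff g = 1"
        by (metis coeff_eq_0 le_antisym le_degree zero_neq_one) (metis \<open>coeff g (degree G) = 1\<close> \<open>degree g \<le> degree G\<close> le_antisym le_degree zero_neq_one)
      have "cmod (coeff g k) \<le> (1 + C) ^ degree g"
      proof (rule monic_coeff_bound[OF dg(2) _ C(1)])
        fix z assume "poly g z = 0"
        then have "rpoly_ev Y G z = 0" using qY by (simp add: g_def rpoly_def)
        then show "cmod z \<le> C" using C(2) * by blast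
      qed
      then show "cmod (ev (coeff G k) Y) \<le> (1 + C) ^ degree G * cmod (ev q Y)"
        using qY by (simp add: cg dg norm_divide field_simps)
    qed
  qed
  then have "\<forall>k. \<exists>c. coeff G k = q * c" by (auto simp: dvd_def)
  then have "\<exists>c. \<forall>k. coeff G k = q * c k" by (rule choice)
  then obtain c where c: "\<And>k. coeff G k = q * c k" by blast
  define F where "F = monom 1 (degree G) + (\<Sum>k<degree G. monom (c k) k)"
  have cF: "coeff F k = (if k = degree G then 1 else if k < degree G then c k else 0)" for k
  proof -
    have "(\<Sum>j<degree G. coeff (monom (c j) j) k) = (\<Sum>j<degree G. if j = k then c k else 0)"
      by (intro sum.cong) auto
    then show ?thesis by (auto simp: F_def coeff_sum)
  qed
  have dF: "degree F = degree G"
  proof (rule antisym)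
    show "degree F \<le> degree G" by (rule degree_le) (simp add: cF)
    show "degree G \<le> degree F" by (rule le_degree) (simp add: cF)
  qed
  have qF: "smult q F = G"
  proof (rule poly_eqI)
    fix k
    show "coeff (smult q F) k = coeff G k"
      using c[of k] by (cases k "degree G" rule: linorder_cases) (auto simp: cF q_def coeff_eq_0)
  qed
  \<comment> \<open>Cancelling \<open>q\<close> uses that \<open>Z\<close> is irreducible and that a
    nonzero polynomial on the base does not vanish identically on \<open>Z\<close>.\<close>
  have "rel lform F"
  proof -
    have "vanZ (liftY q * rpoly liftY F lform)"
      using G0(1) by (simp add: rel_iff_vanZ flip: qF)
    then show ?thesis using vanZ_prime vanZ_liftY q0 by (auto simp: rel_iff_vanZ)
  qed
  moreover have "F \<noteq> 0" using qF G0(2) by auto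
  ultimately have "minrel lform F" using G by (auto simp: minrel_def dF)
  then show ?thesis using cF[of "degree F"] dF by auto
qed

end

section \<open>Puiseux roots\<close>

unbundle no vec_syntax

lemma fps_X_power_dvd_iff: "fps_X ^ n dvd (f :: 'a::comm_ring_1 fps) \<longleftrightarrow> (\<forall>k<n. f $ k = 0)"
proof
  assume "\<forall>k<n. f $ k = 0"
  then have "f = fps_X ^ n * fps_shift n f"
    by (intro fps_ext) (auto simp: fps_X_power_mult_nth)
  then show "fps_X ^ n dvd f" by (metis dvd_triv_left)
qed (auto simp: dvd_def fps_X_power_mult_nth)

lemma poly_diff_dvd: "(a - b :: 'a::comm_ring_1) dvd poly G a - poly G b"
proof (induction G)
  case (pCons c G)
  have "poly (pCons c G) a - poly (pCons c G) b = a * (poly G a - poly G b) + (a - b) * poly G b"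
    by (simp add: algebra_simps)
  then show ?case using pCons by (metis dvd_add dvd_mult dvd_triv_left)
qed simp

lemma poly_fps_nth_0:
  fixes G :: "complex fps poly"
  assumes "a $ 0 = b $ 0"
  shows "poly G a $ 0 = poly G b $ 0"
proof -
  have "fps_X ^ 1 dvd a - b" using assms by (subst fps_X_power_dvd_iff) simp
  then have "fps_X ^ 1 dvd poly G a - poly G b" using poly_diff_dvd dvd_trans by blast
  then show ?thesis by (subst (asm) fps_X_power_dvd_iff) simp
qed

lemma poly_taylor2:
  fixes G :: "complex fps poly"
  shows "\<exists>R. poly G (T + H) = poly G T + H * poly (pderiv G) T + H ^ 2 * R"
proof (induction G)
  case (pCons c G)
  then obtain R where R: "poly G (T + H) = poly G T + H * poly (pderiv G) T + H ^ 2 * R" by blast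
  have "poly (pCons c G) (T + H) = c + (T + H) * (poly G T + H * poly (pderiv G) T + H ^ 2 * R)"
    by (simp add: R)
  also have "\<dots> = poly (pCons c G) T + H * poly (pderiv (pCons c G)) T + H ^ 2 * (poly (pderiv G) T + (T + H) * R)"
    by (simp add: pderiv_pCons algebra_simps power2_eq_square)
  finally show ?case by blast
qed simp

text \<open>Newton iteration with the derivative frozen at its constant term \<open>g\<close>.
  Correcting the coefficient at n + 1 changes the value there by \<open>g\<close> times the
  correction, while the quadratic remainder enters only from order 2 * n + 2 on.\<close>

lemma fps_simple_root:
  fixes G :: "complex fps poly"
  assumes g0: "coeff G 0 $ 0 = 0" and g1: "coeff G 1 $ 0 \<noteq> 0"
  shows "\<exists>T. T $ 0 = 0 \<and> poly G T = 0"
proof -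
  define g where "g = coeff G 1 $ 0"
  define S where "S = rec_nat (0 :: complex fps) (\<lambda>n T. T - fps_const (poly G T $ Suc n / g) * fps_X ^ Suc n)"
  have S0: "S 0 = 0" and SS: "S (Suc n) = S n - fps_const (poly G (S n) $ Suc n / g) * fps_X ^ Suc n" for n
    by (simp_all add: S_def)
  have Sn0: "S n $ 0 = 0" for n by (induction n) (auto simp: S0 SS fps_X_power_nth)
  have der: "poly (pderiv G) (S n) $ 0 = g" for n
    using poly_fps_nth_0[of "S n" 0 "pderiv G"] Sn0 by (simp add: poly_0_coeff_0 coeff_pderiv g_def)
  have root: "\<forall>k\<le>n. poly G (S n) $ k = 0" for n
  proof (induction n)
    case 0
    then show ?case using g0 by (simp add: S0 poly_0_coeff_0)
  next
    case (Suc n)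
    define H where "H = - fps_const (poly G (S n) $ Suc n / g) * fps_X ^ Suc n"
    have SH: "S (Suc n) = S n + H" by (simp add: SS H_def)
    obtain R where R: "poly G (S n + H) = poly G (S n) + H * poly (pderiv G) (S n) + H ^ 2 * R"
      using poly_taylor2 by blast
    show ?case
    proof (intro allI impI)
      fix k assume k: "k \<le> Suc n"
      have H2: "H ^ 2 * R = fps_X ^ (Suc n + Suc n) * ((fps_const (poly G (S n) $ Suc n / g)) ^ 2 * R)"
        by (simp add: H_def power2_eq_square power_add mult_ac)
      have "(H ^ 2 * R) $ k = 0" unfolding H2 using k by (simp add: fps_X_power_mult_nth del: power_Suc)
      moreover have "(H * poly (pderiv G) (S n)) $ k = (if k = Suc n then - poly G (S n) $ Suc n else 0)"
      proof -
        have "H * poly (pderiv G) (S n) = fps_X ^ Suc n * (fps_const (- (poly G (S n) $ Suc n / g)) * poly (pderiv G) (S n))"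
          by (simp add: H_def mult_ac fps_const_neg[symmetric] del: fps_const_neg power_Suc)
        then have "(H * poly (pderiv G) (S n)) $ k =
            (if k < Suc n then 0 else (fps_const (- (poly G (S n) $ Suc n / g)) * poly (pderiv G) (S n)) $ (k - Suc n))"
          by (simp only: fps_X_power_mult_nth)
        then show ?thesis using k g1 by (cases "k = Suc n") (auto simp: der g_def)
      qed
      ultimately show "poly G (S (Suc n)) $ k = 0" using Suc k unfolding SH R by (auto simp: le_Suc_eq)
    qed
  qed
  have stable: "S (n + j) $ k = S n $ k" if "k \<le> n" for n j k
    using that by (induction j) (auto simp: SS fps_X_power_nth simp del: power_Suc)
  \<comment> \<open>Coefficient n does not change after step n, so the diagonal is the
    limit.\<close>
  define T where "T = Abs_fps (\<lambda>n. S n $ n)"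
  have T: "T $ k = S n $ k" if "k \<le> n" for k n
    using stable[of k k "n - k"] that by (simp add: T_def)
  have "poly G T = 0"
  proof (rule fps_ext)
    fix n
    have "fps_X ^ Suc n dvd T - S n" by (subst fps_X_power_dvd_iff) (simp add: T)
    then have "fps_X ^ Suc n dvd poly G T - poly G (S n)" using poly_diff_dvd dvd_trans by blast
    then show "poly G T $ n = 0 $ n" using root[of n] by (subst (asm) fps_X_power_dvd_iff) auto
  qed
  then show ?thesis using T[of 0 0] Sn0 by auto
qed

text \<open>Fractional exponents are avoided by t = s^m: a root of \<open>G\<close> under
  \<open>ramify m\<close> is a Puiseux root in t^(1/m).\<close>

definition ramify :: "nat \<Rightarrow> complex fps \<Rightarrow> complex fps" where
  "ramify m a = fps_compose a (fps_X ^ m)"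

lemma ramify_nth:
  assumes "m \<ge> 1"
  shows "ramify m a $ n = (if m dvd n then a $ (n div m) else 0)"
proof -
  have "ramify m a $ n = (\<Sum>i=0..n. if n = m * i then a $ i else 0)"
    by (auto simp: ramify_def fps_compose_nth fps_X_power_nth simp flip: power_mult intro!: sum.cong)
  also have "\<dots> = (if m dvd n then a $ (n div m) else 0)"
  proof (cases "m dvd n")
    case True
    then obtain k where k: "n = m * k" by blast
    then have "(\<Sum>i=0..n. if n = m * i then a $ i else 0) = (\<Sum>i=0..n. if i = k then a $ i else 0)"
      using assms by (intro sum.cong) auto
    moreover have "k \<le> n" using k assms by simp
    ultimately show ?thesis using k assms by auto
  qed (auto intro!: sum.neutral)
  finally show ?thesis .
qed

lemma rhom_ramify [simp]: "m \<ge> 1 \<Longrightarrow> rhom (ramify m)"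
  by (auto simp: rhom_def ramify_def fps_compose_add_distrib fps_compose_mult_distrib fps_X_power_nth)

lemma ramify_ramify: "m \<ge> 1 \<Longrightarrow> n \<ge> 1 \<Longrightarrow> ramify m (ramify n a) = ramify (m * n) a"
  by (rule fps_ext) (auto simp: ramify_nth div_mult2_eq mult.commute[of m n] dest: dvd_mult_left elim!: dvdE)

lemma ramify_X_power: "m \<ge> 1 \<Longrightarrow> ramify m (fps_X ^ n) = fps_X ^ (m * n)"
  by (rule fps_ext) (auto simp: ramify_nth fps_X_power_nth)

lemma coeff_pcompose_shift:
  fixes G :: "complex fps poly"
  shows "fact j * coeff (pcompose G [:\<phi>, 1:]) j = poly ((pderiv ^^ j) G) \<phi>"
proof -
  have d: "(pderiv ^^ j) (pcompose G [:\<phi>, 1:]) = pcompose ((pderiv ^^ j) G) [:\<phi>, 1:]" for j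
    by (induction j) (auto simp: pderiv_pcompose pderiv_pCons)
  have "fact j * coeff (pcompose G [:\<phi>, 1:]) j = coeff ((pderiv ^^ j) (pcompose G [:\<phi>, 1:])) 0"
    by (simp add: coeff_higher_pderiv pochhammer_fact)
  also have "\<dots> = poly ((pderiv ^^ j) G) \<phi>" by (simp add: d flip: poly_0_coeff_0) (simp add: poly_pcompose)
  finally show ?thesis .
qed

text \<open>Up to factorials these are values of the T-derivatives of \<open>G\<close> at the shift,
  and their constant terms depend only on that of the shift.\<close>

lemma coeff_pcompose_shift_nth_0:
  fixes G :: "complex fps poly"
  assumes "\<phi> $ 0 = \<psi> $ 0"
  shows "coeff (pcompose G [:\<phi>, 1:]) j $ 0 = coeff (pcompose G [:\<psi>, 1:]) j $ 0"
proof -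
  have "(fact j * coeff (pcompose G [:\<phi>, 1:]) j) $ 0 = (fact j * coeff (pcompose G [:\<psi>, 1:]) j) $ 0"
    unfolding coeff_pcompose_shift by (rule poly_fps_nth_0[OF assms])
  moreover have "(fact j :: complex fps) $ 0 \<noteq> 0"
    by (metis fps_nth_of_nat fact_nonzero of_nat_fact)
  ultimately show ?thesis by simp
qed

lemma rhom_fps_nth_0 [simp]: "rhom (\<lambda>a :: complex fps. a $ 0)"
  by (simp add: rhom_def)

lemma coeff_pcompose_const_nth_0:
  fixes B :: "complex fps poly"
  shows "coeff (pcompose B [:fps_const c, 1:]) j $ 0 = coeff (pcompose (map_poly (\<lambda>a. a $ 0) B) [:c, 1:]) j"
proof -
  have "map_poly (\<lambda>a. a $ 0) (pcompose B [:fps_const c, 1:]) = pcompose (map_poly (\<lambda>a. a $ 0) B) [:c, 1:]"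
  proof (subst poly_eq_poly_eq_iff[symmetric], rule ext)
    fix t
    have "poly (map_poly (\<lambda>a. a $ 0) (pcompose B [:fps_const c, 1:])) t = rpoly (\<lambda>a. a $ 0) (pcompose B [:fps_const c, 1:]) t"
      by (simp add: rpoly_def)
    also have "\<dots> = rpoly (\<lambda>a. a $ 0) B (c + t)"
      by (simp add: rpoly_pcompose rpoly_pCons)
    finally show "poly (map_poly (\<lambda>a. a $ 0) (pcompose B [:fps_const c, 1:])) t = poly (pcompose (map_poly (\<lambda>a. a $ 0) B) [:c, 1:]) t"
      by (simp add: rpoly_def poly_pcompose)
  qed
  then show ?thesis by (metis coeff_map_poly fps_zero_nth)
qed

text \<open>If the root had full order, P would be r * (T - c)^e. The missing coefficient of T^(e -
  1) then gives c = 0, and no lower coefficient could survive.\<close>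

lemma poly_root_not_full_order:
  fixes P :: "complex poly"
  assumes d: "degree P = e" "e \<ge> 1" and c: "coeff P (e - 1) = 0" and i: "i < e" "coeff P i \<noteq> 0"
  shows "\<exists>c. 1 \<le> order c P \<and> order c P < e"
proof -
  have P0: "P \<noteq> 0" using i by auto
  obtain c where root: "poly P c = 0" using alg_closed_imp_poly_has_root[of P] d by auto
  have "order c P \<noteq> e"
  proof
    assume "order c P = e"
    then have "[:- c, 1:] ^ e dvd P" by (metis order_1)
    then obtain R where R: "P = [:- c, 1:] ^ e * R" by blast
    then have "R \<noteq> 0" using P0 by auto
    then have "degree P = e + degree R" unfolding R by (subst degree_mult_eq) (auto simp: degree_linear_power)
    then obtain r where r: "R = [:r:]" using d by (metis add_cancel_right_right degree_eq_zeroE)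
    then have r0: "r \<noteq> 0" using \<open>R \<noteq> 0\<close> by auto
    have Pc: "P = smult r ([:- c, 1:] ^ e)" by (simp add: R r)
    have "coeff ([:- c, 1:] ^ e) (e - 1) = of_nat e * (- c)"
      using coeff_linear_poly_power[of "e - 1" e "- c" 1] d(2) binomial_symmetric[of "e - 1" e] by simp
    then have "c = 0" using c r0 d(2) by (auto simp: Pc)
    then have "P = monom r e" by (simp add: Pc monom_altdef)
    then show False using i by simp
  qed
  moreover have "order c P \<le> e" using order_degree[OF P0] d by simp
  moreover have "order c P \<ge> 1" using root P0 by (metis less_one not_le order_root)
  ultimately show ?thesis by (intro exI[of _ c]) auto
qed

lemma coeff_shift_order:
  fixes P :: "complex poly"
  assumes "P \<noteq> 0"
  shows "(\<forall>j<order c P. coeff (pcompose P [:c, 1:]) j = 0) \<and> coeff (pcompose P [:c, 1:]) (order c P) \<noteq> 0"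
proof -
  obtain Q where Q: "P = [:- c, 1:] ^ order c P * Q" "\<not> [:- c, 1:] dvd Q" using order_decomp[OF assms] by blast
  have X: "pcompose [:- c, 1:] [:c, 1:] = monom 1 1" by (simp add: pcompose_pCons monom_altdef)
  have "pcompose P [:c, 1:] = monom 1 (order c P) * pcompose Q [:c, 1:]"
  proof -
    have "pcompose ([:- c, 1:] ^ n) [:c, 1:] = monom 1 n" for n
      by (induction n) (auto simp: pcompose_mult pcompose_1 X mult_monom simp del: mult_pCons_left)
    then show ?thesis by (subst Q(1)) (simp only: pcompose_mult)
  qed
  moreover have "poly (pcompose Q [:c, 1:]) 0 \<noteq> 0" using Q(2) by (simp add: poly_pcompose poly_eq_0_iff_dvd)
  ultimately show ?thesis by (simp add: coeff_monom_mult poly_0_coeff_0)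
qed

text \<open>\<open>e\<close> is the order in \<open>T\<close> of \<open>G(0, T)\<close>. After a translation the coefficient of \<open>T\<close> to the power
  \<open>e - 1\<close> vanishes, so that the polynomial of the Newton edge has a root of order less than \<open>e\<close>.\<close>

theorem puiseux_root:
  fixes G :: "complex fps poly"
  assumes "e \<ge> 1" "\<And>i. i < e \<Longrightarrow> coeff G i $ 0 = 0" "coeff G e $ 0 \<noteq> 0"
  shows "\<exists>m T. 1 \<le> m \<and> m \<le> fact e \<and> T $ 0 = 0 \<and> rpoly (ramify m) G T = 0"
  using assms
proof (induction e arbitrary: G rule: less_induct)
  case (less e)
  \<comment> \<open>For t = 0 the derivative of order e - 1 in T has a simple root at 0, because the
    coefficient of T^e is a unit. Translation by the lifted root removes the term of degree e -
    1.\<close>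
  have "\<exists>\<phi>. \<phi> $ 0 = 0 \<and> poly ((pderiv ^^ (e - 1)) G) \<phi> = 0"
  proof (rule fps_simple_root)
    show "coeff ((pderiv ^^ (e - 1)) G) 0 $ 0 = 0"
      using less.prems by (simp add: coeff_higher_pderiv)
    have poch: "pochhammer (of_nat 2 :: complex fps) (e - 1) = of_nat (pochhammer 2 (e - 1))" by (simp only: pochhammer_of_nat)
    moreover have "pochhammer (2::nat) (e - 1) \<noteq> 0" using pochhammer_pos[of "2::nat" "e - 1"] by linarith
    ultimately show "coeff ((pderiv ^^ (e - 1)) G) 1 $ 0 \<noteq> 0"
      using less.prems by (simp add: coeff_higher_pderiv fps_of_nat[symmetric] del: fps_of_nat)
  qed
  then obtain \<phi> where \<phi>: "\<phi> $ 0 = 0" "poly ((pderiv ^^ (e - 1)) G) \<phi> = 0" by blast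
  define F where "F = pcompose G [:\<phi>, 1:]"
  have F0: "coeff F j $ 0 = coeff G j $ 0" for j
  proof -
    have "pcompose G [:0, 1:] = G" using pcompose_idR[of G] by simp
    then show ?thesis unfolding F_def using coeff_pcompose_shift_nth_0[of \<phi> 0 G j] \<phi>(1) by simp
  qed
  have Fe1: "coeff F (e - 1) = 0"
    using coeff_pcompose_shift[of "e - 1" G \<phi>] \<phi>(2) by (simp add: F_def)
  have translate: "rpoly (ramify m) G (ramify m \<phi> + T) = rpoly (ramify m) F T" if "m \<ge> 1" for m T
    using that by (simp add: F_def rpoly_pcompose rpoly_pCons rhomD)
  have ram\<phi>: "ramify m \<phi> $ 0 = 0" if "m \<ge> 1" for m using that \<phi> by (simp add: ramify_nth)
  show ?case
  proof (cases "\<forall>i<e. coeff F i = 0")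
    \<comment> \<open>Here T^e divides \<open>F\<close>, so the translation itself is a root,
      without ramification.\<close>
    case True
    then have "coeff F 0 = 0" using less.prems(1) by auto
    then have "rpoly (ramify 1) F 0 = 0" by (cases F) (simp add: rpoly_pCons rhomD)
    then have "rpoly (ramify 1) G (ramify 1 \<phi> + 0) = 0" using translate[of 1 0] by simp
    then show ?thesis using ram\<phi>[of 1] by (intro exI[of _ 1] exI[of _ "ramify 1 \<phi>"]) auto
  next
    case False
    define N where "N = {i. i < e \<and> coeff F i \<noteq> 0}"
    have N: "finite N" "N \<noteq> {}" using False by (auto simp: N_def)
    \<comment> \<open>Slopes of the Newton polygon towards the vertex (e, 0). The least one, n/d,
      belongs to the edge along which \<open>F\<close> is rescaled.\<close>
    define slope :: "nat \<Rightarrow> real" where "slope i = real (subdegree (coeff F i)) / real (e - i)" for i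
    obtain i0 where i0: "i0 \<in> N" "\<And>i. i \<in> N \<Longrightarrow> slope i0 \<le> slope i"
      using arg_min_if_finite[OF N, of slope] by (metis not_le)
    define n where "n = subdegree (coeff F i0)"
    define d where "d = e - i0"
    have i0e: "i0 < e" "coeff F i0 \<noteq> 0" using i0(1) by (auto simp: N_def)
    have d1: "d \<ge> 1" "d \<le> e" using i0e by (auto simp: d_def)
    have n1: "n \<ge> 1"
      using i0e less.prems(2)[of i0] F0[of i0] unfolding n_def by (metis One_nat_def Suc_leI neq0_conv nth_subdegree_zero_iff)
    have slopes: "n * (e - i) \<le> d * subdegree (coeff F i)" if "i \<in> N" for i
    proof -
      have "real n / real d \<le> real (subdegree (coeff F i)) / real (e - i)"
        using i0(2)[OF that] by (simp add: slope_def n_def d_def)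
      moreover have "e - i > 0" "d > 0" using that d1 by (auto simp: N_def)
      ultimately have "real n * real (e - i) \<le> real (subdegree (coeff F i)) * real d" by (simp add: field_simps)
      then show ?thesis by (metis mult.commute of_nat_le_iff of_nat_mult)
    qed
    \<comment> \<open>Coefficients of F(s^d, s^n * T) / s^(n * e); minimality of the slope makes the
      division exact.\<close>
    define b where "b i = fps_shift (n * e) (ramify d (coeff F i) * fps_X ^ (n * i))" for i
    have b: "ramify d (coeff F i) * fps_X ^ (n * i) = fps_X ^ (n * e) * b i" for i
    proof -
      have "(ramify d (coeff F i) * fps_X ^ (n * i)) $ k = 0" if k: "k < n * e" for k
      proof (cases "i < e")
        case True
        have "ramify d (coeff F i) $ (k - n * i) = 0" if "\<not> k < n * i"
        proof (cases "coeff F i = 0")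
          case False
          then have "n * (e - i) \<le> d * subdegree (coeff F i)" using True by (intro slopes) (simp add: N_def)
          moreover have "k - n * i < n * (e - i)" using k that True by (simp add: diff_mult_distrib2)
          ultimately have "k - n * i < subdegree (coeff F i) * d" by (simp add: mult.commute)
          then have "(k - n * i) div d < subdegree (coeff F i)" using d1 by (simp add: less_mult_imp_div_less)
          then have "coeff F i $ ((k - n * i) div d) = 0" by (rule nth_less_subdegree_zero)
          then show ?thesis unfolding ramify_nth[OF d1(1)] by presburger
        qed (use d1 in \<open>simp add: ramify_nth\<close>)
        then show ?thesis by (simp add: fps_X_power_mult_right_nth)
      next
        case False
        then have "n * e \<le> n * i" by simp
        then have "k < n * i" using k by (rule less_le_trans[rotated])
        then show ?thesis by (simp add: fps_X_power_mult_right_nth)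
      qed
      then show ?thesis unfolding b_def
        by (intro fps_ext) (auto simp: fps_X_power_mult_nth)
    qed
    define B where "B = (\<Sum>i\<le>degree F. monom (b i) i)"
    have cB: "coeff B i = b i" for i
    proof (cases "i \<le> degree F")
      case False
      then have "b i = 0" using d1 by (simp add: b_def coeff_eq_0 rhomD)
      then show ?thesis using False by (auto simp: B_def coeff_sum intro!: sum.neutral)
    qed (simp add: B_def coeff_sum)
    have dB: "degree B \<le> degree F"
      unfolding B_def by (rule degree_sum_le) (auto intro: order_trans[OF degree_monom_le])
    define P where "P = map_poly (\<lambda>a. a $ 0) B"
    have cP: "coeff P i = b i $ 0" for i by (simp add: P_def coeff_map_poly cB)
    \<comment> \<open>Terms of degree above e acquire a positive power of s since n is positive, so
      the edge polynomial \<open>P\<close> has degree at most e.\<close>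
    have b0: "b i $ 0 = (if i \<le> e then ramify d (coeff F i) $ (n * (e - i)) else 0)" for i
    proof (cases "i \<le> e")
      case True
      then show ?thesis by (simp add: b_def fps_X_power_mult_right_nth diff_mult_distrib2)
    next
      case False
      then have "n * e < n * i" using n1 by simp
      then show ?thesis using False by (simp add: b_def fps_X_power_mult_right_nth)
    qed
    have "coeff P e \<noteq> 0" using less.prems(3) d1 by (simp add: cP b0 F0 ramify_nth)
    moreover have "degree P \<le> e" by (rule degree_le) (simp add: cP b0)
    ultimately have dP: "degree P = e" by (simp add: le_antisym le_degree)
    have Pe1: "coeff P (e - 1) = 0" using d1 Fe1 by (simp add: cP b0 ramify_nth)
    have Pi0: "coeff P i0 \<noteq> 0"
      using i0e d1 by (simp add: cP b0 ramify_nth n_def flip: d_def)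
    obtain c where c: "1 \<le> order c P" "order c P < e"
      using poly_root_not_full_order[OF dP less.prems(1) Pe1 i0e(1) Pi0] by blast
    define e' where "e' = order c P"
    define Q where "Q = pcompose B [:fps_const c, 1:]"
    have cQ: "coeff Q j $ 0 = coeff (pcompose P [:c, 1:]) j" for j
      unfolding Q_def P_def by (rule coeff_pcompose_const_nth_0)
    have "P \<noteq> 0" using Pi0 by auto
    then have "\<And>i. i < e' \<Longrightarrow> coeff Q i $ 0 = 0" "coeff Q e' $ 0 \<noteq> 0"
      using coeff_shift_order[of P c] by (auto simp: cQ e'_def)
    then obtain m T where m: "1 \<le> m" "m \<le> fact e'" and T: "T $ 0 = 0" "rpoly (ramify m) Q T = 0"
      using less.IH[of e' Q] c by (auto simp: e'_def)
    define S where "S = fps_const c + T"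
    have "ramify m (fps_const c) = fps_const c" by (simp add: ramify_def)
    then have BS: "rpoly (ramify m) B S = 0"
      using T(2) m by (simp add: Q_def rpoly_pcompose rpoly_pCons rhomD S_def)
    have "rpoly (ramify (m * d)) F (fps_X ^ (m * n) * S) = 0"
    proof -
      have md: "m * d \<ge> 1" using m d1 by simp
      have "rpoly (ramify (m * d)) F (fps_X ^ (m * n) * S) = (\<Sum>i\<le>degree F. ramify (m * d) (coeff F i) * (fps_X ^ (m * n) * S) ^ i)"
        by (rule rpoly_altdef) (use md in auto)
      also have "\<dots> = (\<Sum>i\<le>degree F. ramify m (fps_X ^ (n * e)) * (ramify m (b i) * S ^ i))"
      proof (rule sum.cong)
        fix i
        have "ramify (m * d) (coeff F i) * (fps_X ^ (m * n) * S) ^ i = ramify m (ramify d (coeff F i) * fps_X ^ (n * i)) * S ^ i"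
        proof -
          have "ramify m (ramify d (coeff F i) * fps_X ^ (n * i)) = ramify (m * d) (coeff F i) * fps_X ^ (m * (n * i))"
            by (simp only: rhomD(4)[OF rhom_ramify[OF m(1)]] ramify_ramify[OF m(1) d1(1)] ramify_X_power[OF m(1)])
          then show ?thesis by (simp add: power_mult_distrib mult_ac flip: power_mult)
        qed
        then show "ramify (m * d) (coeff F i) * (fps_X ^ (m * n) * S) ^ i = ramify m (fps_X ^ (n * e)) * (ramify m (b i) * S ^ i)"
          unfolding b by (simp only: rhomD(4)[OF rhom_ramify[OF m(1)]] mult_ac)
      qed simp
      also have "\<dots> = ramify m (fps_X ^ (n * e)) * rpoly (ramify m) B S"
        using rpoly_altdef[OF rhom_ramify dB, of m S] m by (simp add: cB sum_distrib_left)
      finally show ?thesis using BS by simp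
    qed
    then have "rpoly (ramify (m * d)) G (ramify (m * d) \<phi> + fps_X ^ (m * n) * S) = 0"
      using translate[of "m * d"] m d1 by simp
    moreover have "(ramify (m * d) \<phi> + fps_X ^ (m * n) * S) $ 0 = 0"
      using ram\<phi>[of "m * d"] m d1 n1 by (simp add: fps_X_power_mult_nth)
    \<comment> \<open>The ramification d of this step is at most e, and the remaining one at most (e
      - 1)!.\<close>
    moreover have "m * d \<le> fact e"
    proof -
      have "m * d \<le> fact e' * e" using m d1 by (intro mult_mono) auto
      also have "\<dots> \<le> fact (e - 1) * e" using c by (intro mult_right_mono fact_mono) (auto simp: e'_def)
      also have "\<dots> = fact e" using less.prems(1) by (metis fact_reduce mult.commute of_nat_id less_le_trans zero_less_one)
      finally show ?thesis .
    qed
    moreover have "1 \<le> m * d" using m d1 by simp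
    ultimately show ?thesis by blast
  qed
qed

section \<open>Arcs of bounded order\<close>

lemma rhom_cline [simp]: "rhom (\<lambda>p. cline p x v)"
  by (simp add: cline_def)

text \<open>A bound for all lines at once; the lowest exponent of a nonzero restriction is then
  bounded independently of the line.\<close>

lemma degree_cline_bounded: "\<exists>N. \<forall>x v. degree (cline f x v) \<le> N"
proof (induction f rule: cpoly_induct)
  case (const c)
  show ?case by (rule exI[of _ 0]) (simp add: cline_def)
next
  case (var i)
  show ?case by (rule exI[of _ 1]) (simp add: cline_def)
next
  case (add f g)
  then obtain M N where "\<And>x v. degree (cline f x v) \<le> M" "\<And>x v. degree (cline g x v) \<le> N" by blast
  then show ?case
    by (intro exI[of _ "max M N"]) (auto simp: rhomD[OF rhom_cline] intro!: degree_add_le intro: max.coboundedI1 max.coboundedI2)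
next
  case (mult f g)
  then obtain M N where "\<And>x v. degree (cline f x v) \<le> M" "\<And>x v. degree (cline g x v) \<le> N" by blast
  then show ?case
    by (intro exI[of _ "M + N"]) (auto simp: rhomD[OF rhom_cline] intro!: order_trans[OF degree_mult_le] add_mono)
qed

lemma ramify_cline:
  assumes "m \<ge> 1"
  shows "ramify m (fps_of_poly (cline p x v)) = peval fps_const p (\<lambda>i. fps_const (x i) + fps_const (v i) * fps_X ^ m)"
proof -
  have r: "rhom (\<lambda>q. ramify m (fps_of_poly q))" by (rule rhom_compose[OF rhom_ramify[OF assms] rhom_fps_of_poly])
  have c: "ramify m (fps_const a) = fps_const a" for a by (simp add: ramify_def)
  have X: "ramify m fps_X = fps_X ^ m" using ramify_X_power[OF assms, of 1] by simp
  have "ramify m (fps_of_poly (cline p x v)) = peval (\<lambda>a. ramify m (fps_of_poly [:a:])) p (\<lambda>i. ramify m (fps_of_poly [:x i, v i:]))"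
    unfolding cline_def by (rule peval_commute[OF rhom_pconst r])
  moreover have "(\<lambda>a. ramify m (fps_of_poly [:a:])) = fps_const"
    by (simp add: fps_of_poly_const c)
  moreover have "ramify m (fps_of_poly [:x i, v i:]) = fps_const (x i) + fps_const (v i) * fps_X ^ m" for i
  proof -
    have "fps_of_poly [:x i, v i:] = fps_const (x i) + fps_const (v i) * fps_X"
      by (simp add: fps_of_poly_pCons)
    then show ?thesis by (simp only: rhomD(3,4)[OF rhom_ramify[OF assms]] c X)
  qed
  ultimately show ?thesis by simp
qed

lemma ramify_eq_0_iff: "m \<ge> 1 \<Longrightarrow> ramify m a = 0 \<longleftrightarrow> a = 0"
proof
  assume m: "m \<ge> 1" and r: "ramify m a = 0"
  show "a = 0"
  proof (rule fps_ext)
    fix n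
    have "ramify m a $ (m * n) = a $ n" using m by (simp add: ramify_nth)
    then show "a $ n = 0 $ n" using r by simp
  qed
qed (simp add: ramify_def)

lemma subdegree_ramify_le:
  assumes "m \<ge> 1" "a $ k \<noteq> 0"
  shows "subdegree (ramify m a) \<le> m * k"
  using assms by (intro subdegree_leI) (auto simp: ramify_nth)

text \<open>If z had a pole, u = 1/z would be a power series without constant term, and the equation
  multiplied by u^D would have constant term 1.\<close>

lemma fls_integral:
  fixes z :: "complex fls" and c :: "nat \<Rightarrow> complex fps"
  assumes "(\<Sum>k<D. fps_to_fls (c k) * z ^ k) + z ^ D = 0"
  shows "fls_subdegree z \<ge> 0"
proof (rule ccontr)
  assume neg: "\<not> fls_subdegree z \<ge> 0"
  then have z0: "z \<noteq> 0" by auto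
  define u where "u = inverse z"
  have su: "fls_subdegree u > 0" using neg by (simp add: u_def)
  define U where "U = fls_regpart u"
  have U: "fps_to_fls U = u" using su by (simp add: U_def)
  have U0: "U $ 0 = 0" using su by (simp add: U_def)
  have zu: "z * u = 1" using z0 by (simp add: u_def)
  have "((\<Sum>k<D. fps_to_fls (c k) * z ^ k) + z ^ D) * u ^ D = (\<Sum>k<D. fps_to_fls (c k) * u ^ (D - k)) + 1"
  proof -
    have "z ^ k * u ^ D = u ^ (D - k)" if "k \<le> D" for k
    proof -
      have "z ^ k * u ^ D = (z * u) ^ k * u ^ (D - k)"
        using that by (simp add: power_mult_distrib mult.assoc flip: power_add)
      then show ?thesis by (simp add: zu)
    qed
    then show ?thesis by (simp add: distrib_right sum_distrib_right mult.assoc)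
  qed
  then have "fps_to_fls ((\<Sum>k<D. c k * U ^ (D - k)) + 1) = 0"
    using assms by (simp add: rhomD[OF rhom_fps_to_fls] U)
  then have "((\<Sum>k<D. c k * U ^ (D - k)) + 1) $ 0 = 0" by (metis fps_to_fls_eq_0_iff fps_zero_nth)
  moreover have "((\<Sum>k<D. c k * U ^ (D - k)) + 1) $ 0 = 1"
    by (simp add: fps_sum_nth fps_power_zeroth U0 power_0_left)
  ultimately show False by simp
qed

text \<open>Each point other than P excludes one hyperplane of forms; the product of the
  corresponding nonzero linear polynomials in w is nonzero at some w.\<close>

lemma separating_linear_form:
  fixes S :: "('v::finite \<Rightarrow> complex) set"
  assumes "finite S"
  shows "\<exists>w. \<forall>b\<in>S. b \<noteq> P \<longrightarrow> (\<Sum>l\<in>UNIV. w l * (b l - P l)) \<noteq> 0"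
proof -
  define q where "q b = (\<Sum>l\<in>UNIV. PV l * PC (b l - P l))" for b :: "'v \<Rightarrow> complex"
  have q0: "q b \<noteq> 0" if bP: "b \<noteq> P" for b
  proof
    assume q: "q b = 0"
    obtain l where l: "b l \<noteq> P l" using bP by auto
    have "ev (q b) (\<lambda>k. if k = l then 1 else 0) = (\<Sum>k\<in>UNIV. if k = l then b k - P k else 0)"
      unfolding q_def by (simp add: if_distrib[of "\<lambda>x. x * _"] cong: if_cong)
    then show False using l q by simp
  qed
  have "(\<Prod>b\<in>S - {P}. q b) \<noteq> 0"
  proof -
    have "finite T \<Longrightarrow> P \<notin> T \<Longrightarrow> (\<Prod>b\<in>T. q b) \<noteq> 0" for T
      by (induction T rule: finite_induct) (auto simp: cpoly_mult_eq_0 q0)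
    then show ?thesis using assms by simp
  qed
  then obtain w where "ev (\<Prod>b\<in>S - {P}. q b) w \<noteq> 0" using cpoly_nonzero_point by blast
  then have "\<forall>b\<in>S - {P}. ev (q b) w \<noteq> 0" using assms by (simp add: prod_zero_iff)
  then show ?thesis by (intro exI[of _ w]) (auto simp: q_def)
qed

context noether_normalized
begin

lemma bounded_arcs_normalized:
  assumes f: "\<exists>x\<in>X. ev f x \<noteq> 0"
  shows "\<exists>K. \<forall>P\<in>X. \<exists>b :: 'v \<Rightarrow> complex fps. (\<forall>l. b l $ 0 = P l) \<and>
     (\<forall>p. (\<forall>x\<in>X. ev p x = 0) \<longrightarrow> peval fps_const p b = 0) \<and>
     peval fps_const f b \<noteq> 0 \<and> subdegree (peval fps_const f b) \<le> K"
proof -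
  obtain G where G: "minrel lform G" and monic: "lead_coeff G = 1" using ex_monic_minrel by blast
  have relG: "rel lform G" and G0: "G \<noteq> 0" using G by (auto simp: minrel_def)
  define D where "D = degree G"
  have D: "D > 0" unfolding D_def by (rule rel_degree_pos[OF relG G0])
  obtain \<rho>1 where \<rho>1: "\<rho>1 \<noteq> 0" "\<And>Y T. peval fls_const (lead_coeff G) Y \<noteq> 0 \<Longrightarrow> rpoly_peval fls_const Y G T = 0 \<Longrightarrow>
      peval fls_const \<rho>1 Y \<noteq> 0 \<Longrightarrow> rpoly_peval fls_const Y (fderiv G) T \<noteq> 0"
    using minrel_separable[OF G, where 'r = "complex fls"] by auto
  obtain \<rho>2 \<Psi> where \<rho>2: "\<rho>2 \<noteq> 0" "vanZ (liftY \<rho>2 - liftX f * \<Psi>)" using base_multiple[OF f] by blast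
  obtain N where N: "\<And>x v. degree (cline \<rho>2 x v) \<le> N" using degree_cline_bounded by blast
  have map_monic: "degree (map_poly (\<lambda>p. ev p Y) G) = D" "map_poly (\<lambda>p. ev p Y) G \<noteq> 0" for Y
  proof -
    have "coeff (map_poly (\<lambda>p. ev p Y) G) D = 1" using monic by (simp add: coeff_map_poly D_def)
    then show "degree (map_poly (\<lambda>p. ev p Y) G) = D" "map_poly (\<lambda>p. ev p Y) G \<noteq> 0"
      by (auto simp: D_def intro!: antisym le_degree map_poly_degree_leq)
  qed
  show ?thesis
  proof (intro exI[of _ "fact D * N"] ballI)
    fix P assume P: "P \<in> X"
    define yP where "yP i = ev (y i) P" for i
    have PZ: "(P, case_sum yP w) \<in> Z" for w using P by (auto simp: Z_def yP_def)
    \<comment> \<open>Setting w to a unit vector turns the linear form into x_l, so \<open>G\<close>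
      also provides a monic equation for each coordinate over the y_i.\<close>
    define unit :: "'v \<Rightarrow> 'v \<Rightarrow> complex" where "unit l = (\<lambda>k. if k = l then 1 else 0)" for l
    have unit_sum: "(\<Sum>k\<in>UNIV. unit l k * x k) = x l" for l x
      by (simp add: unit_def if_distrib[of "\<lambda>a. a * _"] cong: if_cong)
    \<comment> \<open>A finite box containing all points of \<open>X\<close> over the image of
      \<open>P\<close>; separating \<open>P\<close> within the box separates it within its
      fibre.\<close>
    define S where "S = (\<Pi>\<^sub>E l\<in>UNIV. {t. rpoly (\<lambda>p. ev p (case_sum yP (unit l))) G t = 0})"
    have "finite S"
      unfolding S_def by (intro finite_PiE) (auto simp: rpoly_def intro!: poly_roots_finite map_monic)
    then obtain w where w: "\<And>b. b \<in> S \<Longrightarrow> b \<noteq> P \<Longrightarrow> (\<Sum>l\<in>UNIV. w l * (b l - P l)) \<noteq> 0"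
      using separating_linear_form[OF \<open>finite S\<close>, of P] by auto
    define Y0 where "Y0 = case_sum yP w"
    define T0 where "T0 = (\<Sum>l\<in>UNIV. w l * P l)"
    \<comment> \<open>The line starts at \<open>Y0\<close>, over \<open>P\<close>, and aims at a
      point where both polynomials are nonzero, so neither vanishes identically along it.\<close>
    have "\<rho>1 * \<rho>2 \<noteq> 0" using \<rho>1 \<rho>2 by (simp add: cpoly_mult_eq_0)
    then obtain Y1 where Y1: "ev (\<rho>1 * \<rho>2) Y1 \<noteq> 0" using cpoly_nonzero_point by blast
    define V where "V i = Y1 i - Y0 i" for i
    have line_nz: "cline \<rho>1 Y0 V \<noteq> 0" "cline \<rho>2 Y0 V \<noteq> 0"
      using Y1 poly_cline[of \<rho>1 Y0 V 1] poly_cline[of \<rho>2 Y0 V 1] by (auto simp: V_def)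
    define \<phi> where "\<phi> p = fps_of_poly (cline p Y0 V)" for p
    have rh\<phi>: "rhom \<phi>" unfolding \<phi>_def by (rule rhom_compose[OF rhom_fps_of_poly rhom_cline])
    have \<phi>0: "\<phi> p $ 0 = ev p Y0" for p
      using poly_cline[of p Y0 V 0] by (simp add: \<phi>_def poly_0_coeff_0)
    \<comment> \<open>Translated so that the root to be continued is T = 0. Its order is the
      multiplicity of \<open>T0\<close> in \<open>G\<close> at \<open>Y0\<close>, at most
      \<open>D\<close>.\<close>
    define F where "F = pcompose (map_poly \<phi> G) [:fps_const T0, 1:]"
    define g where "g = map_poly (\<lambda>p. ev p Y0) G"
    have "map_poly (\<lambda>a. a $ 0) (map_poly \<phi> G) = g"
      by (simp add: g_def map_poly_map_poly o_def \<phi>0 rhomD[OF rh\<phi>])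
    then have F0: "coeff F j $ 0 = coeff (pcompose g [:T0, 1:]) j" for j
      unfolding F_def coeff_pcompose_const_nth_0 by simp
    have g0: "g \<noteq> 0" "degree g = D" unfolding g_def by (rule map_monic)+
    have "poly g T0 = 0"
      using relG PZ[of w] unfolding rel_def g_def Y0_def[symmetric] T0_def
      by (fastforce simp: eval_lform rpoly_def Y0_def)
    then have e: "1 \<le> order T0 g" "order T0 g \<le> D"
      using g0 order_degree[OF g0(1), of T0] by (auto simp: order_root Suc_le_eq)
    obtain m T where m: "1 \<le> m" "m \<le> fact (order T0 g)" and T: "T $ 0 = 0" "rpoly (ramify m) F T = 0"
      using puiseux_root[of "order T0 g" F] e coeff_shift_order[OF g0(1), of T0] by (auto simp: F0)
    have mD: "m \<le> fact D" using m(2) fact_mono[OF e(2)] by (metis le_trans)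
    define T' where "T' = fps_const T0 + T"
    define Yt where "Yt i = fps_const (Y0 i) + fps_const (V i) * fps_X ^ m" for i
    have Yt: "ramify m (\<phi> p) = peval fps_const p Yt" for p
      unfolding \<phi>_def Yt_def by (rule ramify_cline[OF m(1)])
    have Yt0: "Yt i $ 0 = Y0 i" for i using m(1) by (simp add: Yt_def fps_X_power_nth)
    have "ramify m (fps_const T0) = fps_const T0" by (simp add: ramify_def)
    then have "rpoly (ramify m) (map_poly \<phi> G) T' = 0"
      using T(2) m(1) by (simp add: F_def rpoly_pcompose rpoly_pCons T'_def rhomD(2)[OF rhom_ramify[OF m(1)]])
    then have root: "rpoly (\<lambda>p. peval fps_const p Yt) G T' = 0"
      by (simp add: rpoly_def map_poly_map_poly o_def Yt rhomD[OF rh\<phi>] rhomD[OF rhom_ramify[OF m(1)]])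
    define Yf where "Yf i = fps_to_fls (Yt i)" for i
    have fls: "peval fls_const p (\<lambda>i. fps_to_fls (a i)) = fps_to_fls (peval fps_const p a)" for p :: "'z::finite cpoly" and a
      by (subst peval_commute[of fps_const fps_to_fls]) auto
    have Yf: "peval fls_const p Yf = fps_to_fls (peval fps_const p Yt)" for p
      unfolding Yf_def by (rule fls)
    have rootf: "rpoly_peval fls_const Yf G (fps_to_fls T') = 0"
      using arg_cong[OF root, of fps_to_fls] by (subst (asm) rpoly_commute) (auto simp: Yf)
    have leadf: "peval fls_const (lead_coeff G) Yf \<noteq> 0" by (simp add: monic)
    have nz: "peval fls_const p Yf \<noteq> 0" if "cline p Y0 V \<noteq> 0" for p
      unfolding Yf Yt[symmetric] using that m(1) by (simp add: ramify_eq_0_iff \<phi>_def)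
    have rf: "rpoly_peval fls_const Yf (fderiv G) (fps_to_fls T') \<noteq> 0"
      by (rule \<rho>1(2)[OF leadf rootf nz[OF line_nz(1)]])
    define \<xi> where "\<xi> l = - rpoly_peval fls_const Yf (coord_deriv G l) (fps_to_fls T') / rpoly_peval fls_const Yf (fderiv G) (fps_to_fls T')" for l
    have ident: "peval fls_const \<Phi> (case_sum \<xi> Yf) = 0" if "vanZ \<Phi>" for \<Phi>
      by (rule transfer_identity[OF G rhom_fls_const leadf rootf rf \<xi>_def that])
    have \<xi>T: "(\<Sum>l\<in>UNIV. Yf (Inr l) * \<xi> l) = fps_to_fls T'"
      by (rule transfer_lform[OF G rhom_fls_const leadf rootf rf \<xi>_def])
    define coord :: "'v \<Rightarrow> ('v + ('v + 'v)) cpoly" where "coord l = rpoly (\<lambda>p. peval PC p (case_sum (\<lambda>i. PV (Inr (Inl i))) (\<lambda>k. PC (unit l k)))) G (PV (Inl l))"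
      for l :: 'v
    have coord: "peval h (coord l) (case_sum x Y) = rpoly (\<lambda>p. peval h p (case_sum (\<lambda>i. Y (Inl i)) (\<lambda>k. h (unit l k)))) G (x l)"
      if "rhom h" for h :: "complex \<Rightarrow> 'z::comm_ring_1" and l x Y
    proof -
      have "(\<lambda>i. peval h (case_sum (\<lambda>i. PV (Inr (Inl i))) (\<lambda>k. PC (unit l k)) i) (case_sum x Y)) = case_sum (\<lambda>i. Y (Inl i)) (\<lambda>k. h (unit l k))"
        using that by (auto split: sum.split)
      then show ?thesis
        unfolding coord_def using that by (subst rpoly_commute[OF _ rhom_peval]) (auto simp: peval_subst)
    qed
    have coord_van: "vanZ (coord l)" for l
      unfolding vanZ_def
    proof (intro allI impI)
      fix x Y assume "(x, Y) \<in> Z"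
      then have z: "(x, case_sum (\<lambda>i. Y (Inl i)) (unit l)) \<in> Z" by (auto simp: Z_def)
      then have "rpoly (\<lambda>p. ev p (case_sum (\<lambda>i. Y (Inl i)) (unit l))) G (x l) = 0"
        using relG unfolding rel_def by (fastforce simp: eval_lform unit_sum)
      then show "ev (coord l) (case_sum x Y) = 0"
        by (simp add: cpoly_eval_peval coord)
    qed
    \<comment> \<open>The identity \<open>coord l\<close> is a monic equation for
      \<open>\<xi> l\<close> with power series coefficients, which excludes a pole.\<close>
    have integral: "fls_subdegree (\<xi> l) \<ge> 0" for l
    proof -
      define c where "c k = peval fps_const (coeff G k) (case_sum (\<lambda>i. Yt (Inl i)) (\<lambda>k. fps_const (unit l k)))" for k
      have "(case_sum (\<lambda>i. Yf (Inl i)) (\<lambda>k. fls_const (unit l k))) = (\<lambda>i. fps_to_fls (case_sum (\<lambda>i. Yt (Inl i)) (\<lambda>k. fps_const (unit l k)) i))"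
        by (auto simp: Yf_def split: sum.split)
      then have "peval fls_const (coeff G k) (case_sum (\<lambda>i. Yf (Inl i)) (\<lambda>k. fls_const (unit l k))) = fps_to_fls (c k)" for k
        unfolding c_def by (simp only: fls)
      then have "(\<Sum>k\<le>D. fps_to_fls (c k) * \<xi> l ^ k) = 0"
        using ident[OF coord_van, of l] unfolding coord[OF rhom_fls_const]
        by (subst (asm) rpoly_altdef[where n = D]) (auto simp: D_def)
      moreover have "c D = 1" using monic by (simp add: c_def D_def)
      ultimately have "(\<Sum>k<D. fps_to_fls (c k) * \<xi> l ^ k) + \<xi> l ^ D = 0" by (simp flip: lessThan_Suc_atMost)
      then show ?thesis by (rule fls_integral)
    qed
    define b where "b l = fls_regpart (\<xi> l)" for l
    have b: "fps_to_fls (b l) = \<xi> l" for l using integral by (simp add: b_def)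
    have identb: "peval fps_const \<Phi> (case_sum b Yt) = 0" if "vanZ \<Phi>" for \<Phi>
    proof -
      have "(\<lambda>i. fps_to_fls (case_sum b Yt i)) = case_sum \<xi> Yf" by (auto simp: b Yf_def split: sum.split)
      then have "fps_to_fls (peval fps_const \<Phi> (case_sum b Yt)) = 0"
        using ident[OF that] fls[of \<Phi> "case_sum b Yt"] by simp
      then show ?thesis by simp
    qed
    have ident0: "ev \<Phi> (case_sum (\<lambda>l. b l $ 0) Y0) = 0" if "vanZ \<Phi>" for \<Phi>
    proof -
      have "peval fps_const \<Phi> (case_sum b Yt) $ 0 = peval (\<lambda>c. fps_const c $ 0) \<Phi> (\<lambda>i. case_sum b Yt i $ 0)"
        by (rule peval_commute[OF rhom_fps_const rhom_fps_nth_0])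
      moreover have "(\<lambda>i. case_sum b Yt i $ 0) = case_sum (\<lambda>l. b l $ 0) Y0" by (auto simp: Yt0 split: sum.split)
      ultimately show ?thesis using identb[OF that] by (simp add: cpoly_eval_peval)
    qed
    have bS: "(\<lambda>l. b l $ 0) \<in> S"
      unfolding S_def
    proof (intro PiE_I CollectI)
      fix l
      show "rpoly (\<lambda>p. ev p (case_sum yP (unit l))) G (b l $ 0) = 0"
        using ident0[OF coord_van, of l] by (simp add: cpoly_eval_peval coord Y0_def)
    qed auto
    \<comment> \<open>The starting point lies in the box and gives the linear form the value
      \<open>T0\<close>, as \<open>P\<close> does; by the choice of \<open>w\<close> it is
      \<open>P\<close>.\<close>
    have "fps_to_fls (\<Sum>l\<in>UNIV. Yt (Inr l) * b l) = fps_to_fls T'"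
      using \<xi>T by (simp add: rhomD[OF rhom_fps_to_fls] b Yf_def)
    then have "(\<Sum>l\<in>UNIV. Yt (Inr l) * b l) $ 0 = T' $ 0" by simp
    then have "(\<Sum>l\<in>UNIV. w l * (b l $ 0)) = (\<Sum>l\<in>UNIV. w l * P l)"
      by (simp add: fps_sum_nth Yt0 Y0_def T'_def T0_def T(1))
    then have "(\<Sum>l\<in>UNIV. w l * (b l $ 0 - P l)) = 0" by (simp add: right_diff_distrib sum_subtractf)
    then have bP: "(\<lambda>l. b l $ 0) = P" using w[OF bS] by blast
    have van: "peval fps_const p b = 0" if "\<forall>x\<in>X. ev p x = 0" for p
    proof -
      have "vanZ (liftX p)" using that by (simp add: vanZ_liftX)
      from identb[OF this] show ?thesis by (simp add: peval_subst)
    qed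
    \<comment> \<open>Along the arc \<open>f\<close> divides \<open>\<rho>2\<close>, whose order on
      the ramified line is at most m times the degree of its restriction.\<close>
    have feq: "peval fps_const \<rho>2 Yt = peval fps_const f b * peval fps_const \<Psi> (case_sum b Yt)"
      using identb[OF \<rho>2(2)] by (simp add: peval_hom peval_subst)
    have \<rho>Y: "peval fps_const \<rho>2 Yt = ramify m (fps_of_poly (cline \<rho>2 Y0 V))"
      by (simp add: Yt[symmetric] \<phi>_def)
    have \<rho>nz: "peval fps_const \<rho>2 Yt \<noteq> 0"
      unfolding \<rho>Y using line_nz(2) m(1) by (simp add: ramify_eq_0_iff)
    have fnz: "peval fps_const f b \<noteq> 0" "peval fps_const \<Psi> (case_sum b Yt) \<noteq> 0" using feq \<rho>nz by auto
    have "subdegree (peval fps_const f b) \<le> subdegree (peval fps_const \<rho>2 Yt)"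
      unfolding feq using fnz by simp
    also have "\<dots> \<le> m * degree (cline \<rho>2 Y0 V)"
      unfolding \<rho>Y by (rule subdegree_ramify_le[OF m(1)]) (use line_nz(2) in simp)
    also have "\<dots> \<le> fact D * N" using mD N by (rule mult_mono) auto
    finally show "\<exists>b. (\<forall>l. b l $ 0 = P l) \<and> (\<forall>p. (\<forall>x\<in>X. ev p x = 0) \<longrightarrow> peval fps_const p b = 0) \<and>
       peval fps_const f b \<noteq> 0 \<and> subdegree (peval fps_const f b) \<le> fact D * N"
      using bP van fnz by (intro exI[of _ b]) (auto simp: fun_eq_iff)
  qed
qed

end

theorem bounded_arcs:
  fixes X :: "('v::finite \<Rightarrow> complex) set"
  assumes prime: "\<And>p q. (\<forall>x\<in>X. ev (p * q) x = 0) \<Longrightarrow> (\<forall>x\<in>X. ev p x = 0) \<or> (\<forall>x\<in>X. ev q x = 0)"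
    and closed: "\<And>x. (\<And>p. (\<forall>z\<in>X. ev p z = 0) \<Longrightarrow> ev p x = 0) \<Longrightarrow> x \<in> X"
    and f: "\<exists>x\<in>X. ev f x \<noteq> 0"
  shows "\<exists>K. \<forall>P\<in>X. \<exists>b :: 'v \<Rightarrow> complex fps. (\<forall>l. b l $ 0 = P l) \<and>
     (\<forall>p. (\<forall>x\<in>X. ev p x = 0) \<longrightarrow> peval fps_const p b = 0) \<and>
     peval fps_const f b \<noteq> 0 \<and> subdegree (peval fps_const f b) \<le> K"
proof -
  have ne: "X \<noteq> {}" using f by auto
  show ?thesis
  proof (rule noether_normalization[OF ne])
    fix I y E
    assume N: "module_gen X y E" "\<And>i. i \<notin> I \<Longrightarrow> y i = 0"
      "\<And>H Y. (\<And>x. x \<in> X \<Longrightarrow> ev H (\<lambda>i. ev (y i) x) = 0) \<Longrightarrow> (\<And>i. i \<notin> I \<Longrightarrow> Y i = 0) \<Longrightarrow> ev H Y = 0"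
    interpret noether_normalized X I y E
      by (rule noether_normalized.intro[OF prime closed N])
    show ?thesis by (rule bounded_arcs_normalized[OF f])
  qed
qed

section \<open>Arcs on the blowup\<close>

no_notation fps_nth (infixl \<open>$\<close> 75)
unbundle vec_syntax

section \<open>Projective classes and polynomials homogeneous in the second block of
  variables\<close>

lemma vec_nth_smult: "vec_nth (c *s x) = (\<lambda>i. c * x $ i)"
  by (simp add: fun_eq_iff)

lemma proj_class_eq_iff:
  assumes "x \<noteq> 0" "y \<noteq> 0"
  shows "proj_class x = proj_class y \<longleftrightarrow> (\<exists>c. c \<noteq> 0 \<and> y = c *s x)"
proof -
  have refl: "proj_rel z z" if "z \<noteq> 0" for z :: "complex^'a"
    using that by (auto simp: proj_rel_def intro!: exI[of _ 1])
  have "proj_rel x y \<longleftrightarrow> proj_class x = proj_class y"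
    unfolding proj_class_def using Quotient_rel[OF Quotient_cproj, of x y] refl assms by auto
  then show ?thesis using assms by (auto simp: proj_rel_def)
qed

lemma homogeneous_snd_const: "homogeneous_snd 0 (PC c)"
  by (auto simp: homogeneous_snd_def PC_def split: if_splits)

lemma homogeneous_snd_Inl: "homogeneous_snd 0 (PV (Inl i))"
  by (auto simp: homogeneous_snd_def PV_def lookup_single)

lemma homogeneous_snd_Inr: "homogeneous_snd 1 (PV (Inr i))"
proof -
  have "(\<Sum>j\<in>UNIV. lookup (single (Inr i) 1) (Inr j)) = (\<Sum>j\<in>UNIV. if j = i then 1 else (0::nat))"
    by (intro sum.cong) (auto simp: lookup_single when_def)
  then show ?thesis by (auto simp: homogeneous_snd_def PV_def)
qed

lemma homogeneous_snd_add: "homogeneous_snd e f \<Longrightarrow> homogeneous_snd e g \<Longrightarrow> homogeneous_snd e (f + g)"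
  using keys_add[of f g] by (auto simp: homogeneous_snd_def)

lemma homogeneous_snd_diff: "homogeneous_snd e f \<Longrightarrow> homogeneous_snd e g \<Longrightarrow> homogeneous_snd e (f - g)"
  using keys_diff[of f g] by (auto simp: homogeneous_snd_def)

lemma homogeneous_snd_mult: "homogeneous_snd d f \<Longrightarrow> homogeneous_snd e g \<Longrightarrow> homogeneous_snd (d + e) (f * g)"
  using keys_mult[of f g] by (fastforce simp: homogeneous_snd_def lookup_add sum.distrib)

lemma homogeneous_snd_power_Inr: "homogeneous_snd n (PV (Inr i) ^ n)"
proof (induction n)
  case 0
  show ?case using homogeneous_snd_const[of 1] by (simp add: rhomD(2)[OF rhom_PC])
next
  case (Suc n)
  then show ?case using homogeneous_snd_mult[OF homogeneous_snd_Inr] by fastforce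
qed

lemma homogeneous_snd_lift: "homogeneous_snd 0 (peval PC f (\<lambda>i. PV (Inl i)))"
proof (induction f rule: cpoly_induct)
  case (mult f g)
  then show ?case using homogeneous_snd_mult[OF mult] by simp
qed (auto simp: homogeneous_snd_const homogeneous_snd_Inl intro: homogeneous_snd_add)

lemma homogeneous_snd_scale:
  fixes f :: "('n::finite + 'N::finite) cpoly"
  assumes "homogeneous_snd e f"
  shows "ev f (case_sum a (\<lambda>i. c * x i)) = c ^ e * ev f (case_sum a x)"
proof -
  have split: "(\<Prod>i\<in>UNIV. h i) = (\<Prod>i\<in>UNIV. h (Inl i)) * (\<Prod>j\<in>UNIV. h (Inr j))" for h :: "'n + 'N \<Rightarrow> complex"
  proof -
    have "(\<Prod>i\<in>range Inl \<union> range Inr. h i) = (\<Prod>i\<in>range Inl. h i) * (\<Prod>i\<in>range Inr. h i)"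
      by (rule prod.union_disjoint) auto
    then show ?thesis by (simp add: UNIV_sum prod.reindex)
  qed
  show ?thesis
    unfolding cpoly_eval_def sum_distrib_left
  proof (rule sum.cong)
    fix m assume m: "m \<in> keys f"
    then have e: "(\<Sum>j\<in>UNIV. lookup m (Inr j)) = e" using assms by (simp add: homogeneous_snd_def)
    have "(\<Prod>j\<in>UNIV. (c * x j) ^ lookup m (Inr j)) = c ^ e * (\<Prod>j\<in>UNIV. x j ^ lookup m (Inr j))"
      by (simp add: power_mult_distrib prod.distrib power_sum flip: e)
    then show "lookup f m * monom_val (case_sum a (\<lambda>i. c * x i)) m = c ^ e * (lookup f m * monom_val (case_sum a x) m)"
      by (simp add: monom_val_def split)
  qed simp
qed

text \<open>Denominators x_j are cleared variable by variable; for a sum the exponents are made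
  equal by extra powers of x_j.\<close>

lemma homogenization:
  fixes p :: "('n::finite + 'N::finite) cpoly"
  shows "\<exists>e f. homogeneous_snd e f \<and> (\<forall>a x. x j \<noteq> 0 \<longrightarrow> ev f (case_sum a x) = x j ^ e * ev p (case_sum a (\<lambda>i. x i / x j)))"
proof (induction p rule: cpoly_induct)
  case (const c)
  show ?case by (intro exI[of _ 0] exI[of _ "PC c"]) (simp add: homogeneous_snd_const)
next
  case (var i)
  show ?case
  proof (cases i)
    case (Inl l)
    then show ?thesis by (intro exI[of _ 0] exI[of _ "PV (Inl l)"]) (simp add: homogeneous_snd_Inl)
  next
    case (Inr l)
    then show ?thesis by (intro exI[of _ 1] exI[of _ "PV (Inr l)"]) (simp add: homogeneous_snd_Inr[unfolded One_nat_def])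
  qed
next
  case (add p q)
  then obtain d f e g where f: "homogeneous_snd d f" "\<And>a x. x j \<noteq> 0 \<Longrightarrow> ev f (case_sum a x) = x j ^ d * ev p (case_sum a (\<lambda>i. x i / x j))"
    and g: "homogeneous_snd e g" "\<And>a x. x j \<noteq> 0 \<Longrightarrow> ev g (case_sum a x) = x j ^ e * ev q (case_sum a (\<lambda>i. x i / x j))"
    by blast
  have "homogeneous_snd (d + e) (f * PV (Inr j) ^ e + PV (Inr j) ^ d * g)"
    by (intro homogeneous_snd_add homogeneous_snd_mult f g homogeneous_snd_power_Inr)
  moreover have "ev (f * PV (Inr j) ^ e + PV (Inr j) ^ d * g) (case_sum a x) = x j ^ (d + e) * ev (p + q) (case_sum a (\<lambda>i. x i / x j))"
    if "x j \<noteq> 0" for a x using f(2)[where x = x and a = a, OF that] g(2)[where x = x and a = a, OF that] by (simp add: power_add algebra_simps)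
  ultimately show ?case by blast
next
  case (mult p q)
  then obtain d f e g where f: "homogeneous_snd d f" "\<And>a x. x j \<noteq> 0 \<Longrightarrow> ev f (case_sum a x) = x j ^ d * ev p (case_sum a (\<lambda>i. x i / x j))"
    and g: "homogeneous_snd e g" "\<And>a x. x j \<noteq> 0 \<Longrightarrow> ev g (case_sum a x) = x j ^ e * ev q (case_sum a (\<lambda>i. x i / x j))"
    by blast
  have "homogeneous_snd (d + e) (f * g)" by (intro homogeneous_snd_mult f g)
  moreover have "ev (f * g) (case_sum a x) = x j ^ (d + e) * ev (p * q) (case_sum a (\<lambda>i. x i / x j))"
    if "x j \<noteq> 0" for a x using f(2)[where x = x and a = a, OF that] g(2)[where x = x and a = a, OF that] by (simp add: power_add algebra_simps)
  ultimately show ?case by blast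
qed

lemma zero_set_iff: "lam \<in> zero_set (ideal_of v) \<longleftrightarrow> poly_map v lam = 0"
proof -
  have "v j \<in> ideal_of v" for j
  proof -
    have "(\<Sum>i\<in>UNIV. (if i = j then 1 else 0) * v i) = (\<Sum>i\<in>UNIV. if i = j then v i else 0)" by (intro sum.cong) auto
    then have "v j = (\<Sum>i\<in>UNIV. (if i = j then 1 else 0) * v i)" by simp
    then show ?thesis unfolding ideal_of_def by (rule range_eqI[where x = "\<lambda>i. if i = j then 1 else 0"])
  qed
  show ?thesis
  proof
    assume "lam \<in> zero_set (ideal_of v)"
    then show "poly_map v lam = 0" using \<open>\<And>j. v j \<in> ideal_of v\<close> by (simp add: zero_set_def poly_map_def vec_eq_iff)
  next
    assume "poly_map v lam = 0"
    then have "ev (v j) (vec_nth lam) = 0" for j by (simp add: poly_map_def vec_eq_iff)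
    then show "lam \<in> zero_set (ideal_of v)" by (auto simp: zero_set_def ideal_of_def)
  qed
qed

text \<open>By homogeneity the equations may be tested on any representative of the projective
  point.\<close>

lemma in_zariski_closed_iff:
  assumes "\<forall>f\<in>S. \<exists>e. homogeneous_snd e f" "x \<noteq> 0"
  shows "(lam, proj_class x) \<in> {(lam, proj_class x) | lam x. x \<noteq> 0 \<and> (\<forall>f\<in>S. ev f (case_sum (vec_nth lam) (vec_nth x)) = 0)} \<longleftrightarrow>
    (\<forall>f\<in>S. ev f (case_sum (vec_nth lam) (vec_nth x)) = 0)"
proof
  assume "(lam, proj_class x) \<in> {(lam, proj_class x) | lam x. x \<noteq> 0 \<and> (\<forall>f\<in>S. ev f (case_sum (vec_nth lam) (vec_nth x)) = 0)}"
  then obtain y where y: "y \<noteq> 0" "proj_class y = proj_class x" "\<forall>f\<in>S. ev f (case_sum (vec_nth lam) (vec_nth y)) = 0"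
    by auto
  then obtain c where c: "x = c *s y" using proj_class_eq_iff[OF y(1) assms(2)] by blast
  show "\<forall>f\<in>S. ev f (case_sum (vec_nth lam) (vec_nth x)) = 0"
  proof
    fix f assume f: "f \<in> S"
    then obtain e where "homogeneous_snd e f" using assms(1) by blast
    from homogeneous_snd_scale[OF this, of "vec_nth lam" c "vec_nth y"] y(3) f
    show "ev f (case_sum (vec_nth lam) (vec_nth x)) = 0" by (simp add: c vec_nth_smult)
  qed
qed (use assms in auto)

text \<open>Every closed set is an intersection of sets given by a single homogeneous polynomial, so
  the polynomials vanishing on the graph can be tested one at a time.\<close>

lemma blowup_iff:
  fixes v :: "'N::finite \<Rightarrow> 'n::finite cpoly"
  assumes "x \<noteq> 0"
  shows "(lam, proj_class x) \<in> blowup v \<longleftrightarrow>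
    (\<forall>e f. homogeneous_snd e f \<longrightarrow> (\<forall>mu. ev f (case_sum (vec_nth mu) (vec_nth (poly_map v mu))) = 0 \<or> poly_map v mu = 0) \<longrightarrow>
       ev f (case_sum (vec_nth lam) (vec_nth x)) = 0)"
proof -
  let ?graph = "(\<lambda>lam. (lam, proj_class (poly_map v lam))) ` (- zero_set (ideal_of v))"
  define loc :: "('n + 'N) cpoly set \<Rightarrow> ((complex^'n) \<times> 'N cproj) set" where
    "loc S = {(lam, proj_class x) | lam x. x \<noteq> 0 \<and> (\<forall>f\<in>S. ev f (case_sum (vec_nth lam) (vec_nth x)) = 0)}" for S
  have mem: "(lam, proj_class x) \<in> loc S \<longleftrightarrow> (\<forall>f\<in>S. ev f (case_sum (vec_nth lam) (vec_nth x)) = 0)"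
    if "\<forall>f\<in>S. \<exists>e. homogeneous_snd e f" "x \<noteq> 0" for S lam x
    unfolding loc_def by (rule in_zariski_closed_iff[OF that])
  have sub: "?graph \<subseteq> loc S \<longleftrightarrow> (\<forall>mu. poly_map v mu \<noteq> 0 \<longrightarrow> (\<forall>f\<in>S. ev f (case_sum (vec_nth mu) (vec_nth (poly_map v mu))) = 0))"
    if h: "\<forall>f\<in>S. \<exists>e. homogeneous_snd e f" for S
  proof -
    have "?graph \<subseteq> loc S \<longleftrightarrow> (\<forall>mu. poly_map v mu \<noteq> 0 \<longrightarrow> (mu, proj_class (poly_map v mu)) \<in> loc S)"
      by (auto simp: zero_set_iff image_subset_iff Ball_def)
    then show ?thesis using mem[OF h] by simp
  qed
  have bl: "(lam, proj_class x) \<in> blowup v \<longleftrightarrow> (\<forall>S. (\<forall>f\<in>S. \<exists>e. homogeneous_snd e f) \<longrightarrow> ?graph \<subseteq> loc S \<longrightarrow> (lam, proj_class x) \<in> loc S)"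
    unfolding blowup_def zariski_closure_def zariski_closed_def loc_def[symmetric] by blast
  show ?thesis
  proof
    assume L: "(lam, proj_class x) \<in> blowup v"
    show "\<forall>e f. homogeneous_snd e f \<longrightarrow> (\<forall>mu. ev f (case_sum (vec_nth mu) (vec_nth (poly_map v mu))) = 0 \<or> poly_map v mu = 0) \<longrightarrow>
       ev f (case_sum (vec_nth lam) (vec_nth x)) = 0"
    proof (intro allI impI)
      fix e f assume f: "homogeneous_snd e f" "\<forall>mu. ev f (case_sum (vec_nth mu) (vec_nth (poly_map v mu))) = 0 \<or> poly_map v mu = 0"
      have h: "\<forall>f\<in>{f}. \<exists>e. homogeneous_snd e f" using f by blast
      have "?graph \<subseteq> loc {f}" using f sub[OF h] by blast
      then have "(lam, proj_class x) \<in> loc {f}" using L h bl by blast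
      then show "ev f (case_sum (vec_nth lam) (vec_nth x)) = 0" using mem[OF h assms] by blast
    qed
  next
    assume R: "\<forall>e f. homogeneous_snd e f \<longrightarrow> (\<forall>mu. ev f (case_sum (vec_nth mu) (vec_nth (poly_map v mu))) = 0 \<or> poly_map v mu = 0) \<longrightarrow>
       ev f (case_sum (vec_nth lam) (vec_nth x)) = 0"
    show "(lam, proj_class x) \<in> blowup v"
      unfolding bl
    proof (intro allI impI)
      fix S :: "('n + 'N) cpoly set"
      assume h: "\<forall>f\<in>S. \<exists>e. homogeneous_snd e f" and "?graph \<subseteq> loc S"
      then have "\<forall>f\<in>S. ev f (case_sum (vec_nth lam) (vec_nth x)) = 0" using sub[OF h] R by meson
      then show "(lam, proj_class x) \<in> loc S" using mem[OF h assms] by blast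
    qed
  qed
qed

lemma blowup_cases:
  assumes "P \<in> blowup v"
  obtains lam x where "P = (lam, proj_class x)" "x \<noteq> 0"
proof -
  have "zariski_closed {(lam :: complex^'a, proj_class x :: 'b cproj) | lam x. x \<noteq> 0}"
    unfolding zariski_closed_def by (rule exI[of _ "{}"]) auto
  moreover have "(\<lambda>lam. (lam, proj_class (poly_map v lam))) ` (- zero_set (ideal_of v)) \<subseteq> {(lam, proj_class x) | lam x. x \<noteq> 0}"
    by (auto simp: zero_set_iff)
  ultimately have "P \<in> {(lam, proj_class x) | lam x. x \<noteq> 0}"
    using assms unfolding blowup_def zariski_closure_def by blast
  then show ?thesis using that by blast
qed

lemma cpoly_eval_continuous:
  assumes "\<And>i. ((\<lambda>t. x t i) \<longlongrightarrow> a i) F"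
  shows "((\<lambda>t. ev f (x t)) \<longlongrightarrow> ev f a) F"
  unfolding cpoly_eval_def monom_val_def by (intro tendsto_intros assms)

lemma analytic_arc_tendsto:
  assumes "analytic_arc q"
  shows "((\<lambda>t. q t $ i) \<longlongrightarrow> q 0 $ i) (at 0)"
proof -
  have "isCont (\<lambda>t. q t $ i) 0"
    using assms unfolding analytic_arc_def by (intro analytic_at_imp_isCont) auto
  then show ?thesis by (rule isContD)
qed

lemma analytic_arc_nonzero:
  assumes "analytic_arc q" "q 0 \<noteq> 0"
  shows "\<forall>\<^sub>F t in nhds 0. q t \<noteq> 0"
proof -
  obtain i where "q 0 $ i \<noteq> 0" using assms(2) by (auto simp: vec_eq_iff)
  then have "\<forall>\<^sub>F t in at 0. q t $ i \<noteq> 0"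
    using analytic_arc_tendsto[OF assms(1), of i] tendsto_imp_eventually_ne by blast
  then have "\<forall>\<^sub>F t in at 0. q t \<noteq> 0" by eventually_elim auto
  then show ?thesis using assms(2) by (simp add: eventually_nhds_conv_at)
qed

lemma analytic_bigo:
  assumes "f analytic_on {0}"
  shows "(\<lambda>t. t ^ k * f t - t ^ k * f 0) \<in> O[at 0](\<lambda>t. t ^ (k + 1) :: complex)"
proof -
  obtain D where "(f has_field_derivative D) (at 0)"
    using assms by (meson analytic_on_imp_differentiable_at field_differentiable_def singletonI)
  then have "((\<lambda>t. (f t - f 0) / t) \<longlongrightarrow> D) (at 0)" by (simp add: has_field_derivative_iff)
  then have "(\<lambda>t. f t - f 0) \<in> O[at 0](\<lambda>t. t)"
    by (rule bigoI_tendsto) (auto simp: eventually_at_filter)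
  then have "(\<lambda>t. t ^ k * (f t - f 0)) \<in> O[at 0](\<lambda>t. t ^ k * t)"
    by (rule landau_o.big.mult_left)
  then show ?thesis by (simp add: algebra_simps)
qed

text \<open>For t nonzero [q(t)] = [v(g(t))] lies on the graph, and the equations of the blowup
  extend to t = 0 by continuity. Dividing v by t^k along a curve thus produces an arc of order k
  that starts at [q(0)].\<close>

lemma blowup_arc_of_lift:
  fixes v :: "'N::finite \<Rightarrow> 'n::finite cpoly"
  assumes g: "analytic_arc g" and q: "analytic_arc q" "q 0 \<noteq> 0" and k: "k \<ge> 1"
    and eq: "\<forall>\<^sub>F t in nhds 0. poly_map v (g t) = t ^ k *s q t"
  defines "\<alpha> \<equiv> \<lambda>t. (g t, proj_class (q t))"
  shows "blowup_arc v \<alpha>" "has_arc_order v \<alpha> k" "\<alpha> 0 \<in> exceptional v"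
proof -
  have qn: "\<forall>\<^sub>F t in nhds 0. q t \<noteq> 0" by (rule analytic_arc_nonzero[OF q])
  have zero0: "poly_map v (g 0) = 0" using eventually_nhds_x_imp_x[OF eq] k by (simp add: power_0_left)
  have ev: "\<forall>\<^sub>F t in at 0. q t \<noteq> 0 \<and> t \<noteq> 0 \<and> poly_map v (g t) = t ^ k *s q t"
    using qn eq eventually_neq_at_within[of 0 0 UNIV] by (auto simp: eventually_nhds_conv_at eventually_conj_iff)
  have out: "\<forall>\<^sub>F t in at 0. poly_map v (g t) \<noteq> 0" using ev by eventually_elim auto
  have at0: "\<alpha> 0 \<in> blowup v"
    unfolding \<alpha>_def blowup_iff[OF q(2)]
  proof (intro allI impI)
    fix e f assume f: "homogeneous_snd e f" "\<forall>mu. ev f (case_sum (vec_nth mu) (vec_nth (poly_map v mu))) = 0 \<or> poly_map v mu = 0"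
    have "\<forall>\<^sub>F t in at 0. ev f (case_sum (vec_nth (g t)) (vec_nth (q t))) = 0"
      using ev
    proof eventually_elim
      case (elim t)
      then have "poly_map v (g t) \<noteq> 0" by auto
      then have "ev f (case_sum (vec_nth (g t)) (\<lambda>i. t ^ k * q t $ i)) = 0"
        using f(2)[rule_format, of "g t"] elim by (simp add: vec_nth_smult)
      then show ?case using elim unfolding homogeneous_snd_scale[OF f(1)] by simp
    qed
    moreover have "((\<lambda>t. ev f (case_sum (vec_nth (g t)) (vec_nth (q t)))) \<longlongrightarrow> ev f (case_sum (vec_nth (g 0)) (vec_nth (q 0)))) (at 0)"
      by (rule cpoly_eval_continuous) (auto intro: analytic_arc_tendsto g q split: sum.split)
    ultimately have "((\<lambda>t. 0) \<longlongrightarrow> ev f (case_sum (vec_nth (g 0)) (vec_nth (q 0)))) (at (0 :: complex))"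
      by (rule Lim_transform_eventually[rotated])
    then show "ev f (case_sum (vec_nth (g 0)) (vec_nth (q 0))) = 0"
      by (simp add: tendsto_const_iff)
  qed
  then show exc: "\<alpha> 0 \<in> exceptional v" by (simp add: exceptional_def \<alpha>_def zero_set_iff zero0)
  have "\<forall>\<^sub>F t in at 0. \<alpha> t \<in> blowup v"
    using ev
  proof eventually_elim
    case (elim t)
    then have "poly_map v (g t) \<noteq> 0" by auto
    have "q t \<noteq> 0" using elim by simp
    then show ?case
      unfolding \<alpha>_def blowup_iff[OF \<open>q t \<noteq> 0\<close>]
    proof (intro allI impI)
      fix e f assume f: "homogeneous_snd e f" "\<forall>mu. ev f (case_sum (vec_nth mu) (vec_nth (poly_map v mu))) = 0 \<or> poly_map v mu = 0"
      have "ev f (case_sum (vec_nth (g t)) (\<lambda>i. t ^ k * q t $ i)) = 0"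
        using f(2)[rule_format, of "g t"] elim \<open>poly_map v (g t) \<noteq> 0\<close> by (simp add: vec_nth_smult)
      then show "ev f (case_sum (vec_nth (g t)) (vec_nth (q t))) = 0"
        using elim unfolding homogeneous_snd_scale[OF f(1)] by simp
    qed
  qed
  then have "\<forall>\<^sub>F t in nhds 0. \<alpha> t \<in> blowup v" using at0 by (simp add: eventually_nhds_conv_at)
  moreover have "\<not> (\<forall>\<^sub>F t in nhds 0. \<alpha> t \<in> exceptional v)"
  proof
    assume "\<forall>\<^sub>F t in nhds 0. \<alpha> t \<in> exceptional v"
    then have "\<forall>\<^sub>F t in at 0. \<alpha> t \<in> exceptional v" by (simp add: eventually_nhds_conv_at)
    with out have "\<forall>\<^sub>F t in at (0::complex). False"
      by eventually_elim (auto simp: exceptional_def \<alpha>_def zero_set_iff)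
    then show False by simp
  qed
  ultimately show "blowup_arc v \<alpha>"
    using g q(1) qn exc unfolding blowup_arc_def \<alpha>_def by auto
  show "has_arc_order v \<alpha> k"
    unfolding has_arc_order_def
  proof (intro conjI exI[of _ "q 0"] allI k q(2))
    fix j
    have "(\<lambda>t. t ^ k * q t $ j - t ^ k * q 0 $ j) \<in> O[at 0](\<lambda>t. t ^ (k + 1))"
      using q(1) by (intro analytic_bigo) (simp add: analytic_arc_def)
    moreover have "\<forall>\<^sub>F t in at 0. t ^ k * q t $ j - t ^ k * q 0 $ j = poly_map v (fst (\<alpha> t)) $ j - t ^ k * q 0 $ j"
      using ev by eventually_elim (simp add: \<alpha>_def)
    ultimately show "(\<lambda>t. poly_map v (fst (\<alpha> t)) $ j - t ^ k * q 0 $ j) \<in> O[at 0](\<lambda>t. t ^ (k + 1))"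
      by (simp add: landau_o.big.in_cong)
  qed
qed

text \<open>Congruent arguments give congruent values; this justifies replacing an arc by its
  truncation.\<close>

lemma peval_diff_dvd:
  assumes "rhom h" "\<And>i. d dvd x i - y i"
  shows "d dvd peval h f x - peval h f y"
proof (induction f rule: cpoly_induct)
  case (add f g)
  then have "d dvd (peval h f x - peval h f y) + (peval h g x - peval h g y)" by (rule dvd_add)
  then show ?case using assms(1) by (simp add: algebra_simps)
next
  case (mult f g)
  then have "d dvd peval h f x * (peval h g x - peval h g y) + (peval h f x - peval h f y) * peval h g y"
    by (intro dvd_add dvd_mult dvd_mult2)
  then show ?case using assms(1) by (simp add: algebra_simps)
qed (use assms in auto)

section \<open>Affine charts of the blowup\<close>

definition chart :: "('N::finite \<Rightarrow> 'n::finite cpoly) \<Rightarrow> 'N \<Rightarrow> complex^'n \<Rightarrow> 'n + 'N \<Rightarrow> complex" where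
  "chart v j mu = case_sum (vec_nth mu) (\<lambda>i. ev (v i) (vec_nth mu) / ev (v j) (vec_nth mu))"

definition chart_closure :: "('N::finite \<Rightarrow> 'n::finite cpoly) \<Rightarrow> 'N \<Rightarrow> ('n + 'N \<Rightarrow> complex) set" where
  "chart_closure v j = {x. \<forall>p. (\<forall>mu. ev (v j) (vec_nth mu) \<noteq> 0 \<longrightarrow> ev p (chart v j mu) = 0) \<longrightarrow> ev p x = 0}"

lemma chart_in_closure: "ev (v j) (vec_nth mu) \<noteq> 0 \<Longrightarrow> chart v j mu \<in> chart_closure v j"
  by (auto simp: chart_closure_def)

lemma vanish_on_chart_closure:
  "(\<forall>x\<in>chart_closure v j. ev p x = 0) \<longleftrightarrow> (\<forall>mu. ev (v j) (vec_nth mu) \<noteq> 0 \<longrightarrow> ev p (chart v j mu) = 0)"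
  using chart_in_closure by (fastforce simp: chart_closure_def)

lemma chart_clear_denominators:
  "\<exists>e q. \<forall>mu. ev (v j) (vec_nth mu) \<noteq> 0 \<longrightarrow> ev q (vec_nth mu) = ev (v j) (vec_nth mu) ^ e * ev p (chart v j mu)"
proof (induction p rule: cpoly_induct)
  case (const c)
  show ?case by (intro exI[of _ 0] exI[of _ "PC c"]) simp
next
  case (var i)
  show ?case
  proof (cases i)
    case (Inl l)
    then show ?thesis by (intro exI[of _ 0] exI[of _ "PV l"]) (simp add: chart_def)
  next
    case (Inr l)
    then show ?thesis by (intro exI[of _ 1] exI[of _ "v l"]) (simp add: chart_def)
  qed
next
  case (add p p')
  then obtain e q e' q' where
    "\<And>mu. ev (v j) (vec_nth mu) \<noteq> 0 \<Longrightarrow> ev q (vec_nth mu) = ev (v j) (vec_nth mu) ^ e * ev p (chart v j mu)"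
    "\<And>mu. ev (v j) (vec_nth mu) \<noteq> 0 \<Longrightarrow> ev q' (vec_nth mu) = ev (v j) (vec_nth mu) ^ e' * ev p' (chart v j mu)"
    by blast
  then show ?case
    by (intro exI[of _ "e + e'"] exI[of _ "q * v j ^ e' + v j ^ e * q'"]) (simp add: power_add algebra_simps)
next
  case (mult p p')
  then obtain e q e' q' where
    "\<And>mu. ev (v j) (vec_nth mu) \<noteq> 0 \<Longrightarrow> ev q (vec_nth mu) = ev (v j) (vec_nth mu) ^ e * ev p (chart v j mu)"
    "\<And>mu. ev (v j) (vec_nth mu) \<noteq> 0 \<Longrightarrow> ev q' (vec_nth mu) = ev (v j) (vec_nth mu) ^ e' * ev p' (chart v j mu)"
    by blast
  then show ?case
    by (intro exI[of _ "e + e'"] exI[of _ "q * q'"]) (simp add: power_add algebra_simps)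
qed

lemma cpoly_eval_vec_lambda: "ev p (vec_nth (vec_lambda x)) = ev p x"
  by (simp add: vec_lambda_inverse)

text \<open>The chart is parametrized by the set where v_j is nonzero. Clearing denominators turns
  both factors into polynomials whose product, multiplied by v_j, vanishes everywhere; so one of the
  three is zero, and v_j = 0 means an empty chart.\<close>

lemma chart_closure_prime:
  assumes "\<forall>x\<in>chart_closure v j. ev (p * p') x = 0"
  shows "(\<forall>x\<in>chart_closure v j. ev p x = 0) \<or> (\<forall>x\<in>chart_closure v j. ev p' x = 0)"
proof -
  obtain e q where q: "\<And>mu. ev (v j) (vec_nth mu) \<noteq> 0 \<Longrightarrow> ev q (vec_nth mu) = ev (v j) (vec_nth mu) ^ e * ev p (chart v j mu)"
    using chart_clear_denominators by blast
  obtain e' q' where q': "\<And>mu. ev (v j) (vec_nth mu) \<noteq> 0 \<Longrightarrow> ev q' (vec_nth mu) = ev (v j) (vec_nth mu) ^ e' * ev p' (chart v j mu)"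
    using chart_clear_denominators by blast
  have "v j * (q * q') = 0"
  proof (rule cpoly_eqI)
    fix x
    have "ev (v j * (q * q')) (vec_nth (vec_lambda x)) = 0"
      using assms q[of "vec_lambda x"] q'[of "vec_lambda x"] unfolding vanish_on_chart_closure by auto
    then show "ev (v j * (q * q')) x = ev 0 x" by (simp add: cpoly_eval_vec_lambda)
  qed
  then consider "v j = 0" | "q = 0" | "q' = 0" by (auto simp: cpoly_mult_eq_0)
  then show ?thesis
  proof cases
    case 1
    then show ?thesis by (simp add: vanish_on_chart_closure)
  next
    case 2
    then show ?thesis using q by (simp add: vanish_on_chart_closure)
  next
    case 3
    then show ?thesis using q' by (simp add: vanish_on_chart_closure)
  qed
qed

lemma analytic_arc_poly: "analytic_arc (\<lambda>t. \<chi> i. poly (p i) t)"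
  unfolding analytic_arc_def by (auto intro!: holomorphic_on_imp_analytic_at[of _ UNIV] holomorphic_intros)

lemma point_order_chart_bounded:
  fixes v :: "'N::finite \<Rightarrow> 'n::finite cpoly"
  shows "\<exists>K. \<forall>lam x. x \<noteq> 0 \<longrightarrow> x $ j \<noteq> 0 \<longrightarrow> (lam, proj_class x) \<in> exceptional v \<longrightarrow> point_order v (lam, proj_class x) \<le> enat K"
proof (cases "v j = 0")
  case True
  \<comment> \<open>With v_j = 0 the equation x_j = 0 holds on the graph, hence on the
    blowup.\<close>
  have "x $ j = 0" if "x \<noteq> 0" "(lam, proj_class x) \<in> exceptional v" for lam x
    using that homogeneous_snd_Inr[of j] True
    by (force simp: exceptional_def blowup_iff poly_map_def)
  then show ?thesis by blast
next
  case False
  then obtain a where a: "ev (v j) a \<noteq> 0" using cpoly_nonzero_point by blast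
  define X where "X = chart_closure v j"
  \<comment> \<open>In this chart v_i = x_i v_j, so v_j generates the exceptional ideal and its
    order along an arc is the order of the arc.\<close>
  define f where "f = peval PC (v j) (\<lambda>i. PV (Inl i :: 'n + 'N))"
  have "\<exists>K. \<forall>P\<in>X. \<exists>b. (\<forall>l. fps_nth (b l) 0 = P l) \<and>
     (\<forall>p. (\<forall>x\<in>X. ev p x = 0) \<longrightarrow> peval fps_const p b = 0) \<and>
     peval fps_const f b \<noteq> 0 \<and> subdegree (peval fps_const f b) \<le> K"
  proof (rule bounded_arcs)
    show "(\<forall>x\<in>X. ev p x = 0) \<or> (\<forall>x\<in>X. ev q x = 0)" if "\<forall>x\<in>X. ev (p * q) x = 0" for p q
      using that unfolding X_def by (rule chart_closure_prime)
    show "x \<in> X" if "\<And>p. \<forall>z\<in>X. ev p z = 0 \<Longrightarrow> ev p x = 0" for x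
      using that unfolding X_def vanish_on_chart_closure by (auto simp: chart_closure_def)
    have "chart v j (vec_lambda a) \<in> X" unfolding X_def
      by (rule chart_in_closure) (simp add: cpoly_eval_vec_lambda a)
    moreover have "ev f (chart v j (vec_lambda a)) \<noteq> 0"
      using a by (simp add: f_def chart_def cpoly_eval_vec_lambda)
    ultimately show "\<exists>x\<in>X. ev f x \<noteq> 0" by blast
  qed
  then obtain K where K: "\<And>P. P \<in> X \<Longrightarrow> \<exists>b. (\<forall>l. fps_nth (b l) 0 = P l) \<and>
     (\<forall>p. (\<forall>x\<in>X. ev p x = 0) \<longrightarrow> peval fps_const p b = 0) \<and>
     peval fps_const f b \<noteq> 0 \<and> subdegree (peval fps_const f b) \<le> K" by blast
  show ?thesis
  proof (intro exI[of _ K] allI impI)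
    fix lam x assume x: "x \<noteq> 0" "x $ j \<noteq> 0" and exc: "(lam, proj_class x) \<in> exceptional v"
    define z where "z = case_sum (vec_nth lam) (\<lambda>i. x $ i / x $ j)"
    have "z \<in> X"
      unfolding X_def chart_closure_def
    proof (intro CollectI allI impI)
      fix p assume p: "\<forall>mu. ev (v j) (vec_nth mu) \<noteq> 0 \<longrightarrow> ev p (chart v j mu) = 0"
      obtain e h where h: "homogeneous_snd e h"
        "\<And>a x. x j \<noteq> 0 \<Longrightarrow> ev h (case_sum a x) = x j ^ e * ev p (case_sum a (\<lambda>i. x i / x j))"
        using homogenization[where p = p and j = j] by blast
      \<comment> \<open>The factor x_j takes care of the graph points with v_j = 0, which the chart
        does not see.\<close>
      have "homogeneous_snd (1 + e) (PV (Inr j) * h)" by (intro homogeneous_snd_mult homogeneous_snd_Inr h)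
      moreover have "ev (PV (Inr j) * h) (case_sum (vec_nth mu) (vec_nth (poly_map v mu))) = 0" for mu
        using p[rule_format, of mu] h(2)[of "vec_nth (poly_map v mu)"]
        by (cases "ev (v j) (vec_nth mu) = 0") (auto simp: poly_map_def chart_def)
      ultimately have "ev (PV (Inr j) * h) (case_sum (vec_nth lam) (vec_nth x)) = 0"
        using exc blowup_iff[OF x(1)] unfolding exceptional_def by blast
      then show "ev p z = 0" using h(2)[of "vec_nth x"] x(2) by (simp add: z_def)
    qed
    then obtain b where b0: "\<And>l. fps_nth (b l) 0 = z l" and van: "\<And>p. (\<forall>x\<in>X. ev p x = 0) \<Longrightarrow> peval fps_const p b = 0"
      and fb: "peval fps_const f b \<noteq> 0" "subdegree (peval fps_const f b) \<le> K" using K by blast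
    define W where "W = peval fps_const f b"
    define k where "k = subdegree W"
    have W: "W = peval fps_const (v j) (\<lambda>l. b (Inl l))" by (simp add: W_def f_def peval_subst)
    have vW: "peval fps_const (v i) (\<lambda>l. b (Inl l)) = b (Inr i) * W" for i
    proof -
      have "\<forall>x\<in>X. ev (peval PC (v i) (\<lambda>i. PV (Inl i)) - PV (Inr i) * f) x = 0"
        unfolding X_def vanish_on_chart_closure by (simp add: f_def chart_def)
      from van[OF this] show ?thesis by (simp add: peval_hom peval_subst W_def)
    qed
    have lam0: "poly_map v lam = 0" using exc by (simp add: exceptional_def zero_set_iff)
    have "fps_nth W 0 = peval (\<lambda>c. fps_nth (fps_const c) 0) (v j) (\<lambda>l. fps_nth (b (Inl l)) 0)"
      unfolding W by (rule peval_commute[OF rhom_fps_const rhom_fps_nth_0])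
    also have "\<dots> = ev (v j) (vec_nth lam)" by (simp add: b0 z_def cpoly_eval_peval)
    also have "\<dots> = 0" using lam0 by (simp add: poly_map_def vec_eq_iff)
    finally have k1: "k \<ge> 1" using fb(1) by (simp add: k_def W_def[symmetric] Suc_le_eq zero_less_iff_neq_zero subdegree_eq_0_iff)
    have Wk: "fps_nth W k \<noteq> 0" using fb(1) by (simp add: k_def W_def)
    \<comment> \<open>Truncation after order k gives a polynomial arc congruent to \<open>b\<close>
      modulo the power k + 1, so all v_i keep their coefficients up to the leading one.\<close>
    define t where "t l = (\<Sum>n\<le>k. monom (fps_nth (b (Inl l)) n) n)" for l
    have ct: "coeff (t l) n = (if n \<le> k then fps_nth (b (Inl l)) n else 0)" for l n
      by (simp add: t_def coeff_sum)
    have bt: "fps_X ^ Suc k dvd b (Inl l) - fps_of_poly (t l)" for l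
      by (subst fps_X_power_dvd_iff) (simp add: ct)
    define Q where "Q i = peval (\<lambda>c. [:c:]) (v i) t" for i
    have "fps_of_poly (Q i) = peval fps_const (v i) (\<lambda>l. fps_of_poly (t l))" for i
      unfolding Q_def by (subst peval_commute[OF rhom_pconst rhom_fps_of_poly]) (simp add: fps_of_poly_const)
    moreover have "fps_X ^ Suc k dvd peval fps_const (v i) (\<lambda>l. b (Inl l)) - peval fps_const (v i) (\<lambda>l. fps_of_poly (t l))" for i
      by (rule peval_diff_dvd[OF rhom_fps_const]) (rule bt)
    ultimately have "fps_X ^ Suc k dvd b (Inr i) * W - fps_of_poly (Q i)" for i
      by (simp only: vW)
    then have "fps_nth (b (Inr i) * W - fps_of_poly (Q i)) n = 0" if "n \<le> k" for i n
      using that by (subst (asm) fps_X_power_dvd_iff) auto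
    then have Qn: "coeff (Q i) n = fps_nth (b (Inr i) * W) n" if "n \<le> k" for i n
      using that by (simp only: fps_sub_nth fps_of_poly_nth right_minus_eq)
    have Wlow: "fps_nth W n = 0" if "n < k" for n
      using that unfolding k_def by (rule nth_less_subdegree_zero)
    have Qlow: "coeff (Q i) n = 0" if "n < k" for i n
    proof -
      have "fps_nth (b (Inr i) * W) n = (\<Sum>m=0..n. fps_nth (b (Inr i)) m * fps_nth W (n - m))" by (simp add: fps_mult_nth)
      also have "\<dots> = 0" using that by (intro sum.neutral ballI) (simp add: Wlow)
      finally show ?thesis using Qn[of n i] that by (simp only: less_imp_le)
    qed
    \<comment> \<open>\<open>W\<close> starts at order k, so only the constant term of
      \<open>b (Inr i)\<close> contributes: the leading vector is a multiple of
      \<open>x\<close>.\<close>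
    have Qk: "coeff (Q i) k = x $ i / x $ j * fps_nth W k" for i
    proof -
      have "fps_nth (b (Inr i) * W) k = (\<Sum>m=0..k. fps_nth (b (Inr i)) m * fps_nth W (k - m))" by (simp add: fps_mult_nth)
      also have "\<dots> = (\<Sum>m\<in>{0}. fps_nth (b (Inr i)) m * fps_nth W (k - m))"
        by (rule sum.mono_neutral_right) (auto intro: Wlow)
      finally show ?thesis using Qn[of k i] by (simp add: b0 z_def)
    qed
    have "\<forall>i. \<exists>q. Q i = monom 1 k * q" using Qlow by (auto simp: monom_1_dvd_iff' simp flip: dvd_def)
    then have "\<exists>q. \<forall>i. Q i = monom 1 k * q i" by (rule choice)
    then obtain q where q: "\<And>i. Q i = monom 1 k * q i" by blast
    have q0: "poly (q i) 0 = x $ i / x $ j * fps_nth W k" for i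
      using Qk[of i] by (simp add: q coeff_monom_mult poly_0_coeff_0)
    define g where "g = (\<lambda>\<epsilon>. \<chi> l. poly (t l) \<epsilon>)"
    define r where "r = (\<lambda>\<epsilon>. \<chi> i. poly (q i) \<epsilon>)"
    have r0: "r 0 = (fps_nth W k / x $ j) *s x" by (simp add: r_def q0 vec_eq_iff)
    then have r0n: "r 0 \<noteq> 0" using Wk x by simp
    have g0: "g 0 = lam" by (simp add: g_def vec_eq_iff ct b0 z_def poly_0_coeff_0)
    have "poly_map v (g \<epsilon>) = \<epsilon> ^ k *s r \<epsilon>" for \<epsilon>
    proof -
      have "ev (v i) (\<lambda>l. poly (t l) \<epsilon>) = poly (Q i) \<epsilon>" for i
        unfolding Q_def cpoly_eval_peval by (subst peval_commute[OF rhom_pconst rhom_poly]) simp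
      then show ?thesis by (simp add: poly_map_def g_def r_def vec_eq_iff cpoly_eval_vec_lambda q poly_monom)
    qed
    then have ev: "\<forall>\<^sub>F \<epsilon> in nhds 0. poly_map v (g \<epsilon>) = \<epsilon> ^ k *s r \<epsilon>" by simp
    have ar: "analytic_arc g" "analytic_arc r" unfolding g_def r_def by (rule analytic_arc_poly)+
    note arc = blowup_arc_of_lift[OF ar r0n k1 ev]
    have "proj_class (r 0) = proj_class x"
      using proj_class_eq_iff[OF x(1) r0n] r0 Wk x(2) by (metis divide_eq_0_iff)
    then have "point_order v (lam, proj_class x) \<le> enat k"
      unfolding point_order_def using arc(1,2) g0 by (intro Inf_lower) auto
    then show "point_order v (lam, proj_class x) \<le> enat K"
      using fb(2) by (metis W_def enat_ord_simps(1) k_def order_trans)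
  qed
qed

text \<open>Every exceptional point has a nonzero coordinate and so lies in one of finitely many
  charts; the sum of the chart bounds dominates each of them.\<close>

theorem fibre_order_bounded:
  fixes v :: "'N::finite \<Rightarrow> 'n::finite cpoly"
  shows "\<exists>K. \<forall>lam. fibre_order v lam \<le> enat K"
proof -
  have "\<forall>j. \<exists>K. \<forall>lam x. x \<noteq> 0 \<longrightarrow> x $ j \<noteq> 0 \<longrightarrow> (lam, proj_class x) \<in> exceptional v \<longrightarrow> point_order v (lam, proj_class x) \<le> enat K"
    using point_order_chart_bounded by blast
  then have "\<exists>K. \<forall>j. \<forall>lam x. x \<noteq> 0 \<longrightarrow> x $ j \<noteq> 0 \<longrightarrow> (lam, proj_class x) \<in> exceptional v \<longrightarrow> point_order v (lam, proj_class x) \<le> enat (K j)"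
    by (rule choice)
  then obtain K where K: "\<And>j lam x. x \<noteq> 0 \<Longrightarrow> x $ j \<noteq> 0 \<Longrightarrow> (lam, proj_class x) \<in> exceptional v \<Longrightarrow> point_order v (lam, proj_class x) \<le> enat (K j)"
    by blast
  have "point_order v P \<le> enat (\<Sum>j\<in>UNIV. K j)" if P: "P \<in> exceptional v" for P
  proof -
    obtain lam x where x: "P = (lam, proj_class x)" "x \<noteq> 0"
      using P blowup_cases[of P v] by (auto simp: exceptional_def)
    obtain j where "x $ j \<noteq> 0" using x(2) by (auto simp: vec_eq_iff)
    then have "point_order v P \<le> enat (K j)" using K x P by blast
    also have "\<dots> \<le> enat (\<Sum>j\<in>UNIV. K j)" by (simp add: member_le_sum)
    finally show ?thesis .
  qed
  then have "fibre_order v lam \<le> enat (\<Sum>j\<in>UNIV. K j)" for lam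
    unfolding fibre_order_def by (intro SUP_least) auto
  then show ?thesis by blast
qed

section \<open>Analytic germs and arcs\<close>

text \<open>Weierstrass M-test for unordered sums: the finite partial sums converge uniformly on
  small closed discs.\<close>

lemma holomorphic_on_infsum:
  fixes f :: "'i \<Rightarrow> complex \<Rightarrow> complex"
  assumes hol: "\<And>i. f i holomorphic_on ball 0 \<rho>" and bound: "\<And>i t. t \<in> ball 0 \<rho> \<Longrightarrow> cmod (f i t) \<le> M i"
    and M: "M summable_on UNIV" and sum: "\<And>t. t \<in> ball 0 \<rho> \<Longrightarrow> ((\<lambda>i. f i t) has_sum S t) UNIV"
  shows "S holomorphic_on ball 0 \<rho>"
proof -
  have "S field_differentiable at z" if z: "z \<in> ball 0 \<rho>" for z
  proof -
    obtain r where r: "r > 0" "cball z r \<subseteq> ball 0 \<rho>"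
      using z open_contains_cball[of "ball 0 \<rho>"] by (meson open_ball)
    have sub: "ball z r \<subseteq> ball 0 \<rho>" using r ball_subset_cball by blast
    have lim: "uniform_limit (cball z r) (\<lambda>X t. \<Sum>i\<in>X. f i t) S (finite_subsets_at_top UNIV)"
      by (rule Weierstrass_m_test_general'[OF _ _ M]) (use bound sum r in auto)
    have "continuous_on (cball z r) (\<lambda>t. \<Sum>i\<in>X. f i t) \<and> (\<lambda>t. \<Sum>i\<in>X. f i t) holomorphic_on ball z r" for X
      using hol holomorphic_on_subset[OF hol] r sub
      by (intro conjI continuous_intros holomorphic_intros) (auto intro: holomorphic_on_imp_continuous_on)
    then have "S holomorphic_on ball z r"
      using holomorphic_uniform_limit[OF _ lim] by (simp add: always_eventually finite_subsets_at_top_neq_bot) blast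
    then show ?thesis
      using r(1) by (auto intro: holomorphic_on_imp_differentiable_at)
  qed
  then show ?thesis by (simp add: holomorphic_on_def field_differentiable_at_within)
qed

lemma analytic_arc_near:
  fixes g :: "complex \<Rightarrow> complex^'n"
  assumes "analytic_arc g" "s > 0"
  shows "\<exists>\<rho>>0. \<forall>i. (\<lambda>t. g t $ i) holomorphic_on ball 0 \<rho> \<and> (\<forall>t\<in>ball 0 \<rho>. cmod (g t $ i - g 0 $ i) \<le> s)"
proof -
  have "\<forall>i. \<exists>\<rho>>0. (\<lambda>t. g t $ i) holomorphic_on ball 0 \<rho> \<and> (\<forall>t\<in>ball 0 \<rho>. cmod (g t $ i - g 0 $ i) \<le> s)"
  proof
    fix i
    have an: "(\<lambda>t. g t $ i) analytic_on {0}" using assms(1) by (simp add: analytic_arc_def)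
    then obtain \<rho>1 where \<rho>1: "\<rho>1 > 0" "(\<lambda>t. g t $ i) holomorphic_on ball 0 \<rho>1"
      by (auto simp: analytic_on_def)
    have "isCont (\<lambda>t. g t $ i) 0" using an by (rule analytic_at_imp_isCont)
    then obtain \<rho>2 where \<rho>2: "\<rho>2 > 0" "\<And>t. dist t 0 < \<rho>2 \<Longrightarrow> dist (g t $ i) (g 0 $ i) < s"
      using assms(2) unfolding continuous_at_eps_delta by blast
    show "\<exists>\<rho>>0. (\<lambda>t. g t $ i) holomorphic_on ball 0 \<rho> \<and> (\<forall>t\<in>ball 0 \<rho>. cmod (g t $ i - g 0 $ i) \<le> s)"
      using \<rho>1 \<rho>2 by (intro exI[of _ "min \<rho>1 \<rho>2"])
        (auto simp: dist_norm intro: holomorphic_on_subset less_imp_le)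
  qed
  then have "\<exists>\<rho>. \<forall>i. \<rho> i > 0 \<and> (\<lambda>t. g t $ i) holomorphic_on ball 0 (\<rho> i) \<and> (\<forall>t\<in>ball 0 (\<rho> i). cmod (g t $ i - g 0 $ i) \<le> s)"
    by (rule choice)
  then obtain \<rho> where \<rho>: "\<And>i. \<rho> i > 0" "\<And>i. (\<lambda>t. g t $ i) holomorphic_on ball 0 (\<rho> i)" "\<And>i t. t \<in> ball 0 (\<rho> i) \<Longrightarrow> cmod (g t $ i - g 0 $ i) \<le> s"
    by blast
  have le: "Min (range \<rho>) \<le> \<rho> i" for i by simp
  have sub: "ball 0 (Min (range \<rho>)) \<subseteq> ball (0 :: complex) (\<rho> i)" for i using le[of i] by (rule subset_ball)
  have "Min (range \<rho>) > 0" using \<rho>(1) by simp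
  then show ?thesis
    using \<rho>(2,3) sub by (intro exI[of _ "Min (range \<rho>)"]) (blast intro: holomorphic_on_subset)
qed

lemma cmod_monom_val_le:
  assumes "\<And>i. cmod (x i) \<le> s"
  shows "cmod (monom_val x m) \<le> cmod (monom_val (\<lambda>_. of_real s) m)"
  unfolding monom_val_def prod_norm[symmetric] norm_power
  using assms by (intro prod_mono conjI power_mono) (auto intro: order_trans[OF _ abs_ge_self])

lemma in_ball_of_coordinates:
  fixes x a :: "complex^'n"
  assumes "\<And>i. cmod (x $ i - a $ i) \<le> s" "real CARD('n) * s < r"
  shows "x \<in> ball a r"
proof -
  have "norm (x - a) \<le> (\<Sum>i\<in>UNIV. cmod ((x - a) $ i))"
    unfolding norm_vec_def by (rule L2_set_le_sum) auto
  also have "\<dots> \<le> (\<Sum>i\<in>(UNIV::'n set). s)" by (intro sum_mono) (use assms in auto)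
  finally show ?thesis using assms(2) by (simp add: dist_norm norm_minus_commute)
qed

lemma ex_small_coordinate: "r > 0 \<Longrightarrow> \<exists>s>0. s < r \<and> real CARD('n::finite) * s < (r::real)"
  by (intro exI[of _ "r / (real CARD('n) + 1)"]) (auto simp: field_simps)

lemma monom_val_arc_holomorphic:
  "(\<And>i. (\<lambda>t. x t i) holomorphic_on A) \<Longrightarrow> (\<lambda>t. monom_val (x t) m) holomorphic_on A"
  unfolding monom_val_def by (intro holomorphic_intros)

text \<open>The series converges absolutely at the corner a + (s, ..., s), and its terms there
  majorize those along an arc that stays in the polydisc of radius s.\<close>

lemma analytic_germ_compose:
  fixes f :: "complex^'n \<Rightarrow> complex"
  assumes "analytic_germ f (g 0)" "analytic_arc g"
  shows "(\<lambda>t. f (g t)) analytic_on {0}"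
proof -
  let ?a = "g 0"
  obtain c r where r: "r > 0" and c: "\<And>x. x \<in> ball ?a r \<Longrightarrow> ((\<lambda>m. c m * monom_val (vec_nth (x - ?a)) m) has_sum f x) UNIV"
    using assms(1) unfolding analytic_germ_def by blast
  obtain s where s: "s > 0" "real CARD('n) * s < r" using ex_small_coordinate[OF r, where 'n = 'n] by blast
  obtain \<rho> where \<rho>: "\<rho> > 0" "\<And>i. (\<lambda>t. g t $ i) holomorphic_on ball 0 \<rho>" "\<And>i t. t \<in> ball 0 \<rho> \<Longrightarrow> cmod (g t $ i - ?a $ i) \<le> s"
    using analytic_arc_near[OF assms(2) s(1)] by blast
  have "?a + vec_lambda (\<lambda>_. of_real s) \<in> ball ?a r"
    by (rule in_ball_of_coordinates[OF _ s(2)]) (use s in simp)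
  from c[OF this] have "((\<lambda>m. c m * monom_val (\<lambda>_. of_real s) m) has_sum f (?a + vec_lambda (\<lambda>_. of_real s))) UNIV"
    by (simp add: vec_lambda_inverse)
  then have "(\<lambda>m. c m * monom_val (\<lambda>_. of_real s) m) summable_on UNIV" by (auto simp: summable_on_def)
  then have M: "(\<lambda>m. cmod (c m * monom_val (\<lambda>_. of_real s) m)) summable_on UNIV"
    by (simp add: summable_on_iff_abs_summable_on_complex)
  have "(\<lambda>t. f (g t)) holomorphic_on ball 0 \<rho>"
  proof (rule holomorphic_on_infsum[OF _ _ M])
    show "(\<lambda>t. c m * monom_val (vec_nth (g t - ?a)) m) holomorphic_on ball 0 \<rho>" for m
      by (intro holomorphic_intros monom_val_arc_holomorphic) (simp, intro holomorphic_intros \<rho>)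
    show "cmod (c m * monom_val (vec_nth (g t - ?a)) m) \<le> cmod (c m * monom_val (\<lambda>_. of_real s) m)" if "t \<in> ball 0 \<rho>" for m t
      unfolding norm_mult by (intro mult_left_mono cmod_monom_val_le) (use \<rho>(3)[OF that] in auto)
    show "((\<lambda>m. c m * monom_val (vec_nth (g t - ?a)) m) has_sum f (g t)) UNIV" if "t \<in> ball 0 \<rho>" for t
      by (intro c in_ball_of_coordinates[OF _ s(2)] \<rho> that)
  qed
  then show ?thesis using \<rho>(1) by (intro holomorphic_on_imp_analytic_at[of _ "ball 0 \<rho>"]) auto
qed

lemma analytic_germ_poly: "analytic_germ (\<lambda>x. ev p (vec_nth x)) a"
proof -
  define p' where "p' = peval PC p (\<lambda>i. PV i + PC (a $ i))"
  have "((\<lambda>m. lookup p' m * monom_val (vec_nth (x - a)) m) has_sum ev p (vec_nth x)) UNIV" for x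
  proof -
    have "ev p (vec_nth x) = ev p' (vec_nth (x - a))" by (simp add: p'_def)
    then have "((\<lambda>m. lookup p' m * monom_val (vec_nth (x - a)) m) has_sum ev p (vec_nth x)) (keys p')"
      by (simp add: cpoly_eval_def)
    then show ?thesis
      by (subst (asm) has_sum_cong_neutral[where T = UNIV and g = "\<lambda>m. lookup p' m * monom_val (vec_nth (x - a)) m"])
        (auto simp: in_keys_iff)
  qed
  then show ?thesis unfolding analytic_germ_def by (intro exI[of _ "lookup p'"] exI[of _ 1]) auto
qed

lemma germ_ideal_generator:
  assumes "analytic_germ (P j) a"
  shows "P j \<in> germ_ideal a (range P)"
proof -
  have "analytic_germ (\<lambda>x. 1) a" using analytic_germ_poly[of 1 a] by simp
  then show ?thesis
    unfolding germ_ideal_def using assms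
    by (intro CollectI conjI exI[of _ "{P j}"] exI[of _ "\<lambda>_ _. 1"]) auto
qed

text \<open>Sums in \<open>germ_ideal\<close> run over functions, so equal generators are merged;
  one index is chosen for each function.\<close>

lemma germ_ideal_indexed:
  assumes "f \<in> germ_ideal a (range P)"
  shows "\<exists>J c. finite J \<and> (\<forall>j\<in>J. analytic_germ (c j) a) \<and> (\<forall>\<^sub>F x in nhds a. f x = (\<Sum>j\<in>J. c j x * P j x))"
proof -
  obtain S c where S: "finite S" "S \<subseteq> range P" "\<forall>g\<in>S. analytic_germ (c g) a" "\<forall>\<^sub>F x in nhds a. f x = (\<Sum>g\<in>S. c g x * g x)"
    using assms unfolding germ_ideal_def by blast
  then obtain J where J: "inj_on P J" "S = P ` J" using subset_image_inj[of S P UNIV] by auto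
  then have "finite J" using S(1) finite_image_iff by blast
  moreover have "(\<Sum>g\<in>S. c g x * g x) = (\<Sum>j\<in>J. c (P j) x * P j x)" for x
    using J by (simp add: sum.reindex)
  ultimately show ?thesis using S(3,4) J by (intro exI[of _ J] exI[of _ "\<lambda>j. c (P j)"]) auto
qed

section \<open>Leading coefficients along arcs\<close>

lemma leading_coeff_tendsto:
  assumes "(\<lambda>t. f t - t ^ k * b) \<in> O[at 0](\<lambda>t. t ^ (k + 1))"
  shows "((\<lambda>t. f t / t ^ k) \<longlongrightarrow> (b::complex)) (at 0)"
proof -
  obtain c where "eventually (\<lambda>t. cmod (f t - t ^ k * b) \<le> c * cmod (t ^ (k + 1))) (at 0)"
    using assms by (elim landau_o.bigE)
  then have "eventually (\<lambda>t. cmod (f t / t ^ k - b) \<le> c * cmod t) (at 0)"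
    using eventually_neq_at_within[of 0 0 UNIV]
  proof eventually_elim
    case (elim t)
    have "(f t / t ^ k - b) * t ^ k = f t - t ^ k * b" using elim(2) by (simp add: field_simps)
    then have "cmod (f t / t ^ k - b) * cmod (t ^ k) \<le> c * cmod t * cmod (t ^ k)"
      using elim(1) by (simp add: norm_mult[symmetric] mult.assoc del: norm_power)
    then show ?case using elim by simp
  qed
  moreover have "((\<lambda>t. c * cmod t) \<longlongrightarrow> 0) (at (0::complex))"
    by (auto intro!: tendsto_eq_intros)
  ultimately have "((\<lambda>t. f t / t ^ k - b) \<longlongrightarrow> 0) (at 0)" by (rule Lim_null_comparison)
  then show ?thesis by (simp add: Lim_null[symmetric])
qed

lemma tendsto_lower_order:
  assumes "((\<lambda>t. f t / t ^ k) \<longlongrightarrow> (b::complex)) (at 0)" "l < k"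
  shows "((\<lambda>t. f t / t ^ l) \<longlongrightarrow> 0) (at 0)"
proof -
  have "((\<lambda>t. t ^ (k - l) * (f t / t ^ k)) \<longlongrightarrow> 0 ^ (k - l) * b) (at 0)"
    by (intro tendsto_intros assms)
  moreover have "eventually (\<lambda>t. t ^ (k - l) * (f t / t ^ k) = f t / t ^ l) (at 0)"
    using eventually_neq_at_within[of 0 0 UNIV]
  proof eventually_elim
    case (elim t)
    have "t ^ k = t ^ (k - l) * t ^ l" using assms(2) by (simp flip: power_add)
    then show ?case using elim by simp
  qed
  ultimately show ?thesis using assms(2) by (auto intro: Lim_transform_eventually simp: power_0_left)
qed

text \<open>The exponent k is the least order among the components; a component attaining it makes
  q(0) nonzero.\<close>

lemma analytic_arc_factor:
  fixes \<phi> :: "complex \<Rightarrow> complex^'n"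
  assumes an: "analytic_arc \<phi>" and nz: "\<not> (\<forall>\<^sub>F t in nhds 0. \<phi> t = 0)"
  shows "\<exists>k q. analytic_arc q \<and> q 0 \<noteq> 0 \<and> (\<forall>\<^sub>F t in nhds 0. \<phi> t = t ^ k *s q t)"
proof -
  define G where "G i = fps_expansion (\<lambda>t. \<phi> t $ i) 0" for i
  have G: "(\<lambda>t. \<phi> t $ i) has_fps_expansion G i" for i
    unfolding G_def by (rule analytic_at_imp_has_fps_expansion_0) (use an in \<open>simp add: analytic_arc_def\<close>)
  define N where "N = {i. G i \<noteq> 0}"
  have "N \<noteq> {}"
  proof
    assume "N = {}"
    then have "\<forall>\<^sub>F t in nhds 0. \<phi> t $ i = 0" for i using G[of i] by (simp add: N_def has_fps_expansion_0_iff)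
    then have "\<forall>\<^sub>F t in nhds 0. \<forall>i. \<phi> t $ i = 0" by (simp add: eventually_all_finite)
    then show False using nz by (simp add: vec_eq_iff)
  qed
  define k where "k = Min ((\<lambda>i. subdegree (G i)) ` N)"
  have k: "k \<le> subdegree (G i)" if "i \<in> N" for i unfolding k_def using that by simp
  have "k \<in> (\<lambda>i. subdegree (G i)) ` N" unfolding k_def using \<open>N \<noteq> {}\<close> by (intro Min_in) auto
  then obtain i0 where i0: "G i0 \<noteq> 0" "subdegree (G i0) = k" by (auto simp: N_def)
  \<comment> \<open>The value at 0 is the one that removes the singularity of the quotient.\<close>
  define q where "q = (\<lambda>t. \<chi> i. if t = 0 then fps_nth (G i) k else \<phi> t $ i / t ^ k)"
  have "(\<lambda>t. q t $ i) analytic_on {0}" for i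
  proof (cases "i \<in> N")
    case True
    have "(\<lambda>t. if t = 0 then fps_nth (G i) k else \<phi> t $ i / t ^ k) has_fps_expansion fps_shift k (G i)"
      by (rule has_fps_expansion_shift[OF G k[OF True] refl])
    then show ?thesis unfolding q_def by (simp add: has_fps_expansion_imp_analytic_0)
  next
    case False
    then have G0: "G i = 0" by (simp add: N_def)
    then have ev: "\<forall>\<^sub>F t in nhds 0. \<phi> t $ i = 0" using G[of i] by (simp add: has_fps_expansion_0_iff)
    have "\<forall>\<^sub>F t in nhds 0. q t $ i = 0" using ev by eventually_elim (simp add: q_def G0)
    then show ?thesis by (subst analytic_at_cong[of _ "\<lambda>_. 0"]) auto
  qed
  moreover have "q 0 $ i0 \<noteq> 0" using i0 by (auto simp: q_def)
  moreover have "\<forall>\<^sub>F t in nhds 0. \<phi> t = t ^ k *s q t"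
  proof -
    \<comment> \<open>At t = 0 the factor \<open>0 ^ k\<close> is 1 for k = 0; for positive k all
      components vanish at 0.\<close>
    have "\<phi> 0 $ i = 0 ^ k * fps_nth (G i) k" for i
    proof -
      have "fps_nth (G i) 0 = \<phi> 0 $ i" using fps_nth_fps_expansion[OF G[of i], of 0] by simp
      moreover have "fps_nth (G i) 0 = 0" if "k \<noteq> 0"
      proof (cases "i \<in> N")
        case True
        then have "0 < subdegree (G i)" using k[OF True] that by linarith
        then show ?thesis by (rule nth_less_subdegree_zero)
      qed (simp add: N_def)
      ultimately show ?thesis by (cases "k = 0") auto
    qed
    then have "\<phi> t = t ^ k *s q t" for t by (cases "t = 0") (auto simp: vec_eq_iff q_def)
    then show ?thesis by simp
  qed
  ultimately show ?thesis by (intro exI[of _ k] exI[of _ q]) (auto simp: analytic_arc_def)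
qed

section \<open>Bifurcation functions\<close>

text \<open>Absolute convergence of the double series at the corner of a polydisc allows summing
  over \<open>m\<close> first. The row sums are the Taylor coefficients in h, with a Cauchy estimate
  B / s^k uniform in x; the uniformity later permits summation over k along an arc.\<close>

lemma analytic_germ2_taylor:
  fixes F :: "complex \<Rightarrow> complex^'n \<Rightarrow> complex"
  assumes "analytic_germ2 F h0 a"
  shows "\<exists>s>0. \<exists>B c. (\<forall>k. (\<lambda>m. cmod (c k m * monom_val (\<lambda>_. of_real s) m)) summable_on UNIV) \<and>
     (\<forall>x. (\<forall>i. cmod (x $ i - a $ i) \<le> s) \<longrightarrow>
        (\<forall>k. ((\<lambda>m. c k m * monom_val (vec_nth (x - a)) m) has_sum taylor_coeff F h0 k x) UNIV \<and>
             cmod (taylor_coeff F h0 k x) \<le> B / s ^ k) \<and>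
        (\<forall>h. cmod (h - h0) < s \<longrightarrow> (\<lambda>k. taylor_coeff F h0 k x * (h - h0) ^ k) sums F h x))"
proof -
  obtain c r where r: "r > 0" and c: "\<And>h x. h \<in> ball h0 r \<Longrightarrow> x \<in> ball a r \<Longrightarrow>
      ((\<lambda>(k, m). c k m * (h - h0) ^ k * monom_val (vec_nth (x - a)) m) has_sum F h x) UNIV"
    using assms unfolding analytic_germ2_def by blast
  obtain s where s: "s > 0" "s < r" "real CARD('n) * s < r" using ex_small_coordinate[OF r, where 'n = 'n] by blast
  let ?ms = "\<lambda>m. monom_val (\<lambda>_. of_real s :: complex) m"
  have "h0 + of_real s \<in> ball h0 r" using s by (simp add: dist_norm)
  moreover have "a + vec_lambda (\<lambda>_. of_real s) \<in> ball a r"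
    by (rule in_ball_of_coordinates[OF _ s(3)]) (use s in simp)
  ultimately have "((\<lambda>(k, m). c k m * of_real s ^ k * ?ms m) has_sum F (h0 + of_real s) (a + vec_lambda (\<lambda>_. of_real s))) UNIV"
    using c[of "h0 + of_real s" "a + vec_lambda (\<lambda>_. of_real s)"] by (simp add: vec_lambda_inverse)
  then have "(\<lambda>(k, m). c k m * of_real s ^ k * ?ms m) summable_on UNIV" by (auto simp: summable_on_def)
  then have W: "(\<lambda>p. cmod (case p of (k, m) \<Rightarrow> c k m * of_real s ^ k * ?ms m)) summable_on UNIV"
    by (simp add: summable_on_iff_abs_summable_on_complex)
  then have W': "(\<lambda>(k, m). cmod (c k m * of_real s ^ k * ?ms m)) summable_on UNIV \<times> UNIV"
    by (simp add: case_prod_unfold)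
  define B where "B = (\<Sum>\<^sub>\<infinity>(k, m)\<in>UNIV \<times> UNIV. cmod (c k m * of_real s ^ k * ?ms m))"
  have Wk: "(\<lambda>m. cmod (c k m * of_real s ^ k * ?ms m)) summable_on UNIV" for k
    using summable_on_SigmaD1[OF W', of k] by simp
  define b where "b k = (\<Sum>\<^sub>\<infinity>m. cmod (c k m * of_real s ^ k * ?ms m))" for k
  have b: "((\<lambda>m. cmod (c k m * of_real s ^ k * ?ms m)) has_sum b k) UNIV" for k
    using Wk by (simp add: b_def)
  have bsum: "(b has_sum B) UNIV"
  proof (rule has_sum_SigmaD)
    show "((\<lambda>(k, m). cmod (c k m * of_real s ^ k * ?ms m)) has_sum B) (UNIV \<times> UNIV)"
      unfolding B_def using W' by (rule has_sum_infsum)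
  qed (use b in simp)
  have b0: "b k \<ge> 0" for k using b by (rule has_sum_nonneg) auto
  have bB: "b k \<le> B" for k
    using finite_sum_le_has_sum[OF bsum, of "{k}"] b0 by simp
  have sum_s: "(\<lambda>m. cmod (c k m * ?ms m)) summable_on UNIV" for k
  proof -
    have "(\<lambda>m. s ^ k * cmod (c k m * ?ms m)) summable_on UNIV"
      using Wk[of k] s(1) by (simp add: norm_mult norm_power mult_ac)
    then show ?thesis using s(1) by (subst (asm) summable_on_cmult_right') auto
  qed
  define T where "T k x = (\<Sum>\<^sub>\<infinity>m. c k m * monom_val (vec_nth (x - a)) m)" for k and x :: "complex^'n"
  have main: "((\<lambda>m. c k m * monom_val (vec_nth (x - a)) m) has_sum T k x) UNIV \<and> cmod (T k x) \<le> B / s ^ k \<and>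
      (cmod (h - h0) < s \<longrightarrow> (\<lambda>k. T k x * (h - h0) ^ k) sums F h x)"
    if x: "\<forall>i. cmod (x $ i - a $ i) \<le> s" for x k h
  proof -
    have le: "cmod (c k m * monom_val (vec_nth (x - a)) m) \<le> cmod (c k m * ?ms m)" for k m
      unfolding norm_mult by (intro mult_left_mono cmod_monom_val_le) (use x in auto)
    have abs: "(\<lambda>m. cmod (c k m * monom_val (vec_nth (x - a)) m)) summable_on UNIV" for k
      by (rule summable_on_comparison_test[OF sum_s le]) auto
    have 1: "((\<lambda>m. c k m * monom_val (vec_nth (x - a)) m) has_sum T k x) UNIV" for k
      unfolding T_def by (rule has_sum_infsum[OF abs_summable_summable[OF abs]])
    have "cmod (T k x) \<le> (\<Sum>\<^sub>\<infinity>m. cmod (c k m * monom_val (vec_nth (x - a)) m))"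
      unfolding T_def by (rule norm_infsum_bound[OF abs])
    also have "\<dots> \<le> (\<Sum>\<^sub>\<infinity>m. cmod (c k m * ?ms m))" by (rule infsum_mono[OF abs sum_s le])
    also have "\<dots> = b k / s ^ k"
    proof -
      have "b k = (\<Sum>\<^sub>\<infinity>m. s ^ k * cmod (c k m * ?ms m))"
        unfolding b_def using s(1) by (intro infsum_cong) (simp add: norm_mult norm_power mult_ac)
      also have "\<dots> = s ^ k * (\<Sum>\<^sub>\<infinity>m. cmod (c k m * ?ms m))" by (rule infsum_cmult_right')
      finally show ?thesis using s(1) by simp
    qed
    also have "\<dots> \<le> B / s ^ k" using bB s(1) by (intro divide_right_mono) auto
    finally have 2: "cmod (T k x) \<le> B / s ^ k" .
    have 3: "(\<lambda>k. T k x * (h - h0) ^ k) sums F h x" if h: "cmod (h - h0) < s"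
    proof (rule has_sum_imp_sums, rule has_sum_SigmaD)
      have "h \<in> ball h0 r" using h s by (simp add: dist_norm norm_minus_commute)
      moreover have "x \<in> ball a r" using x by (intro in_ball_of_coordinates[OF _ s(3)]) auto
      ultimately show "((\<lambda>(k, m). c k m * (h - h0) ^ k * monom_val (vec_nth (x - a)) m) has_sum F h x) (UNIV \<times> UNIV)"
        using c by simp
      show "((\<lambda>m. case (k, m) of (k, m) \<Rightarrow> c k m * (h - h0) ^ k * monom_val (vec_nth (x - a)) m) has_sum T k x * (h - h0) ^ k) UNIV" for k
        using has_sum_cmult_left[OF 1[of k], where c = "(h - h0) ^ k"] by (simp add: mult_ac)
    qed
    show ?thesis using 1 2 3 by blast
  qed
  \<comment> \<open>The row sums are the coefficients of a power series representing
    \<open>F\<close> in h, and such coefficients are unique.\<close>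
  have T: "T k x = taylor_coeff F h0 k x" if x: "\<forall>i. cmod (x $ i - a $ i) \<le> s" for k x
  proof -
    have "\<forall>\<^sub>F u in nhds 0. (\<lambda>k. fps_nth (Abs_fps (\<lambda>k. T k x)) k * u ^ k) sums F (h0 + u) x"
      using eventually_nhds_in_open[of "ball 0 s" "0 :: complex"] s(1)
    proof (simp, elim eventually_mono)
      fix u :: complex assume "cmod u < s"
      then show "(\<lambda>k. T k x * u ^ k) sums F (h0 + u) x" using main[OF x, of _ "h0 + u"] by simp
    qed
    then have "(\<lambda>u. F (h0 + u) x) has_fps_expansion Abs_fps (\<lambda>k. T k x)" by (rule has_fps_expansionI)
    from fps_nth_fps_expansion[OF this, of k] have "T k x = (deriv ^^ k) (\<lambda>u. F (h0 + u) x) 0 / fact k" by simp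
    also have "(deriv ^^ k) (\<lambda>u. F (h0 + u) x) 0 = (deriv ^^ k) (\<lambda>h. F h x) h0"
      by (subst (2) higher_deriv_shift_0) (simp add: o_def)
    finally show ?thesis by (simp add: taylor_coeff_def)
  qed
  have "(\<forall>k. ((\<lambda>m. c k m * monom_val (vec_nth (x - a)) m) has_sum taylor_coeff F h0 k x) UNIV \<and>
             cmod (taylor_coeff F h0 k x) \<le> B / s ^ k) \<and>
        (\<forall>h. cmod (h - h0) < s \<longrightarrow> (\<lambda>k. taylor_coeff F h0 k x * (h - h0) ^ k) sums F h x)"
    if x: "\<forall>i. cmod (x $ i - a $ i) \<le> s" for x
    using main[OF x] by (simp add: T[OF x])
  then show ?thesis using s(1) sum_s by (intro exI[of _ s] conjI exI[of _ B] exI[of _ c]) auto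
qed

lemma leading_coeff_vanishes:
  assumes "(\<lambda>t. f t - t ^ k * b) \<in> O[at 0](\<lambda>t. t ^ (k + 1))" "(\<lambda>t. f t - t ^ l * c) \<in> O[at 0](\<lambda>t. t ^ (l + 1))" "l < k"
  shows "c = (0 :: complex)"
  using tendsto_lower_order[OF leading_coeff_tendsto[OF assms(1)] assms(3)] leading_coeff_tendsto[OF assms(2)]
  by (rule LIM_unique[symmetric])

lemma leading_coeff_unique:
  assumes "(\<lambda>t. f t - t ^ k * b) \<in> O[at 0](\<lambda>t. t ^ (k + 1))" "(\<lambda>t. f t - t ^ k * c) \<in> O[at 0](\<lambda>t. t ^ (k + 1))"
  shows "b = (c :: complex)"
  using leading_coeff_tendsto[OF assms(1)] leading_coeff_tendsto[OF assms(2)] by (rule LIM_unique)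

lemma analytic_arc_filterlim:
  assumes "analytic_arc g"
  shows "filterlim g (nhds (g 0)) (nhds 0)"
proof -
  have "(g \<longlongrightarrow> g 0) (at 0)" by (rule vec_tendstoI) (rule analytic_arc_tendsto[OF assms])
  then show ?thesis by (simp add: tendsto_at_iff_tendsto_nhds)
qed

text \<open>The functions \<open>C k j\<close> express the Taylor coefficients of \<open>F\<close>
  through the v_j, which is one inclusion between the two germ ideals.\<close>

locale displacement_germ =
  fixes F :: "complex \<Rightarrow> complex^'n \<Rightarrow> complex" and h0 :: complex and a :: "complex^'n"
    and v :: "'N::finite \<Rightarrow> 'n cpoly" and J :: "nat \<Rightarrow> 'N set" and C :: "nat \<Rightarrow> 'N \<Rightarrow> complex^'n \<Rightarrow> complex"
  assumes germ2: "analytic_germ2 F h0 a"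
    and C_germ: "\<And>k j. j \<in> J k \<Longrightarrow> analytic_germ (C k j) a"
    and C_eq: "\<And>k. \<forall>\<^sub>F x in nhds a. taylor_coeff F h0 k x = (\<Sum>j\<in>J k. C k j x * ev (v j) (vec_nth x))"
begin

text \<open>Taylor coefficient at \<open>h0\<close> of the bifurcation function of an arc. It
  depends on the arc only through the leading vector \<open>p\<close> of v along it, and
  linearly.\<close>

definition arc_coeff :: "complex^'N \<Rightarrow> nat \<Rightarrow> complex" where
  "arc_coeff p k = (\<Sum>j\<in>J k. C k j a * p $ j)"

definition arc_function :: "complex^'N \<Rightarrow> complex \<Rightarrow> complex" where
  "arc_function p h = suminf (\<lambda>k. arc_coeff p k * (h - h0) ^ k)"

lemma taylor_coeff_arc:
  assumes g: "analytic_arc g" "g 0 = a" and q: "analytic_arc q"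
    and eq: "\<forall>\<^sub>F t in nhds 0. poly_map v (g t) = t ^ K *s q t"
  shows "\<exists>w. w analytic_on {0} \<and> w 0 = arc_coeff (q 0) k \<and> (\<forall>\<^sub>F t in nhds 0. taylor_coeff F h0 k (g t) = t ^ K * w t)"
proof (intro exI conjI)
  define w where "w t = (\<Sum>j\<in>J k. C k j (g t) * q t $ j)" for t
  show "w analytic_on {0}"
    unfolding w_def
  proof (intro analytic_on_sum analytic_on_mult)
    show "(\<lambda>t. C k j (g t)) analytic_on {0}" if "j \<in> J k" for j
      by (rule analytic_germ_compose) (use C_germ[OF that] g in auto)
    show "(\<lambda>t. q t $ j) analytic_on {0}" for j using q by (simp add: analytic_arc_def)
  qed
  show "w 0 = arc_coeff (q 0) k" by (simp add: w_def arc_coeff_def g)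
  have "\<forall>\<^sub>F t in nhds 0. taylor_coeff F h0 k (g t) = (\<Sum>j\<in>J k. C k j (g t) * ev (v j) (vec_nth (g t)))"
    using eventually_compose_filterlim[OF C_eq analytic_arc_filterlim[OF g(1), unfolded g(2)]] .
  then show "\<forall>\<^sub>F t in nhds 0. taylor_coeff F h0 k (g t) = t ^ K * w t"
    using eq
  proof eventually_elim
    case (elim t)
    have "ev (v j) (vec_nth (g t)) = t ^ K * q t $ j" for j
      using elim(2) by (simp add: poly_map_def vec_eq_iff)
    then show ?case by (simp add: elim(1) w_def sum_distrib_left mult_ac)
  qed
qed

text \<open>Each Taylor coefficient is divisible by t^K along the arc, but a priori only on a disc
  depending on k. The uniform estimate on one circle and the maximum principle bound all quotients
  by B' / s^k on a common disc, so that they can be summed.\<close>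

lemma expansion:
  assumes g: "analytic_arc g" "g 0 = a" and q: "analytic_arc q"
    and eq: "\<forall>\<^sub>F t in nhds 0. poly_map v (g t) = t ^ K *s q t"
  shows "\<forall>\<^sub>F h in nhds h0. (\<lambda>t. F h (g t) - t ^ K * arc_function (q 0) h) \<in> O[at 0](\<lambda>t. t ^ (K + 1))"
    and "\<exists>s>0. \<exists>B. \<forall>k. cmod (arc_coeff (q 0) k) \<le> B / s ^ k"
proof -
  obtain s B c where s: "s > 0" and sum_s: "\<And>k. (\<lambda>m. cmod (c k m * monom_val (\<lambda>_. of_real s) m)) summable_on UNIV"
    and T: "\<And>x k. (\<forall>i. cmod (x $ i - a $ i) \<le> s) \<Longrightarrow> ((\<lambda>m. c k m * monom_val (vec_nth (x - a)) m) has_sum taylor_coeff F h0 k x) UNIV"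
    and TB: "\<And>x k. (\<forall>i. cmod (x $ i - a $ i) \<le> s) \<Longrightarrow> cmod (taylor_coeff F h0 k x) \<le> B / s ^ k"
    and TF: "\<And>x h. (\<forall>i. cmod (x $ i - a $ i) \<le> s) \<Longrightarrow> cmod (h - h0) < s \<Longrightarrow> (\<lambda>k. taylor_coeff F h0 k x * (h - h0) ^ k) sums F h x"
    using analytic_germ2_taylor[OF germ2] by blast
  obtain \<rho> where \<rho>: "\<rho> > 0" "\<And>i. (\<lambda>t. g t $ i) holomorphic_on ball 0 \<rho>" "\<And>i t. t \<in> ball 0 \<rho> \<Longrightarrow> cmod (g t $ i - a $ i) \<le> s"
    using analytic_arc_near[OF g(1) s] g(2) by auto
  define D where "D k t = taylor_coeff F h0 k (g t)" for k t
  have D_hol: "D k holomorphic_on ball 0 \<rho>" for k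
  proof (rule holomorphic_on_infsum[OF _ _ sum_s[of k]])
    show "(\<lambda>t. c k m * monom_val (vec_nth (g t - a)) m) holomorphic_on ball 0 \<rho>" for m
      by (intro holomorphic_intros monom_val_arc_holomorphic) (simp, intro holomorphic_intros \<rho>)
    show "cmod (c k m * monom_val (vec_nth (g t - a)) m) \<le> cmod (c k m * monom_val (\<lambda>_. of_real s) m)" if "t \<in> ball 0 \<rho>" for m t
      unfolding norm_mult by (intro mult_left_mono cmod_monom_val_le) (use \<rho>(3)[OF that] in auto)
    show "((\<lambda>m. c k m * monom_val (vec_nth (g t - a)) m) has_sum D k t) UNIV" if "t \<in> ball 0 \<rho>" for t
      unfolding D_def by (rule T) (use \<rho>(3)[OF that] in auto)
  qed
  \<comment> \<open>The value at 0 fills the removable singularity, as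
    \<open>taylor_coeff_arc\<close> shows.\<close>
  define u where "u k t = (if t = 0 then arc_coeff (q 0) k else D k t / t ^ K)" for k t
  have u_diff: "u k field_differentiable at z" if z: "z \<in> ball 0 \<rho>" for k z
  proof (cases "z = 0")
    case True
    obtain w where w: "w analytic_on {0}" "w 0 = arc_coeff (q 0) k" "\<forall>\<^sub>F t in nhds 0. D k t = t ^ K * w t"
      using taylor_coeff_arc[OF g q eq, of k] unfolding D_def by blast
    have "\<forall>\<^sub>F t in nhds 0. u k t = w t" using w(3) by eventually_elim (auto simp: u_def w(2))
    then have "u k analytic_on {0}" using w(1) by (subst analytic_at_cong[of _ w]) auto
    then show ?thesis using True by (simp add: analytic_on_imp_differentiable_at)
  next
    case False
    have "(\<lambda>t. D k t / t ^ K) holomorphic_on ball 0 \<rho> - {0}"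
      by (intro holomorphic_intros holomorphic_on_subset[OF D_hol]) auto
    then have "u k holomorphic_on ball 0 \<rho> - {0}" by (rule holomorphic_transform) (simp add: u_def)
    then show ?thesis by (rule holomorphic_on_imp_differentiable_at) (use z False in auto)
  qed
  then have u_hol: "u k holomorphic_on ball 0 \<rho>" for k
    by (simp add: holomorphic_on_def field_differentiable_at_within)
  define R where "R = \<rho> / 2"
  have R: "R > 0" "cball 0 R \<subseteq> ball (0 :: complex) \<rho>" using \<rho>(1) by (auto simp: R_def)
  define B' where "B' = B / R ^ K"
  have u_bound: "cmod (u k t) \<le> B' / s ^ k" if "t \<in> cball 0 R" for k t
  proof (rule maximum_modulus_frontier[where S = "cball 0 R" and f = "u k" and \<xi> = t])
    show "u k holomorphic_on interior (cball 0 R)"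
      using R ball_subset_cball by (intro holomorphic_on_subset[OF u_hol]) auto
    show "continuous_on (closure (cball 0 R)) (u k)"
      using R by (intro holomorphic_on_imp_continuous_on holomorphic_on_subset[OF u_hol]) auto
    fix z :: complex assume "z \<in> frontier (cball 0 R)"
    then have z: "cmod z = R" by simp
    then have "z \<in> ball 0 \<rho>" "z \<noteq> 0" using R by auto
    moreover have "cmod (D k z) \<le> B / s ^ k" unfolding D_def by (rule TB) (use \<rho>(3) \<open>z \<in> ball 0 \<rho>\<close> in auto)
    ultimately show "cmod (u k z) \<le> B' / s ^ k"
      using R s by (simp add: u_def B'_def norm_divide norm_power z field_simps)
  qed (use that in auto)
  have "cmod (arc_coeff (q 0) k) \<le> B' / s ^ k" for k using u_bound[of 0 k] R by (simp add: u_def)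
  then show "\<exists>s>0. \<exists>B. \<forall>k. cmod (arc_coeff (q 0) k) \<le> B / s ^ k" using s by blast
  have B'0: "B' \<ge> 0" using u_bound[of 0 0] R by (simp) (meson norm_ge_zero order_trans)
  \<comment> \<open>Halving the radius in h makes the terms decay like (1/2)^k.\<close>
  have "(\<lambda>t. F h (g t) - t ^ K * arc_function (q 0) h) \<in> O[at 0](\<lambda>t. t ^ (K + 1))" if h: "cmod (h - h0) < s / 2" for h
  proof -
    have "summable (\<lambda>k. B' * (1 / 2) ^ k)" by (intro summable_mult summable_geometric) auto
    then have Msum: "(\<lambda>k. B' * (1 / 2) ^ k) summable_on UNIV"
      using B'0 by (subst summable_on_UNIV_nonneg_real_iff) auto
    have bound: "cmod (u k t * (h - h0) ^ k) \<le> B' * (1 / 2) ^ k" if "t \<in> ball 0 R" for k t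
    proof -
      have "cmod (u k t * (h - h0) ^ k) \<le> B' / s ^ k * (s / 2) ^ k"
        unfolding norm_mult norm_power using u_bound[of t k] that h B'0 s
        by (intro mult_mono power_mono) auto
      then show ?thesis using s by (simp add: power_divide)
    qed
    define U where "U t = (\<Sum>\<^sub>\<infinity>k. u k t * (h - h0) ^ k)" for t
    have U: "((\<lambda>k. u k t * (h - h0) ^ k) has_sum U t) UNIV" if "t \<in> ball 0 R" for t
    proof -
      have "(\<lambda>k. cmod (u k t * (h - h0) ^ k)) summable_on UNIV"
        by (rule summable_on_comparison_test[OF Msum bound[OF that]]) auto
      then show ?thesis unfolding U_def by (rule has_sum_infsum[OF abs_summable_summable])
    qed
    have "U holomorphic_on ball 0 R"
    proof (rule holomorphic_on_infsum[OF _ bound Msum U])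
      show "(\<lambda>t. u k t * (h - h0) ^ k) holomorphic_on ball 0 R" for k
        using R ball_subset_cball by (intro holomorphic_intros holomorphic_on_subset[OF u_hol]) auto
    qed
    then have U_an: "U analytic_on {0}" using R(1) by (intro holomorphic_on_imp_analytic_at[of _ "ball 0 R"]) auto
    have U0: "U 0 = arc_function (q 0) h"
      using has_sum_imp_sums[OF U[of 0]] R(1) by (simp add: arc_function_def u_def sums_iff)
    have FU: "F h (g t) = t ^ K * U t" if t: "t \<in> ball 0 R" "t \<noteq> 0" for t
    proof -
      have "(\<lambda>k. t ^ K * (u k t * (h - h0) ^ k)) sums (t ^ K * U t)"
        by (intro sums_mult has_sum_imp_sums U t)
      moreover have "t ^ K * (u k t * (h - h0) ^ k) = taylor_coeff F h0 k (g t) * (h - h0) ^ k" for k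
        using t by (simp add: u_def D_def)
      moreover have "(\<lambda>k. taylor_coeff F h0 k (g t) * (h - h0) ^ k) sums F h (g t)"
      proof (rule TF)
        have "t \<in> ball 0 \<rho>" using t R by (meson ball_subset_cball subsetD)
        then show "\<forall>i. cmod (g t $ i - a $ i) \<le> s" using \<rho>(3) by blast
      qed (use h s in simp)
      ultimately show ?thesis by (simp add: sums_unique2)
    qed
    have "\<forall>\<^sub>F t in at 0. t ^ K * U t - t ^ K * U 0 = F h (g t) - t ^ K * arc_function (q 0) h"
      using eventually_at_in_open[of "ball 0 R" "0 :: complex"] R(1)
      by (simp, elim eventually_mono) (simp add: FU U0)
    then show ?thesis using analytic_bigo[OF U_an, of K] by (simp add: landau_o.big.in_cong)
  qed
  then show "\<forall>\<^sub>F h in nhds h0. (\<lambda>t. F h (g t) - t ^ K * arc_function (q 0) h) \<in> O[at 0](\<lambda>t. t ^ (K + 1))"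
    using eventually_nhds_in_open[of "ball h0 (s / 2)" h0] s
    by (simp, elim eventually_mono) (simp add: dist_norm norm_minus_commute)
qed

lemma arc_coeff_scale: "arc_coeff (c *s p) k = c * arc_coeff p k"
  by (simp add: arc_coeff_def sum_distrib_left mult_ac)

lemma arc_function_sums:
  assumes "s > 0" "\<And>k. cmod (arc_coeff p k) \<le> B / s ^ k" "cmod (h - h0) < s"
  shows "(\<lambda>k. arc_coeff p k * (h - h0) ^ k) sums arc_function p h"
proof -
  have "summable (\<lambda>k. B * (cmod (h - h0) / s) ^ k)"
    using assms by (intro summable_mult summable_geometric) auto
  then have "summable (\<lambda>k. arc_coeff p k * (h - h0) ^ k)"
  proof (rule summable_comparison_test'[where N = 0])
    fix k
    have "cmod (arc_coeff p k * (h - h0) ^ k) \<le> B / s ^ k * cmod (h - h0) ^ k"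
      unfolding norm_mult norm_power by (intro mult_right_mono assms) auto
    then show "cmod (arc_coeff p k * (h - h0) ^ k) \<le> B * (cmod (h - h0) / s) ^ k" by (simp add: power_divide)
  qed
  then show ?thesis by (simp add: arc_function_def summable_sums)
qed

text \<open>Equality is claimed only near \<open>h0\<close>, where the estimate makes the defining
  series converge.\<close>

lemma arc_function_scale:
  assumes "s > 0" "\<And>k. cmod (arc_coeff p k) \<le> B / s ^ k"
  shows "\<forall>\<^sub>F h in nhds h0. arc_function (c *s p) h = c * arc_function p h"
proof -
  have "arc_function (c *s p) h = c * arc_function p h" if "cmod (h - h0) < s" for h
    using sums_mult[OF arc_function_sums[OF assms that], of c] by (simp add: arc_function_def[of "c *s p"] arc_coeff_scale sums_iff mult_ac)
  then show ?thesis
    using eventually_nhds_in_open[of "ball h0 s" h0] assms(1)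
    by (simp, elim eventually_mono) (simp add: dist_norm norm_minus_commute)
qed

lemma arc_coeff_eq_0:
  assumes "s > 0" "\<And>k. cmod (arc_coeff p k) \<le> B / s ^ k" "\<forall>\<^sub>F h in nhds h0. arc_function p h = 0"
  shows "arc_coeff p k = 0"
proof -
  have "\<forall>\<^sub>F u in nhds 0. (\<lambda>k. fps_nth (Abs_fps (arc_coeff p)) k * u ^ k) sums arc_function p (h0 + u)"
    using eventually_nhds_in_open[of "ball 0 s" "0 :: complex"] assms(1)
  proof (simp, elim eventually_mono)
    fix u :: complex assume "cmod u < s"
    then show "(\<lambda>k. arc_coeff p k * u ^ k) sums arc_function p (h0 + u)" using arc_function_sums[OF assms(1,2), of "h0 + u"] by simp
  qed
  then have 1: "(\<lambda>u. arc_function p (h0 + u)) has_fps_expansion Abs_fps (arc_coeff p)" by (rule has_fps_expansionI)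
  have "filterlim (\<lambda>u. h0 + u) (nhds h0) (nhds 0)"
    using tendsto_add[OF tendsto_const[of h0] filterlim_ident, of 0] by simp
  then have "\<forall>\<^sub>F u in nhds 0. arc_function p (h0 + u) = 0" by (rule eventually_compose_filterlim[OF assms(3)])
  then have 2: "(\<lambda>u. arc_function p (h0 + u)) has_fps_expansion 0" by (simp add: has_fps_expansion_0_iff)
  show ?thesis using fps_nth_fps_expansion[OF 1, of k] fps_nth_fps_expansion[OF 2, of k] by simp
qed

text \<open>Here the other inclusion of the germ ideals enters: v_j is a combination of Taylor
  coefficients of \<open>F\<close>. If all of these are o(t^K) along the arc, so is v_j.\<close>

lemma leading_vector_zero:
  assumes g: "analytic_arc g" "g 0 = a" and q: "analytic_arc q"
    and eq: "\<forall>\<^sub>F t in nhds 0. poly_map v (g t) = t ^ K *s q t"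
    and L: "finite L" "\<And>k. k \<in> L \<Longrightarrow> analytic_germ (b k) a"
      "\<forall>\<^sub>F x in nhds a. ev (v j) (vec_nth x) = (\<Sum>k\<in>L. b k x * taylor_coeff F h0 k x)"
    and A0: "\<And>k. arc_coeff (q 0) k = 0"
  shows "q 0 $ j = 0"
proof -
  have T: "((\<lambda>t. taylor_coeff F h0 k (g t) / t ^ K) \<longlongrightarrow> 0) (at 0)" for k
  proof -
    obtain w where w: "w analytic_on {0}" "w 0 = arc_coeff (q 0) k" "\<forall>\<^sub>F t in nhds 0. taylor_coeff F h0 k (g t) = t ^ K * w t"
      using taylor_coeff_arc[OF g q eq] by blast
    have "(w \<longlongrightarrow> 0) (at 0)" using analytic_at_imp_isCont[OF w(1)] w(2) A0 by (simp add: isCont_def)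
    moreover have "\<forall>\<^sub>F t in at 0. w t = taylor_coeff F h0 k (g t) / t ^ K"
      using w(3) eventually_neq_at_within[of 0 0 UNIV] unfolding eventually_nhds_conv_at
      by (auto elim: eventually_elim2)
    ultimately show ?thesis by (rule Lim_transform_eventually)
  qed
  have bt: "((\<lambda>t. b k (g t)) \<longlongrightarrow> b k a) (at 0)" if "k \<in> L" for k
    using analytic_at_imp_isCont[OF analytic_germ_compose[of "b k" g]] L(2)[OF that] g by (simp add: isCont_def)
  have "((\<lambda>t. \<Sum>k\<in>L. b k (g t) * (taylor_coeff F h0 k (g t) / t ^ K)) \<longlongrightarrow> (\<Sum>k\<in>L. b k a * 0)) (at 0)"
    by (intro tendsto_intros bt T)
  moreover have "\<forall>\<^sub>F t in at 0. (\<Sum>k\<in>L. b k (g t) * (taylor_coeff F h0 k (g t) / t ^ K)) = q t $ j"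
  proof -
    have "\<forall>\<^sub>F t in nhds 0. ev (v j) (vec_nth (g t)) = (\<Sum>k\<in>L. b k (g t) * taylor_coeff F h0 k (g t))"
      using eventually_compose_filterlim[OF L(3) analytic_arc_filterlim[OF g(1), unfolded g(2)]] .
    then have "\<forall>\<^sub>F t in at 0. ev (v j) (vec_nth (g t)) = (\<Sum>k\<in>L. b k (g t) * taylor_coeff F h0 k (g t))"
      "\<forall>\<^sub>F t in at 0. poly_map v (g t) = t ^ K *s q t" using eq by (simp_all add: eventually_nhds_conv_at)
    then show ?thesis using eventually_neq_at_within[of 0 0 UNIV]
    proof eventually_elim
      case (elim t)
      have "t ^ K * q t $ j = (\<Sum>k\<in>L. b k (g t) * taylor_coeff F h0 k (g t))"
        using elim(1,2) by (simp add: poly_map_def vec_eq_iff)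
      then have "(\<Sum>k\<in>L. b k (g t) * taylor_coeff F h0 k (g t)) / t ^ K = q t $ j" using elim(3) by (simp add: field_simps)
      then show ?case by (simp add: sum_divide_distrib)
    qed
  qed
  ultimately have "((\<lambda>t. q t $ j) \<longlongrightarrow> 0) (at 0)" by (auto intro: Lim_transform_eventually)
  then show ?thesis using analytic_arc_tendsto[OF q, of j] LIM_unique by blast
qed

end

section \<open>Arcs through a common point of the exceptional locus\<close>

lemma analytic_arc_poly_map: "analytic_arc g \<Longrightarrow> analytic_arc (\<lambda>t. poly_map v (g t))"
  unfolding analytic_arc_def[of "\<lambda>t. poly_map v (g t)"]
  by (simp add: poly_map_def analytic_germ_compose[OF analytic_germ_poly])

text \<open>An arc on the blowup has its own projective lift l, while q comes from v. The minors x_i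
  v_j - x_j v_i vanish on the blowup, so l and q are parallel for t nonzero and, in the limit, at t
  = 0. Hence the leading vector of v represents the starting point.\<close>

lemma blowup_arc_lift:
  fixes v :: "'N::finite \<Rightarrow> 'n::finite cpoly"
  assumes arc: "blowup_arc v \<alpha>" and ord: "has_arc_order v \<alpha> k" and start: "\<alpha> 0 = (a, proj_class p)" and p: "p \<noteq> 0"
  shows "\<exists>q c. analytic_arc (\<lambda>t. fst (\<alpha> t)) \<and> analytic_arc q \<and> c \<noteq> 0 \<and> q 0 = c *s p \<and>
    (\<forall>\<^sub>F t in nhds 0. poly_map v (fst (\<alpha> t)) = t ^ k *s q t)"
proof -
  let ?g = "\<lambda>t. fst (\<alpha> t)"
  have g: "analytic_arc ?g" using arc by (simp add: blowup_arc_def)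
  obtain l where l: "analytic_arc l" "\<forall>\<^sub>F t in nhds 0. l t \<noteq> 0 \<and> snd (\<alpha> t) = proj_class (l t)"
    using arc unfolding blowup_arc_def by blast
  have bl: "\<forall>\<^sub>F t in nhds 0. \<alpha> t \<in> blowup v" using arc unfolding blowup_arc_def by blast
  obtain p' where p': "p' \<noteq> 0" "\<And>j. (\<lambda>t. poly_map v (?g t) $ j - t ^ k * p' $ j) \<in> O[at 0](\<lambda>t. t ^ (k + 1))"
    using ord unfolding has_arc_order_def by blast
  note lim = leading_coeff_tendsto[OF p'(2)]
  have nz: "\<not> (\<forall>\<^sub>F t in nhds 0. poly_map v (?g t) = 0)"
  proof
    assume "\<forall>\<^sub>F t in nhds 0. poly_map v (?g t) = 0"
    then have "\<forall>\<^sub>F t in at 0. poly_map v (?g t) = 0" by (simp add: eventually_nhds_conv_at)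
    then have "((\<lambda>t. poly_map v (?g t) $ j / t ^ k) \<longlongrightarrow> 0) (at 0)" for j
      by (intro tendsto_eventually) (auto elim: eventually_mono)
    then have "p' $ j = 0" for j using LIM_unique[OF lim] by blast
    then show False using p'(1) by (simp add: vec_eq_iff)
  qed
  obtain K q where q: "analytic_arc q" "q 0 \<noteq> 0" and eq: "\<forall>\<^sub>F t in nhds 0. poly_map v (?g t) = t ^ K *s q t"
    using analytic_arc_factor[OF analytic_arc_poly_map[OF g] nz] by blast
  have limK: "((\<lambda>t. poly_map v (?g t) $ j / t ^ K) \<longlongrightarrow> q 0 $ j) (at 0)" for j
  proof -
    have "\<forall>\<^sub>F t in at 0. q t $ j = poly_map v (?g t) $ j / t ^ K"
      using eq eventually_neq_at_within[of 0 0 UNIV] unfolding eventually_nhds_conv_at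
      by (auto elim: eventually_elim2)
    then show ?thesis by (rule Lim_transform_eventually[OF analytic_arc_tendsto[OF q(1)]])
  qed
  \<comment> \<open>Of two different exponents the smaller one would carry a zero leading
    vector.\<close>
  have "K = k"
  proof (rule linorder_cases[of K k])
    assume "K < k"
    then have "q 0 $ j = 0" for j using tendsto_lower_order[OF lim] limK LIM_unique by blast
    then show ?thesis using q(2) by (simp add: vec_eq_iff)
  next
    assume "k < K"
    then have "p' $ j = 0" for j using tendsto_lower_order[OF limK] lim LIM_unique by blast
    then show ?thesis using p'(1) by (simp add: vec_eq_iff)
  qed
  have par: "l 0 $ i * q 0 $ j = l 0 $ j * q 0 $ i" for i j
  proof -
    define f :: "('n + 'N) cpoly" where
      "f = PV (Inr i) * peval PC (v j) (\<lambda>m. PV (Inl m)) - PV (Inr j) * peval PC (v i) (\<lambda>m. PV (Inl m))"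
    have hf: "homogeneous_snd (1 + 0) f"
      unfolding f_def by (intro homogeneous_snd_diff homogeneous_snd_mult homogeneous_snd_Inr homogeneous_snd_lift)
    have vf: "\<forall>mu. ev f (case_sum (vec_nth mu) (vec_nth (poly_map v mu))) = 0 \<or> poly_map v mu = 0"
      by (simp add: f_def poly_map_def)
    have "\<forall>\<^sub>F t in at 0. l t \<noteq> 0 \<and> snd (\<alpha> t) = proj_class (l t)" "\<forall>\<^sub>F t in at 0. \<alpha> t \<in> blowup v"
      "\<forall>\<^sub>F t in at 0. poly_map v (?g t) = t ^ K *s q t"
      using l(2) bl eq by (simp_all add: eventually_nhds_conv_at)
    then have "\<forall>\<^sub>F t in at 0. l t $ i * q t $ j = l t $ j * q t $ i"
      using eventually_neq_at_within[of 0 0 UNIV]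
    proof eventually_elim
      case (elim t)
      have "(fst (\<alpha> t), proj_class (l t)) \<in> blowup v" using elim by (metis prod.collapse)
      then have "ev f (case_sum (vec_nth (?g t)) (vec_nth (l t))) = 0"
        using elim hf vf by (subst (asm) blowup_iff) blast+
      then have "l t $ i * poly_map v (?g t) $ j = l t $ j * poly_map v (?g t) $ i"
        by (simp add: f_def poly_map_def)
      then show ?case using elim by (simp add: mult_ac)
    qed
    moreover have lims: "((\<lambda>t. l t $ i * q t $ j) \<longlongrightarrow> l 0 $ i * q 0 $ j) (at 0)" "((\<lambda>t. l t $ j * q t $ i) \<longlongrightarrow> l 0 $ j * q 0 $ i) (at 0)"
      by (intro tendsto_intros analytic_arc_tendsto l q)+
    ultimately have "((\<lambda>t. l t $ j * q t $ i) \<longlongrightarrow> l 0 $ i * q 0 $ j) (at 0)"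
      by (intro Lim_transform_eventually[OF lims(1)])
    then show ?thesis using lims(2) by (rule LIM_unique)
  qed
  have l0: "l 0 \<noteq> 0" "proj_class p = proj_class (l 0)"
    using eventually_nhds_x_imp_x[OF l(2)] start by auto
  then obtain d where d: "d \<noteq> 0" "l 0 = d *s p" using proj_class_eq_iff[OF p] by blast
  obtain i where i: "l 0 $ i \<noteq> 0" using l0(1) by (auto simp: vec_eq_iff)
  have q0: "q 0 = (q 0 $ i / l 0 $ i) *s l 0"
    using par[of i] i by (simp add: vec_eq_iff field_simps)
  then have "q 0 $ i / l 0 $ i \<noteq> 0" using q(2) by (metis vector_smult_lzero)
  then have "q 0 $ i / l 0 $ i * d \<noteq> 0" using d(1) by simp
  moreover have "q 0 = (q 0 $ i / l 0 $ i * d) *s p" using q0 d(2) by (metis vector_smult_assoc)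
  ultimately show ?thesis using g q(1) eq \<open>K = k\<close> by blast
qed

theorem minimal_order_le_fibre_order:
  fixes v :: "'N::finite \<Rightarrow> 'n::finite cpoly"
  assumes germ2: "analytic_germ2 F h0 a"
    and sheaf: "\<And>k. analytic_germ (taylor_coeff F h0 k) a"
    and generators: "germ_ideal a (range (taylor_coeff F h0)) = germ_ideal a (range (\<lambda>j lam. ev (v j) (vec_nth lam)))"
    and bif: "bifurcation_function F h0 a k M"
  shows "enat (minimal_order F h0 a M) \<le> fibre_order v a"
proof -
  let ?P = "\<lambda>j lam. ev (v j) (vec_nth lam)"
  have "\<forall>k. \<exists>J c. (\<forall>j\<in>J. analytic_germ (c j) a) \<and> (\<forall>\<^sub>F x in nhds a. taylor_coeff F h0 k x = (\<Sum>j\<in>J. c j x * ?P j x))"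
    using germ_ideal_indexed[of _ a ?P] germ_ideal_generator[of "taylor_coeff F h0", OF sheaf] unfolding generators by blast
  then have "\<exists>J. \<forall>k. \<exists>c. (\<forall>j\<in>J k. analytic_germ (c j) a) \<and> (\<forall>\<^sub>F x in nhds a. taylor_coeff F h0 k x = (\<Sum>j\<in>J k. c j x * ?P j x))"
    by (rule choice)
  then obtain J where "\<forall>k. \<exists>c. (\<forall>j\<in>J k. analytic_germ (c j) a) \<and> (\<forall>\<^sub>F x in nhds a. taylor_coeff F h0 k x = (\<Sum>j\<in>J k. c j x * ?P j x))"
    by blast
  then have "\<exists>C. \<forall>k. (\<forall>j\<in>J k. analytic_germ (C k j) a) \<and> (\<forall>\<^sub>F x in nhds a. taylor_coeff F h0 k x = (\<Sum>j\<in>J k. C k j x * ?P j x))"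
    by (rule choice)
  then obtain C where C: "\<And>k j. j \<in> J k \<Longrightarrow> analytic_germ (C k j) a"
    "\<And>k. \<forall>\<^sub>F x in nhds a. taylor_coeff F h0 k x = (\<Sum>j\<in>J k. C k j x * ?P j x)" by blast
  have inv: "\<exists>L b. finite L \<and> (\<forall>k\<in>L. analytic_germ (b k) a) \<and> (\<forall>\<^sub>F x in nhds a. ?P j x = (\<Sum>k\<in>L. b k x * taylor_coeff F h0 k x))" for j
    using germ_ideal_indexed[of "?P j" a "taylor_coeff F h0"] germ_ideal_generator[of ?P j a] analytic_germ_poly
    unfolding generators by blast
  interpret dg: displacement_germ F h0 a v J C
    using germ2 C by unfold_locales
  obtain g where g: "analytic_arc g" "g 0 = a"
    and Fg: "\<forall>\<^sub>F h in nhds h0. (\<lambda>t. F h (g t) - t ^ k * M h) \<in> O[at 0](\<lambda>t. t ^ (k + 1))"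
    and M0: "\<not> (\<forall>\<^sub>F h in nhds h0. M h = 0)"
    using bif unfolding bifurcation_function_def by blast
  have nz: "\<not> (\<forall>\<^sub>F t in nhds 0. poly_map v (g t) = 0)"
  proof
    assume "\<forall>\<^sub>F t in nhds 0. poly_map v (g t) = 0"
    \<comment> \<open>With leading vector 0 and exponent k + 1 the expansion makes \<open>F\<close>
      vanish along \<open>g\<close> beyond order k, so \<open>M\<close> would be zero.\<close>
    then have "\<forall>\<^sub>F t in nhds 0. poly_map v (g t) = t ^ (k + 1) *s (\<lambda>_. 0) t" by simp
    moreover have "analytic_arc (\<lambda>_. 0 :: complex^'N)" by (simp add: analytic_arc_def)
    ultimately have "\<forall>\<^sub>F h in nhds h0. (\<lambda>t. F h (g t) - t ^ (k + 1) * dg.arc_function 0 h) \<in> O[at 0](\<lambda>t. t ^ (k + 1 + 1))"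
      using dg.expansion(1)[OF g] by blast
    with Fg have "\<forall>\<^sub>F h in nhds h0. M h = 0"
      by eventually_elim (rule leading_coeff_vanishes, assumption+, simp)
    then show False using M0 by blast
  qed
  obtain K q where q: "analytic_arc q" "q 0 \<noteq> 0" and eq: "\<forall>\<^sub>F t in nhds 0. poly_map v (g t) = t ^ K *s q t"
    using analytic_arc_factor[OF analytic_arc_poly_map[OF g(1)] nz] by blast
  note ex = dg.expansion(1)[OF g q(1) eq]
  obtain s B where sB: "s > 0" "\<And>k. cmod (dg.arc_coeff (q 0) k) \<le> B / s ^ k"
    using dg.expansion(2)[OF g q(1) eq] by blast
  have Mnz: "\<not> (\<forall>\<^sub>F h in nhds h0. dg.arc_function (q 0) h = 0)"
  proof
    assume "\<forall>\<^sub>F h in nhds h0. dg.arc_function (q 0) h = 0"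
    then have A0: "dg.arc_coeff (q 0) k = 0" for k using dg.arc_coeff_eq_0[OF sB] by blast
    have "q 0 $ j = 0" for j
    proof -
      obtain L b where L: "finite L" "\<And>k. k \<in> L \<Longrightarrow> analytic_germ (b k) a"
        "\<forall>\<^sub>F x in nhds a. ?P j x = (\<Sum>k\<in>L. b k x * taylor_coeff F h0 k x)" using inv[of j] by blast
      show ?thesis by (rule dg.leading_vector_zero[OF g q(1) eq L A0])
    qed
    then show False using q(2) by (simp add: vec_eq_iff)
  qed
  have Kk: "K = k"
  proof (rule linorder_cases[of K k])
    assume "K < k"
    from ex Fg have "\<forall>\<^sub>F h in nhds h0. dg.arc_function (q 0) h = 0"
      by eventually_elim (rule leading_coeff_vanishes[OF _ _ \<open>K < k\<close>], assumption+)
    then show ?thesis using Mnz by blast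
  next
    assume "k < K"
    from ex Fg have "\<forall>\<^sub>F h in nhds h0. M h = 0"
      by eventually_elim (rule leading_coeff_vanishes[OF _ _ \<open>k < K\<close>], assumption+)
    then show ?thesis using M0 by blast
  qed
  have MM: "\<forall>\<^sub>F h in nhds h0. dg.arc_function (q 0) h = M h"
    using ex Fg unfolding Kk by eventually_elim (rule leading_coeff_unique, assumption+)
  show ?thesis
  proof (cases "k = 0")
    \<comment> \<open>For order 0 the vector v(a) is nonzero and there is no exceptional point over
      \<open>a\<close>; the minimal order is then 0 and the bound is trivial.\<close>
    case True
    have "minimal_order F h0 a M \<le> k"
      unfolding minimal_order_def by (rule Least_le) (use bif in \<open>auto intro!: exI[of _ 1]\<close>)
    then show ?thesis using True by (simp flip: zero_enat_def)
  next
    case False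
    then have K1: "K \<ge> 1" using Kk by simp
    have exc: "(a, proj_class (q 0)) \<in> exceptional v"
      using blowup_arc_of_lift(3)[OF g(1) q K1 eq] g(2) by simp
    have "enat (minimal_order F h0 a M) \<le> point_order v (a, proj_class (q 0))"
      unfolding point_order_def
    \<comment> \<open>An admissible arc through the same point has a leading vector c q(0), hence
      the bifurcation function c M of order k', so k' bounds the minimal order.\<close>
    proof (rule Inf_greatest, clarify)
      fix k' \<alpha>
      assume \<alpha>: "blowup_arc v \<alpha>" "\<alpha> 0 = (a, proj_class (q 0))" "has_arc_order v \<alpha> k'"
      obtain q' c where g': "analytic_arc (\<lambda>t. fst (\<alpha> t))" and q': "analytic_arc q'" and c: "c \<noteq> 0" "q' 0 = c *s q 0"
        and eq': "\<forall>\<^sub>F t in nhds 0. poly_map v (fst (\<alpha> t)) = t ^ k' *s q' t"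
        using blowup_arc_lift[OF \<alpha>(1,3,2) q(2)] by blast
      have g'0: "fst (\<alpha> 0) = a" using \<alpha>(2) by simp
      have "\<forall>\<^sub>F h in nhds h0. (\<lambda>t. F h (fst (\<alpha> t)) - t ^ k' * (c * M h)) \<in> O[at 0](\<lambda>t. t ^ (k' + 1))"
        using dg.expansion(1)[OF g' g'0 q' eq'] dg.arc_function_scale[OF sB, of c] MM
        by eventually_elim (simp add: c(2))
      moreover have "\<not> (\<forall>\<^sub>F h in nhds h0. c * M h = 0)" using M0 c(1) by simp
      ultimately have "bifurcation_function F h0 a k' (\<lambda>h. c * M h)"
        unfolding bifurcation_function_def using g' g'0 by blast
      then have "minimal_order F h0 a M \<le> k'"
        unfolding minimal_order_def using c(1) by (intro Least_le) blast
      then show "enat (minimal_order F h0 a M) \<le> enat k'" by simp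
    qed
    also have "\<dots> \<le> fibre_order v a"
      unfolding fibre_order_def using exc by (intro SUP_upper) auto
    finally show ?thesis .
  qed
qed

theorem corollary4:
  fixes d :: nat
    and idx :: "'n::finite \<Rightarrow> bool \<times> nat \<times> nat"
    and \<sigma> :: "real \<Rightarrow> real \<times> real"
    and h\<^sub>0 :: real
    and F :: "complex \<Rightarrow> complex^'n \<Rightarrow> complex"
    and U :: "(complex^'n) set"
    and v :: "'N::finite \<Rightarrow> 'n cpoly"
  assumes coeffs: "coeff_indexing d idx"
    and U: "open U"
    and displ: "\<And>lam. lam \<in> U \<Longrightarrow> annulus_through idx lam \<sigma> h\<^sub>0 \<Longrightarrow> displacement idx lam \<sigma> h\<^sub>0 F"
    and sheaf: "\<And>k lam. lam \<in> U \<Longrightarrow> analytic_germ (taylor_coeff F (of_real h\<^sub>0) k) lam"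
    and generators: "\<And>lam. lam \<in> U \<Longrightarrow>
      germ_ideal lam (range (taylor_coeff F (of_real h\<^sub>0))) =
      germ_ideal lam (range (\<lambda>j lam. cpoly_eval (v j) (vec_nth lam)))"
  shows "(\<forall>lam\<^sub>0\<in>U. annulus_through idx lam\<^sub>0 \<sigma> h\<^sub>0 \<longrightarrow>
            (\<forall>k M. bifurcation_function F (of_real h\<^sub>0) lam\<^sub>0 k M \<longrightarrow>
               enat (minimal_order F (of_real h\<^sub>0) lam\<^sub>0 M) \<le> fibre_order v lam\<^sub>0)) \<and>
         (SUP lam\<in>U \<inter> zero_set (ideal_of v). fibre_order v lam) < \<infinity>"
proof (intro conjI ballI impI allI)
  fix lam\<^sub>0 k M
  assume lam: "lam\<^sub>0 \<in> U" "annulus_through idx lam\<^sub>0 \<sigma> h\<^sub>0" and bif: "bifurcation_function F (of_real h\<^sub>0) lam\<^sub>0 k M"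
  have "analytic_germ2 F (of_real h\<^sub>0) lam\<^sub>0" using displ[OF lam] by (simp add: displacement_def)
  from minimal_order_le_fibre_order[OF this sheaf[OF lam(1)] generators[OF lam(1)] bif]
  show "enat (minimal_order F (of_real h\<^sub>0) lam\<^sub>0 M) \<le> fibre_order v lam\<^sub>0" .
next
  obtain K where K: "\<And>lam. fibre_order v lam \<le> enat K" using fibre_order_bounded by blast
  have "(SUP lam\<in>U \<inter> zero_set (ideal_of v). fibre_order v lam) \<le> enat K" by (intro SUP_least K)
  also have "\<dots> < \<infinity>" by simp
  finally show "(SUP lam\<in>U \<inter> zero_set (ideal_of v). fibre_order v lam) < \<infinity>" .
qed

end
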